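(* Let $\mathcal{H}=\bigoplus_{n\ge 0}\mathcal{H}_n$ be a graded connected Hopf algebra over $\mathbb{R}$ with each $\mathcal{H}_n$ finite-dimensional, and let $a\ge 2$ be an integer. (A) Suppose $\mathcal{H}$ is commutative, and let $\mathcal{C}$ be a (homogeneous) free generating set for $\mathcal{H}$. Then $\{e(c_1)\cdots e(c_k) : k\in\mathbb{N},\ \{c_1,\dots,c_k\}\text{ a multiset in }\mathcal{C}\}$ is a basis of $\mathcal{H}$ consisting of eigenvectors of $\Psi^a$, and $e(c_1)\cdots e(c_k)$ has eigenvalue $a^k$. So the multiplicity of the eigenvalue $a^k$ of $\Psi^a$ on $\mathcal{H}_n$ is the coefficient of $x^ny^k$ in $\prod_{c\in\mathcal{C}}(1-yx^{\deg c})^{-1}$. (B) Suppose $\mathcal{H}$ is cocommutative, and let $\mathcal{P}$ be a (homogeneous) basis of its primitive subspace. Then $\left\{\frac{1}{k!}\sum_{\sigma\in\mathfrak{S}_k}p_{\sigma(1)}\cdots p_{\sigma(k)} : k\in\mathbb{N},\ \{p_1,\dots,p_k\}\text{ a multiset in }\mathcal{P}\right\}$ is a basis of $\mathcal{H}$ consisting of eigenvectors of $\Psi^a$, and $\frac{1}{k!}\sum_{\sigma\in\mathfrak{S}_k}p_{\sigma(1)}\cdots p_{\sigma(k)}$ has eigenvalue $a^k$. So the multiplicity of the eigenvalue $a^k$ of $\Psi^a$ on $\mathcal{H}_n$ is the coefficient of $x^ny^k$ in $\prod_{p\in\mathcal{P}}(1-yx^{\deg p})^{-1}$. (A$'$)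 Suppose $\mathcal{H}$ is commutative and is isomorphic, as a non-graded algebra only, to the shuffle algebra, and write $P_w$ for the image in $\mathcal{H}$ of the word $w$ under this isomorphism (so $\{P_w\}$ is a basis of $\mathcal{H}$ indexed by words, with $P_wP_{w'}=\sum_vP_v$, summing over all interleavings $v$ of $w$ and $w'$ with multiplicity); each $P_w$ with $w$ non-empty is homogeneous of positive degree. Define $g_w\in\mathcal{H}$ recursively by $g_w:=e(P_w)$ if $w$ is a Lyndon word, and $g_w:=g_{u_1}\cdots g_{u_k}$ if $w$ has Lyndon factorisation $w=u_1\cdot\ldots\cdot u_k$. Then $\{g_w\}$ is a basis of $\mathcal{H}$ consisting of eigenvectors of $\Psi^a$, and $g_w$ has eigenvalue $a^{k(w)}$, where $k(w)$ is the number of factors in the Lyndon factorisation of $w$. So the multiplicity of the eigenvalue $a^k$ of $\Psi^a$ on $\mathcal{H}_n$ is the coefficient of $x^ny^k$ in $\prod_{w\text{ Lyndon}}(1-yx^{\deg P_w})^{-1}$. (B$'$) Suppose $\mathcal{H}$ is cocommutative and is isomorphic, as a non-graded algebra only, to the free associative algebra $\mathbb{R}\langle S_1,S_2,\dots\rangle$, where (the images in $\mathcal{H}$ of) the $S_i$ are homogeneous of positive degree. For a word $w=w_1\cdots w_l$ write $S_w:=S_{w_1}\cdots S_{w_l}$. Define $g_w\in\mathcal{H}$ recursively by $g_w:=e(S_w)$ if $w$ is a single letter; $g_w:=g_{u_1}g_{u_2}-g_{u_2}g_{u_1}$ if $w$ is Lyndon (of length at least 2) with standard factorisation $w=u_1u_2$;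 $g_w:=\frac{1}{k!}\sum_{\sigma\in\mathfrak{S}_k}g_{u_{\sigma(1)}}\cdots g_{u_{\sigma(k)}}$ if $w$ has Lyndon factorisation $w=u_1\cdot\ldots\cdot u_k$. Then $\{g_w\}$ is a basis of $\mathcal{H}$ consisting of eigenvectors of $\Psi^a$, and $g_w$ has eigenvalue $a^{k(w)}$, where $k(w)$ is the number of factors in the Lyndon factorisation of $w$. So the multiplicity of the eigenvalue $a^k$ of $\Psi^a$ on $\mathcal{H}_n$ is the coefficient of $x^ny^k$ in $\prod_{w\text{ Lyndon}}(1-yx^{\deg S_w})^{-1}$.
   Context: A graded connected Hopf algebra over $\mathbb{R}$ is $\mathcal{H}=\bigoplus_{n\ge0}\mathcal{H}_n$ with $\mathcal{H}_0=\mathbb{R}\cdot1$, an associative unital product $m:\mathcal{H}_i\otimes\mathcal{H}_j\to\mathcal{H}_{i+j}$ and a coassociative coproduct $\Delta:\mathcal{H}_n\to\bigoplus_{j=0}^n\mathcal{H}_j\otimes\mathcal{H}_{n-j}$ with $\Delta(1)=1\otimes1$, $\Delta(x)-1\otimes x-x\otimes1\in\bigoplus_{j=1}^{n-1}\mathcal{H}_j\otimes\mathcal{H}_{n-j}$ for $x\in\mathcal{H}_n$ ($n\ge1$), and $\Delta(wz)=\Delta(w)\Delta(z)$. Commutative: $wz=zw$; cocommutative: $\Delta(x)$ is invariant under swapping tensor factors. For $x\in\mathcal{H}_n$, $\deg x=n$. $m^{[a]}:\mathcal{H}^{\otimes a}\to\mathcal{H}$ and $\Delta^{[a]}:\mathcal{H}\to\mathcal{H}^{\otimes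 a}$ are the $a$-fold product and coproduct ($m^{[1]}=\Delta^{[1]}=\mathrm{id}$), and the $a$th Hopf-power map is $\Psi^a:=m^{[a]}\Delta^{[a]}$; it preserves degree. An element $x$ is primitive if $\Delta(x)=1\otimes x+x\otimes 1$. For $x$ of positive degree the reduced coproduct is $\bar\Delta(x):=\Delta(x)-1\otimes x-x\otimes1$, $\bar\Delta^{[1]}:=\mathrm{id}$, $\bar\Delta^{[r]}:=(\mathrm{id}\otimes\cdots\otimes\mathrm{id}\otimes\bar\Delta)\bar\Delta^{[r-1]}$. The Eulerian idempotent is $e(x):=\sum_{r\ge1}\frac{(-1)^{r-1}}{r}m^{[r]}\bar\Delta^{[r]}(x)$ for $x$ of positive degree (a finite sum). A free generating set of a commutative $\mathcal{H}$ is a set $\mathcal{C}=\{c_1,c_2,\dots\}$ of homogeneous elements of positive degree with $\mathcal{H}=\mathbb{R}[c_1,c_2,\dots]$ as an algebra. Empty products equal $1$. The shuffle algebra has as basis all words in the (totally ordered) letters $\{1,2,\dots\}$ (or $\{1,\dots,N\}$), and the product of two words is the sum of all their interleavings with multiplicity. A word is Lyndon if it is lexicographically strictly smaller than all its (non-trivial) cyclic rearrangements. The Lyndon factorisation $w=u_1\cdot\ldots\cdot u_k$ (concatenation) is obtained by taking $u_k$ to be the lexicographically smallest (non-empty) tail of $w$, then $u_{k-1}$ the lexicographically smallest tail of $w$ with $u_k$ removed, and so on; equivalently it is the unique deconcatenation into Lyndon words with $u_1\ge u_2\ge\cdots\ge u_k$ lexicographically. The standard factorisation of a Lyndon word $u$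 of length greater than 1 is $u=u_1u_2$, where $u_2$ is the longest Lyndon tail of $u$ other than $u$ itself and $u_1$ is the corresponding head (which is also Lyndon). *)

theory Defs
  imports
    "HOL-Computational_Algebra.Formal_Power_Series"
    "HOL-Combinatorics.Permutations"
    "HOL-Library.Multiset"
    "HOL-Library.Poly_Mapping"
    "HOL-Library.List_Lexorder"
    "HOL-Library.Sublist"
begin

section \<open>Free vector spaces\<close>

instantiation poly_mapping :: (type, real_vector) real_vector
begin

lift_definition scaleR_poly_mapping :: "real \<Rightarrow> ('a \<Rightarrow>\<^sub>0 'b) \<Rightarrow> 'a \<Rightarrow>\<^sub>0 'b"
  is "\<lambda>r f x. r *\<^sub>R f x"
proof -
  fix r :: real and f :: "'a \<Rightarrow> 'b"
  assume "finite {x. f x \<noteq> 0}"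
  then show "finite {x. r *\<^sub>R f x \<noteq> 0}"
    by (rule rev_finite_subset) auto
qed

instance
  by (standard; transfer) (auto simp: fun_eq_iff scaleR_add_right scaleR_add_left)

end

definition free_extend :: "('a \<Rightarrow> 'b::real_vector) \<Rightarrow> ('a \<Rightarrow>\<^sub>0 real) \<Rightarrow> 'b"
  where "free_extend f p = (\<Sum>x\<in>Poly_Mapping.keys p. Poly_Mapping.lookup p x *\<^sub>R f x)"

lemma free_extend_superset:
  assumes "finite A" "Poly_Mapping.keys p \<subseteq> A"
  shows "free_extend f p = (\<Sum>x\<in>A. Poly_Mapping.lookup p x *\<^sub>R f x)"
  unfolding free_extend_def
  using assms by (intro sum.mono_neutral_left) (auto simp: in_keys_iff)

lemma lookup_scaleR [simp]: "Poly_Mapping.lookup (r *\<^sub>R p) x = r *\<^sub>R Poly_Mapping.lookup p x"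
  by transfer simp

lemma linear_free_extend: "linear (free_extend f)"
proof (rule linearI)
  fix p q :: "'a \<Rightarrow>\<^sub>0 real" and r :: real
  let ?A = "Poly_Mapping.keys p \<union> Poly_Mapping.keys q"
  have "free_extend f (p + q) = (\<Sum>x\<in>?A. Poly_Mapping.lookup (p + q) x *\<^sub>R f x)"
    by (rule free_extend_superset) (simp_all add: Poly_Mapping.keys_add)
  also have "\<dots> = (\<Sum>x\<in>?A. Poly_Mapping.lookup p x *\<^sub>R f x)
                + (\<Sum>x\<in>?A. Poly_Mapping.lookup q x *\<^sub>R f x)"
    by (simp add: lookup_add scaleR_add_left sum.distrib)
  also have "\<dots> = free_extend f p + free_extend f q"
    by (simp add: free_extend_superset[of ?A])
  finally show "free_extend f (p + q) = free_extend f p + free_extend f q" .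
  have "free_extend f (r *\<^sub>R p)
      = (\<Sum>x\<in>Poly_Mapping.keys p. Poly_Mapping.lookup (r *\<^sub>R p) x *\<^sub>R f x)"
    by (rule free_extend_superset) (auto simp: in_keys_iff)
  then show "free_extend f (r *\<^sub>R p) = r *\<^sub>R free_extend f p"
    by (simp add: free_extend_def scaleR_sum_right)
qed

lemma free_extend_single [simp]: "free_extend f (Poly_Mapping.single x 1) = f x"
  by (simp add: free_extend_def)

lemma free_extend_basis: "free_extend (\<lambda>x. Poly_Mapping.single x 1) p = p"
proof (rule poly_mapping_eqI)
  fix k
  show "Poly_Mapping.lookup (free_extend (\<lambda>x. Poly_Mapping.single x 1) p) k
      = Poly_Mapping.lookup p k"
    by (simp add: free_extend_def lookup_sum lookup_single when_def in_keys_iff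
        if_distrib cong: if_cong)
qed

section \<open>The tensor algebra of a vector space\<close>

text \<open>
  The tensor powers of a space are collected in one type, the quotient of the free vector space
  on lists by the multilinearity relations.  The tensor power of order \<open>a\<close> is the span
  of the pure tensors on lists of length \<open>a\<close>.
\<close>

definition multilinear_relations :: "('a::real_vector list \<Rightarrow>\<^sub>0 real) set"
  where "multilinear_relations = span (
    {Poly_Mapping.single (us @ (x + y) # vs) 1
      - Poly_Mapping.single (us @ x # vs) 1 - Poly_Mapping.single (us @ y # vs) 1 |us vs x y. True}
    \<union> {Poly_Mapping.single (us @ (r *\<^sub>R x) # vs) 1
      - r *\<^sub>R Poly_Mapping.single (us @ x # vs) 1 |us vs r x. True})"

lemma subspace_multilinear_relations: "subspace multilinear_relations"
  by (simp add: multilinear_relations_def)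

quotient_type (overloaded) 'a tensor_algebra =
  "'a::real_vector list \<Rightarrow>\<^sub>0 real" / "\<lambda>p q. p - q \<in> multilinear_relations"
proof (rule equivpI)
  note R = subspace_multilinear_relations
  show "reflp (\<lambda>p q :: 'a list \<Rightarrow>\<^sub>0 real. p - q \<in> multilinear_relations)"
    by (simp add: reflp_def subspace_0[OF R])
  show "symp (\<lambda>p q :: 'a list \<Rightarrow>\<^sub>0 real. p - q \<in> multilinear_relations)"
    using subspace_neg[OF R] by (force simp: symp_def)
  show "transp (\<lambda>p q :: 'a list \<Rightarrow>\<^sub>0 real. p - q \<in> multilinear_relations)"
    using subspace_add[OF R] by (force simp: transp_def)
qed

instantiation tensor_algebra :: (real_vector) real_vector
begin

lift_definition zero_tensor_algebra :: "'a tensor_algebra" is 0 .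

lift_definition plus_tensor_algebra :: "'a tensor_algebra \<Rightarrow> 'a tensor_algebra \<Rightarrow> 'a tensor_algebra"
  is "(+)"
  using subspace_add[OF subspace_multilinear_relations] by (force simp: add_diff_add)

lift_definition uminus_tensor_algebra :: "'a tensor_algebra \<Rightarrow> 'a tensor_algebra" is uminus
  using subspace_neg[OF subspace_multilinear_relations] by force

lift_definition minus_tensor_algebra :: "'a tensor_algebra \<Rightarrow> 'a tensor_algebra \<Rightarrow> 'a tensor_algebra"
  is "(-)"
proof -
  fix p q p' q' :: "'a list \<Rightarrow>\<^sub>0 real"
  assume "p - q \<in> multilinear_relations" "p' - q' \<in> multilinear_relations"
  then have "(p - q) - (p' - q') \<in> multilinear_relations"
    by (rule subspace_diff[OF subspace_multilinear_relations])
  then show "(p - p') - (q - q') \<in> multilinear_relations"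
    by (simp add: algebra_simps)
qed

lift_definition scaleR_tensor_algebra :: "real \<Rightarrow> 'a tensor_algebra \<Rightarrow> 'a tensor_algebra"
  is scaleR
  using subspace_scale[OF subspace_multilinear_relations]
  by (force simp: scaleR_diff_right[symmetric])

instance
  by (standard; transfer)
    (simp_all add: algebra_simps subspace_0[OF subspace_multilinear_relations])

end

lift_definition pure_tensor :: "'a::real_vector list \<Rightarrow> 'a tensor_algebra"
  is "\<lambda>xs. Poly_Mapping.single xs 1" .

definition multilinear :: "('a::real_vector list \<Rightarrow> 'b::real_vector) \<Rightarrow> bool"
  where "multilinear f \<longleftrightarrow>
    (\<forall>us vs x y. f (us @ (x + y) # vs) = f (us @ x # vs) + f (us @ y # vs)) \<and>
    (\<forall>us vs r x. f (us @ (r *\<^sub>R x) # vs) = r *\<^sub>R f (us @ x # vs))"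

text \<open>
  The linear map given by a multilinear function \<open>f\<close> (one for each length of the argument
  list).  Its universal property is lemma \<open>tensor_lift\<close>; every use below is shown to be
  at a multilinear function.
\<close>

definition tensor_lift :: "('a::real_vector list \<Rightarrow> 'b::real_vector) \<Rightarrow> 'a tensor_algebra \<Rightarrow> 'b"
  where "tensor_lift f = (THE F. linear F \<and> (\<forall>xs. F (pure_tensor xs) = f xs))"

lemma linear_abs_tensor_algebra: "linear abs_tensor_algebra"
  by (rule linearI) (simp_all add: plus_tensor_algebra.abs_eq scaleR_tensor_algebra.abs_eq)

lemma span_pure_tensor: "span (range pure_tensor) = UNIV"
proof -
  have "t \<in> span (range pure_tensor)" for t :: "'a tensor_algebra"
  proof (induction t rule: tensor_algebra.abs_induct)
    case (1 p)
    have "abs_tensor_algebra p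
        = abs_tensor_algebra (free_extend (\<lambda>xs. Poly_Mapping.single xs 1) p)"
      by (simp add: free_extend_basis)
    also have "\<dots> = (\<Sum>xs\<in>Poly_Mapping.keys p. Poly_Mapping.lookup p xs *\<^sub>R pure_tensor xs)"
      by (simp add: free_extend_def linear_sum[OF linear_abs_tensor_algebra]
          linear_scale[OF linear_abs_tensor_algebra] pure_tensor.abs_eq)
    also have "\<dots> \<in> span (range pure_tensor)"
      by (intro span_sum span_scale span_base) auto
    finally show ?case .
  qed
  then show ?thesis by blast
qed

lemma tensor_lift:
  assumes "multilinear f"
  shows "linear (tensor_lift f)" and "tensor_lift f (pure_tensor xs) = f xs"
proof -
  note L = linear_free_extend[of f]
  have rel: "free_extend f p = 0" if "p \<in> multilinear_relations" for p
    using that unfolding multilinear_relations_def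
  proof (induction p rule: span_induct)
    case base
    show ?case by (simp add: subspace_def linear_0[OF L] linear_add[OF L] linear_scale[OF L])
  next
    case (step p)
    then show ?case
      using assms by (auto simp: linear_diff[OF L] linear_scale[OF L] multilinear_def)
  qed
  define F where "F t = free_extend f (rep_tensor_algebra t)" for t
  have F: "F (abs_tensor_algebra p) = free_extend f p" for p
  proof -
    have "rep_tensor_algebra (abs_tensor_algebra p) - p \<in> multilinear_relations"
      using Quotient_rep_abs[OF Quotient_tensor_algebra]
        subspace_0[OF subspace_multilinear_relations] by fastforce
    from rel[OF this] show ?thesis by (simp add: F_def linear_diff[OF L])
  qed
  have "linear F"
  proof (rule linearI)
    fix s t :: "'a tensor_algebra" and r :: real
    obtain p q where "s = abs_tensor_algebra p" "t = abs_tensor_algebra q"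
      by (rule that[of "rep_tensor_algebra s" "rep_tensor_algebra t"])
        (simp_all add: Quotient_abs_rep[OF Quotient_tensor_algebra])
    then show "F (s + t) = F s + F t" "F (r *\<^sub>R s) = r *\<^sub>R F s"
      by (simp_all add: plus_tensor_algebra.abs_eq scaleR_tensor_algebra.abs_eq F
          linear_add[OF L] linear_scale[OF L])
  qed
  moreover have "F (pure_tensor xs) = f xs" for xs
    by (simp add: pure_tensor.abs_eq F)
  moreover have "G = G'"
    if "linear G \<and> (\<forall>xs. G (pure_tensor xs) = f xs)"
      "linear G' \<and> (\<forall>xs. G' (pure_tensor xs) = f xs)" for G G'
  proof
    fix t
    show "G t = G' t"
      by (rule linear_eq_on_span[of G G' "range pure_tensor"])
        (use that in \<open>auto simp: span_pure_tensor\<close>)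
  qed
  ultimately have "linear (tensor_lift f) \<and> (\<forall>xs. tensor_lift f (pure_tensor xs) = f xs)"
    unfolding tensor_lift_def
    by (intro theI[of "\<lambda>F. linear F \<and> (\<forall>xs. F (pure_tensor xs) = f xs)" F]) blast+
  then show "linear (tensor_lift f)" and "tensor_lift f (pure_tensor xs) = f xs"
    by auto
qed

lemma multilinear_pure_tensor: "multilinear pure_tensor"
  unfolding multilinear_def
proof (intro conjI allI)
  fix us vs and x y :: 'a and r :: real
  show "pure_tensor (us @ (x + y) # vs) = pure_tensor (us @ x # vs) + pure_tensor (us @ y # vs)"
    by transfer (unfold multilinear_relations_def diff_diff_eq[symmetric], rule span_base, blast)
  show "pure_tensor (us @ (r *\<^sub>R x) # vs) = r *\<^sub>R pure_tensor (us @ x # vs)"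
    by transfer (unfold multilinear_relations_def, rule span_base, blast)
qed

lemmas pure_tensor_add =
  multilinear_pure_tensor[unfolded multilinear_def, THEN conjunct1, rule_format]
lemmas pure_tensor_scale =
  multilinear_pure_tensor[unfolded multilinear_def, THEN conjunct2, rule_format]

lemma multilinear_append_left: "multilinear f \<Longrightarrow> multilinear (\<lambda>ys. f (xs @ ys))"
  unfolding multilinear_def by (simp flip: append_assoc)

lemma multilinear_append_right: "multilinear f \<Longrightarrow> multilinear (\<lambda>xs. f (xs @ ys))"
  unfolding multilinear_def by simp

lemma tensor_lift_eqI:
  assumes "linear F" "linear G" "\<And>xs. F (pure_tensor xs) = G (pure_tensor xs)"
  shows "F t = G t"
  by (rule linear_eq_on_span[of F G "range pure_tensor"])
    (use assms in \<open>auto simp: span_pure_tensor\<close>)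

lemma tensor_lift2:
  assumes "\<And>xs. multilinear (f xs)" "\<And>ys. multilinear (\<lambda>xs. f xs ys)"
  shows "multilinear (\<lambda>xs. tensor_lift (f xs) t)"
    and "linear (\<lambda>s. tensor_lift (\<lambda>xs. tensor_lift (f xs) t) s)"
    and "linear (\<lambda>t. tensor_lift (\<lambda>xs. tensor_lift (f xs) t) s)"
    and "tensor_lift (\<lambda>xs. tensor_lift (f xs) (pure_tensor ys')) (pure_tensor xs') = f xs' ys'"
proof -
  note L = tensor_lift(1)[OF assms(1)] and P = tensor_lift(2)[OF assms(1)]
  have *: "multilinear (\<lambda>xs. tensor_lift (f xs) t)" for t
    unfolding multilinear_def
  proof (intro conjI allI)
    fix us vs and x y :: 'a and r :: real
    show "tensor_lift (f (us @ (x + y) # vs)) t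
        = tensor_lift (f (us @ x # vs)) t + tensor_lift (f (us @ y # vs)) t"
      by (rule tensor_lift_eqI[where F = "tensor_lift _"], rule L, intro linear_compose_add L,
          unfold P, use assms(2) in \<open>simp add: multilinear_def\<close>)
    show "tensor_lift (f (us @ (r *\<^sub>R x) # vs)) t = r *\<^sub>R tensor_lift (f (us @ x # vs)) t"
      by (rule tensor_lift_eqI[where F = "tensor_lift _"], rule L,
          intro linear_compose_scale_right L, unfold P,
          use assms(2) in \<open>simp add: multilinear_def\<close>)
  qed
  then show "multilinear (\<lambda>xs. tensor_lift (f xs) t)" .
  show "linear (\<lambda>s. tensor_lift (\<lambda>xs. tensor_lift (f xs) t) s)"
    by (rule tensor_lift(1)[OF *])
  show "tensor_lift (\<lambda>xs. tensor_lift (f xs) (pure_tensor ys')) (pure_tensor xs') = f xs' ys'"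
    by (rule trans[OF tensor_lift(2)[OF *] P])
  note LL = tensor_lift(1)[OF *] and PP = tensor_lift(2)[OF *]
  show "linear (\<lambda>t. tensor_lift (\<lambda>xs. tensor_lift (f xs) t) s)"
  proof (rule linearI)
    fix t t' and r :: real
    show "tensor_lift (\<lambda>xs. tensor_lift (f xs) (t + t')) s
        = tensor_lift (\<lambda>xs. tensor_lift (f xs) t) s + tensor_lift (\<lambda>xs. tensor_lift (f xs) t') s"
      by (rule tensor_lift_eqI[where F = "tensor_lift _"], rule LL, intro linear_compose_add LL,
          unfold PP, rule linear_add[OF L])
    show "tensor_lift (\<lambda>xs. tensor_lift (f xs) (r *\<^sub>R t)) s
        = r *\<^sub>R tensor_lift (\<lambda>xs. tensor_lift (f xs) t) s"
      by (rule tensor_lift_eqI[where F = "tensor_lift _"], rule LL,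
          intro linear_compose_scale_right LL, unfold PP, rule linear_scale[OF L])
  qed
qed

definition tensor_concat ::
    "'a::real_vector tensor_algebra \<Rightarrow> 'a tensor_algebra \<Rightarrow> 'a tensor_algebra"
  where "tensor_concat s t =
    tensor_lift (\<lambda>xs. tensor_lift (\<lambda>ys. pure_tensor (xs @ ys)) t) s"

lemma tensor_concat:
  shows "linear (\<lambda>s. tensor_concat s t)" and "linear (tensor_concat s)"
    and "tensor_concat (pure_tensor xs) (pure_tensor ys) = pure_tensor (xs @ ys)"
  unfolding tensor_concat_def
  by (rule tensor_lift2; intro multilinear_append_left multilinear_append_right
      multilinear_pure_tensor)+

text \<open>The maps \<open>id \<otimes> \<dots> \<otimes> id \<otimes> D\<close> and \<open>D \<otimes> id \<otimes> \<dots> \<otimes> id\<close>.\<close>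

definition map_last ::
    "('a::real_vector \<Rightarrow> 'a tensor_algebra) \<Rightarrow> 'a tensor_algebra \<Rightarrow> 'a tensor_algebra"
  where "map_last D = tensor_lift (\<lambda>xs. tensor_concat (pure_tensor (butlast xs)) (D (last xs)))"

definition map_first ::
    "('a::real_vector \<Rightarrow> 'a tensor_algebra) \<Rightarrow> 'a tensor_algebra \<Rightarrow> 'a tensor_algebra"
  where "map_first D = tensor_lift (\<lambda>xs. tensor_concat (D (hd xs)) (pure_tensor (tl xs)))"

lemma multilinear_map_last:
  assumes "linear D"
  shows "multilinear (\<lambda>xs. tensor_concat (pure_tensor (butlast xs)) (D (last xs)))"
  unfolding multilinear_def
proof (intro conjI allI)
  fix us vs and x y :: 'a and r :: real
  show "tensor_concat (pure_tensor (butlast (us @ (x + y) # vs))) (D (last (us @ (x + y) # vs)))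
      = tensor_concat (pure_tensor (butlast (us @ x # vs))) (D (last (us @ x # vs)))
      + tensor_concat (pure_tensor (butlast (us @ y # vs))) (D (last (us @ y # vs)))"
    by (cases "vs = []")
      (simp_all add: butlast_append pure_tensor_add pure_tensor_scale
        linear_add[OF assms] linear_add[OF tensor_concat(1)]
        linear_add[OF tensor_concat(2)])
  show "tensor_concat (pure_tensor (butlast (us @ (r *\<^sub>R x) # vs))) (D (last (us @ (r *\<^sub>R x) # vs)))
      = r *\<^sub>R tensor_concat (pure_tensor (butlast (us @ x # vs))) (D (last (us @ x # vs)))"
    by (cases "vs = []")
      (simp_all add: butlast_append pure_tensor_add pure_tensor_scale
        linear_scale[OF assms] linear_scale[OF tensor_concat(1)]
        linear_scale[OF tensor_concat(2)])
qed

lemma multilinear_map_first: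
  assumes "linear D"
  shows "multilinear (\<lambda>xs. tensor_concat (D (hd xs)) (pure_tensor (tl xs)))"
  unfolding multilinear_def
proof (intro conjI allI)
  fix us vs and x y :: 'a and r :: real
  show "tensor_concat (D (hd (us @ (x + y) # vs))) (pure_tensor (tl (us @ (x + y) # vs)))
      = tensor_concat (D (hd (us @ x # vs))) (pure_tensor (tl (us @ x # vs)))
      + tensor_concat (D (hd (us @ y # vs))) (pure_tensor (tl (us @ y # vs)))"
    by (cases us)
      (simp_all add: pure_tensor_add pure_tensor_add[of "[]", simplified]
        pure_tensor_scale pure_tensor_scale[of "[]", simplified]
        linear_add[OF assms] linear_add[OF tensor_concat(1)] linear_add[OF tensor_concat(2)])
  show "tensor_concat (D (hd (us @ (r *\<^sub>R x) # vs))) (pure_tensor (tl (us @ (r *\<^sub>R x) # vs)))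
      = r *\<^sub>R tensor_concat (D (hd (us @ x # vs))) (pure_tensor (tl (us @ x # vs)))"
    by (cases us)
      (simp_all add: pure_tensor_add pure_tensor_add[of "[]", simplified]
        pure_tensor_scale pure_tensor_scale[of "[]", simplified]
        linear_scale[OF assms] linear_scale[OF tensor_concat(1)] linear_scale[OF tensor_concat(2)])
qed

text \<open>The factorwise product on each tensor power of an algebra.\<close>

definition tensor_times ::
    "'a::real_algebra_1 tensor_algebra \<Rightarrow> 'a tensor_algebra \<Rightarrow> 'a tensor_algebra"
  where "tensor_times s t =
    tensor_lift (\<lambda>xs. tensor_lift
      (\<lambda>ys. if length xs = length ys then pure_tensor (map2 (*) xs ys) else 0) t) s"

lemma multilinear_map2_left:
  fixes ys :: "'a::real_algebra_1 list"
  shows "multilinear (\<lambda>xs. if length xs = length ys then pure_tensor (map2 (*) xs ys) else 0)"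
  unfolding multilinear_def
proof (intro conjI allI)
  fix us vs :: "'a list" and x y :: 'a and r :: real
  have "\<exists>ps q qs. ys = ps @ q # qs \<and> length ps = length us"
    if "Suc (length us + length vs) = length ys"
    using that id_take_nth_drop[of "length us" ys]
    by (intro exI[of _ "take (length us) ys"] exI[of _ "ys ! length us"]
        exI[of _ "drop (Suc (length us)) ys"]) auto
  then show "(if length (us @ (x + y) # vs) = length ys
        then pure_tensor (map2 (*) (us @ (x + y) # vs) ys) else 0)
      = (if length (us @ x # vs) = length ys then pure_tensor (map2 (*) (us @ x # vs) ys) else 0)
      + (if length (us @ y # vs) = length ys then pure_tensor (map2 (*) (us @ y # vs) ys) else 0)"
    and "(if length (us @ (r *\<^sub>R x) # vs) = length ys
        then pure_tensor (map2 (*) (us @ (r *\<^sub>R x) # vs) ys) else 0)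
      = r *\<^sub>R (if length (us @ x # vs) = length ys
          then pure_tensor (map2 (*) (us @ x # vs) ys) else 0)"
    by (auto simp: pure_tensor_add pure_tensor_scale distrib_right)
qed

lemma multilinear_map2_right:
  fixes xs :: "'a::real_algebra_1 list"
  shows "multilinear (\<lambda>ys. if length xs = length ys then pure_tensor (map2 (*) xs ys) else 0)"
  unfolding multilinear_def
proof (intro conjI allI)
  fix us vs :: "'a list" and x y :: 'a and r :: real
  have "\<exists>ps q qs. xs = ps @ q # qs \<and> length ps = length us"
    if "length xs = Suc (length us + length vs)"
    using that id_take_nth_drop[of "length us" xs]
    by (intro exI[of _ "take (length us) xs"] exI[of _ "xs ! length us"]
        exI[of _ "drop (Suc (length us)) xs"]) auto
  then show "(if length xs = length (us @ (x + y) # vs)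
        then pure_tensor (map2 (*) xs (us @ (x + y) # vs)) else 0)
      = (if length xs = length (us @ x # vs) then pure_tensor (map2 (*) xs (us @ x # vs)) else 0)
      + (if length xs = length (us @ y # vs) then pure_tensor (map2 (*) xs (us @ y # vs)) else 0)"
    and "(if length xs = length (us @ (r *\<^sub>R x) # vs)
        then pure_tensor (map2 (*) xs (us @ (r *\<^sub>R x) # vs)) else 0)
      = r *\<^sub>R (if length xs = length (us @ x # vs)
          then pure_tensor (map2 (*) xs (us @ x # vs)) else 0)"
    by (auto simp: pure_tensor_add pure_tensor_scale distrib_left)
qed

lemma tensor_times:
  shows "linear (\<lambda>s. tensor_times s t)" and "linear (tensor_times s)"
    and "tensor_times (pure_tensor xs) (pure_tensor ys)
      = (if length xs = length ys then pure_tensor (map2 (*) xs ys) else 0)"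
  unfolding tensor_times_def
  by (rule tensor_lift2; intro multilinear_map2_left multilinear_map2_right)+

text \<open>On the tensor square, reversal is the swap of the two factors.\<close>

definition tensor_rev :: "'a::real_vector tensor_algebra \<Rightarrow> 'a tensor_algebra"
  where "tensor_rev = tensor_lift (\<lambda>xs. pure_tensor (rev xs))"

lemma multilinear_rev: "multilinear (\<lambda>xs. pure_tensor (rev xs))"
  unfolding multilinear_def by (simp add: pure_tensor_add pure_tensor_scale)

definition tensor_product_space :: "'a::real_vector set \<Rightarrow> 'a set \<Rightarrow> 'a tensor_algebra set"
  where "tensor_product_space U V = span {pure_tensor [x, y] |x y. x \<in> U \<and> y \<in> V}"

section \<open>Graded connected Hopf algebras\<close>

definition reduced_coproduct ::
    "('h::real_algebra_1 \<Rightarrow> 'h tensor_algebra) \<Rightarrow> 'h \<Rightarrow> 'h tensor_algebra"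
  where "reduced_coproduct \<Delta> x = \<Delta> x - pure_tensor [1, x] - pure_tensor [x, 1]"

locale graded_connected_hopf_algebra =
  fixes H :: "nat \<Rightarrow> 'h::real_algebra_1 set"
    and \<Delta> :: "'h \<Rightarrow> 'h tensor_algebra"
  assumes subspace_H: "subspace (H n)"
    and span_H: "span (\<Union>n. H n) = UNIV"
    and direct_H: "finite N \<Longrightarrow> (\<And>n. n \<in> N \<Longrightarrow> x n \<in> H n) \<Longrightarrow> (\<Sum>n\<in>N. x n) = 0
      \<Longrightarrow> n \<in> N \<Longrightarrow> x n = 0"
    and H_0: "H 0 = span {1}"
    and mult_H: "w \<in> H i \<Longrightarrow> z \<in> H j \<Longrightarrow> w * z \<in> H (i + j)"
    and linear_coprod: "linear \<Delta>"
    and coprod_H: "w \<in> H n \<Longrightarrow> \<Delta> w \<in> span (\<Union>j\<in>{0..n}. tensor_product_space (H j) (H (n - j)))"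
    and coassoc: "map_first \<Delta> (\<Delta> w) = map_last \<Delta> (\<Delta> w)"
    and coprod_1: "\<Delta> 1 = pure_tensor [1, 1]"
    and reduced_coprod_H: "1 \<le> n \<Longrightarrow> w \<in> H n
      \<Longrightarrow> reduced_coproduct \<Delta> w \<in> span (\<Union>j\<in>{1..n - 1}. tensor_product_space (H j) (H (n - j)))"
    and coprod_mult: "\<Delta> (w * z) = tensor_times (\<Delta> w) (\<Delta> z)"

definition commutative_algebra :: "'h::real_algebra_1 itself \<Rightarrow> bool"
  where "commutative_algebra _ \<longleftrightarrow> (\<forall>w z :: 'h. w * z = z * w)"

definition cocommutative :: "('h::real_algebra_1 \<Rightarrow> 'h tensor_algebra) \<Rightarrow> bool"
  where "cocommutative \<Delta> \<longleftrightarrow> (\<forall>x. tensor_rev (\<Delta> x) = \<Delta> x)"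

text \<open>For \<open>r \<ge> 1\<close>, the \<open>r\<close>-fold iterate, starting with the identity for \<open>r = 1\<close>.\<close>

definition iterated_coproduct ::
    "('h::real_algebra_1 \<Rightarrow> 'h tensor_algebra) \<Rightarrow> nat \<Rightarrow> 'h \<Rightarrow> 'h tensor_algebra"
  where "iterated_coproduct D r x = (map_last D ^^ (r - 1)) (pure_tensor [x])"

definition iterated_product :: "'h::real_algebra_1 tensor_algebra \<Rightarrow> 'h"
  where "iterated_product = tensor_lift prod_list"

lemma multilinear_prod_list: "multilinear (prod_list :: 'h::real_algebra_1 list \<Rightarrow> 'h)"
  unfolding multilinear_def by (simp add: distrib_left distrib_right)

definition hopf_power :: "('h::real_algebra_1 \<Rightarrow> 'h tensor_algebra) \<Rightarrow> nat \<Rightarrow> 'h \<Rightarrow> 'h"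
  where "hopf_power \<Delta> a x = iterated_product (iterated_coproduct \<Delta> a x)"

definition primitive :: "('h::real_algebra_1 \<Rightarrow> 'h tensor_algebra) \<Rightarrow> 'h \<Rightarrow> bool"
  where "primitive \<Delta> x \<longleftrightarrow> \<Delta> x = pure_tensor [1, x] + pure_tensor [x, 1]"

text \<open>For \<open>x\<close> of positive degree, only finitely many of the iterates are nonzero.\<close>

definition eulerian_idempotent :: "('h::real_algebra_1 \<Rightarrow> 'h tensor_algebra) \<Rightarrow> 'h \<Rightarrow> 'h"
  where "eulerian_idempotent \<Delta> x =
    (\<Sum>r | 1 \<le> r \<and> iterated_coproduct (reduced_coproduct \<Delta>) r x \<noteq> 0.
      ((-1) ^ (r - 1) / real r) *\<^sub>R
        iterated_product (iterated_coproduct (reduced_coproduct \<Delta>) r x))"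

text \<open>Well defined for nonzero homogeneous elements.\<close>

definition hdeg :: "(nat \<Rightarrow> 'h set) \<Rightarrow> 'h \<Rightarrow> nat"
  where "hdeg H x = (THE n. x \<in> H n)"

section \<open>Bases, eigenvectors and multiplicities\<close>

definition is_basis_family :: "'i set \<Rightarrow> ('i \<Rightarrow> 'v::real_vector) \<Rightarrow> bool"
  where "is_basis_family I b \<longleftrightarrow> inj_on b I \<and> independent (b ` I) \<and> span (b ` I) = UNIV"

definition is_eigenvector :: "('v::real_vector \<Rightarrow> 'v) \<Rightarrow> real \<Rightarrow> 'v \<Rightarrow> bool"
  where "is_eigenvector T c v \<longleftrightarrow> v \<noteq> 0 \<and> T v = c *\<^sub>R v"

text \<open>
  Power series in \<open>x\<close> and \<open>y\<close> are series in \<open>x\<close> whose coefficients are series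
  in \<open>y\<close>.  The infinite product is the limit of the finite subproducts in the
  \<open>x\<close>-adic topology.
\<close>

definition has_multiplicity_product :: "'i set \<Rightarrow> ('i \<Rightarrow> nat) \<Rightarrow> real fps fps \<Rightarrow> bool"
  where "has_multiplicity_product I d F \<longleftrightarrow>
    ((\<lambda>J. \<Prod>i\<in>J. inverse (1 - fps_const fps_X * fps_X ^ d i)) \<longlongrightarrow> F) (finite_subsets_at_top I)"

text \<open>
  The multiplicity of the eigenvalue \<open>a ^ k\<close> on \<open>H n\<close> is the dimension of the
  eigenspace; the operators in question are diagonalisable.
\<close>

definition multiplicities_given_by ::
    "(nat \<Rightarrow> 'h::real_algebra_1 set) \<Rightarrow> ('h \<Rightarrow> 'h tensor_algebra) \<Rightarrow> nat \<Rightarrow> 'i set \<Rightarrow> ('i \<Rightarrow> nat) \<Rightarrow> bool"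
  where "multiplicities_given_by H \<Delta> a I d \<longleftrightarrow>
    (\<exists>F. has_multiplicity_product I d F \<and>
      (\<forall>n k. real (dim {x \<in> H n. hopf_power \<Delta> a x = (real a ^ k) *\<^sub>R x})
        = fps_nth (fps_nth F n) k))"

section \<open>Products indexed by multisets\<close>

text \<open>
  An enumeration of a multiset.  It is only used where the result does not depend on the order.
\<close>

definition list_of_mset :: "'a multiset \<Rightarrow> 'a list"
  where "list_of_mset M = (SOME xs. mset xs = M)"

lemma mset_list_of_mset [simp]: "mset (list_of_mset M) = M"
  unfolding list_of_mset_def by (rule someI_ex) (rule ex_mset)

definition symmetrized_product :: "'h::real_algebra_1 list \<Rightarrow> 'h"
  where "symmetrized_product xs =
    (1 / fact (length xs)) *\<^sub>R
      (\<Sum>\<sigma> | \<sigma> permutes {..<length xs}. prod_list (permute_list \<sigma> xs))"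

text \<open>
  Polynomials in the elements of \<open>C\<close> are finite linear combinations of monomials, and
  monomials are multisets.  The algebra is \<open>\<real>[C]\<close> if evaluation of polynomials is
  bijective; for a commutative algebra, evaluation does not depend on the enumerations.
\<close>

definition eval_polynomial :: "('h::real_algebra_1 multiset \<Rightarrow>\<^sub>0 real) \<Rightarrow> 'h"
  where "eval_polynomial = free_extend (\<lambda>M. prod_list (list_of_mset M))"

definition free_generating_set :: "(nat \<Rightarrow> 'h::real_algebra_1 set) \<Rightarrow> 'h set \<Rightarrow> bool"
  where "free_generating_set H C \<longleftrightarrow>
    (\<forall>c\<in>C. \<exists>n\<ge>1. c \<in> H n) \<and>
    bij_betw eval_polynomial {p. \<forall>M\<in>Poly_Mapping.keys p. set_mset M \<subseteq> C} UNIV"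

definition homogeneous_primitive_basis ::
    "(nat \<Rightarrow> 'h::real_algebra_1 set) \<Rightarrow> ('h \<Rightarrow> 'h tensor_algebra) \<Rightarrow> 'h set \<Rightarrow> bool"
  where "homogeneous_primitive_basis H \<Delta> P \<longleftrightarrow>
    (\<forall>p\<in>P. \<exists>n. p \<in> H n) \<and> independent P \<and> span P = {x. primitive \<Delta> x}"

section \<open>The shuffle algebra and the free associative algebra\<close>

fun interleavings :: "'a list \<Rightarrow> 'a list \<Rightarrow> 'a list multiset"
  where
    "interleavings [] vs = {#vs#}"
  | "interleavings us [] = {#us#}"
  | "interleavings (u # us) (v # vs) =
      image_mset ((#) u) (interleavings us (v # vs)) + image_mset ((#) v) (interleavings (u # us) vs)"

definition bilinear_extension ::
    "('a \<Rightarrow> 'a \<Rightarrow> 'a \<Rightarrow>\<^sub>0 real) \<Rightarrow> ('a \<Rightarrow>\<^sub>0 real) \<Rightarrow> ('a \<Rightarrow>\<^sub>0 real) \<Rightarrow> 'a \<Rightarrow>\<^sub>0 real"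
  where "bilinear_extension m p q = free_extend (\<lambda>u. free_extend (m u) q) p"

definition shuffle_times ::
    "('a list \<Rightarrow>\<^sub>0 real) \<Rightarrow> ('a list \<Rightarrow>\<^sub>0 real) \<Rightarrow> 'a list \<Rightarrow>\<^sub>0 real"
  where "shuffle_times =
    bilinear_extension (\<lambda>u v. \<Sum>w\<in>#interleavings u v. Poly_Mapping.single w 1)"

definition concat_times ::
    "('a list \<Rightarrow>\<^sub>0 real) \<Rightarrow> ('a list \<Rightarrow>\<^sub>0 real) \<Rightarrow> 'a list \<Rightarrow>\<^sub>0 real"
  where "concat_times = bilinear_extension (\<lambda>u v. Poly_Mapping.single (u @ v) 1)"

text \<open>
  An isomorphism of unital algebras from the span of the words in the letters \<open>L\<close>, with
  product \<open>times_w\<close> and the empty word as unit.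
\<close>

definition word_algebra_iso ::
    "'l set \<Rightarrow> (('l list \<Rightarrow>\<^sub>0 real) \<Rightarrow> ('l list \<Rightarrow>\<^sub>0 real) \<Rightarrow> 'l list \<Rightarrow>\<^sub>0 real)
      \<Rightarrow> (('l list \<Rightarrow>\<^sub>0 real) \<Rightarrow> 'h::real_algebra_1) \<Rightarrow> bool"
  where "word_algebra_iso L times_w \<phi> \<longleftrightarrow>
    (let A = {p. Poly_Mapping.keys p \<subseteq> lists L} in
      bij_betw \<phi> A UNIV \<and>
      (\<forall>p\<in>A. \<forall>q\<in>A. \<phi> (p + q) = \<phi> p + \<phi> q) \<and>
      (\<forall>r. \<forall>p\<in>A. \<phi> (r *\<^sub>R p) = r *\<^sub>R \<phi> p) \<and>
      (\<forall>p\<in>A. \<forall>q\<in>A. \<phi> (times_w p q) = \<phi> p * \<phi> q) \<and>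
      \<phi> (Poly_Mapping.single [] 1) = 1)"

definition is_alphabet :: "nat set \<Rightarrow> bool"
  where "is_alphabet L \<longleftrightarrow> L = {1..} \<or> (\<exists>N. L = {1..N})"

section \<open>Lyndon words\<close>

text \<open>The order on words is the lexicographic one, a proper prefix being smaller.\<close>

definition lyndon :: "'l::linorder list \<Rightarrow> bool"
  where "lyndon w \<longleftrightarrow> w \<noteq> [] \<and> (\<forall>i. 0 < i \<and> i < length w \<longrightarrow> w < rotate i w)"

definition smallest_tail :: "'l::linorder list \<Rightarrow> 'l list"
  where "smallest_tail w = Min {u. u \<noteq> [] \<and> suffix u w}"

lemma finite_tails: "finite {u. u \<noteq> [] \<and> suffix u w}"
  by (rule finite_subset[of _ "set (suffixes w)"]) auto

lemma smallest_tail: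
  assumes "w \<noteq> []"
  shows "smallest_tail w \<noteq> []" "suffix (smallest_tail w) w"
    "\<And>u. u \<noteq> [] \<Longrightarrow> suffix u w \<Longrightarrow> smallest_tail w \<le> u"
proof -
  have "w \<in> {u. u \<noteq> [] \<and> suffix u w}"
    using assms by simp
  then have "smallest_tail w \<in> {u. u \<noteq> [] \<and> suffix u w}"
    unfolding smallest_tail_def using finite_tails Min_in by blast
  then show "smallest_tail w \<noteq> []" "suffix (smallest_tail w) w" by auto
  show "smallest_tail w \<le> u" if "u \<noteq> []" "suffix u w" for u
    unfolding smallest_tail_def using that by (intro Min_le finite_tails) simp
qed

function lyndon_factorisation :: "'l::linorder list \<Rightarrow> 'l list list"
  where "lyndon_factorisation w =
    (if w = [] then []
     else lyndon_factorisation (take (length w - length (smallest_tail w)) w) @ [smallest_tail w])"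
  by auto
termination
  by (relation "measure length") (simp_all add: smallest_tail(1) diff_less)

declare lyndon_factorisation.simps [simp del]

lemma concat_lyndon_factorisation: "concat (lyndon_factorisation w) = w"
proof (induction w rule: lyndon_factorisation.induct)
  case (1 w)
  show ?case
  proof (cases "w = []")
    case False
    then obtain v where "w = v @ smallest_tail w"
      using smallest_tail(2) by (metis suffixE)
    then have "take (length w - length (smallest_tail w)) w @ smallest_tail w = w"
      by (metis append_eq_conv_conj diff_add_inverse2 length_append)
    then show ?thesis
      using 1 False by (subst lyndon_factorisation.simps) simp
  qed (simp add: lyndon_factorisation.simps)
qed

lemma lyndon_if_smallest_tail:
  assumes "w \<noteq> []" "smallest_tail w = w"
  shows "lyndon w"
  unfolding lyndon_def
proof (intro conjI allI impI)
  fix i assume i: "0 < i \<and> i < length w"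
  have "w \<le> drop i w"
    using smallest_tail(3)[OF assms(1), of "drop i w"] i assms(2) by (simp add: suffix_drop)
  moreover have "w \<noteq> drop i w"
    using i by (metis diff_less length_drop less_irrefl length_greater_0_conv assms(1))
  ultimately have "(w, drop i w) \<in> lexord {(u, v). u < v}"
    by (auto simp: list_le_def list_less_def)
  then have "(w @ [], drop i w @ take i w) \<in> lexord {(u, v). u < v}"
    by (rule lexord_sufI) simp
  then show "w < rotate i w"
    using i by (simp add: list_less_def rotate_drop_take)
qed fact

lemma length_lyndon_factor:
  assumes "\<not> lyndon w" "u \<in> set (lyndon_factorisation w)"
  shows "length u < length w"
proof -
  have w: "w \<noteq> []"
    using assms(2) by (auto simp: lyndon_factorisation.simps)
  have part: "length x \<le> length (concat xs)" if "x \<in> set xs" for x :: "'a list" and xs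
    using that by (induction xs) auto
  let ?v = "take (length w - length (smallest_tail w)) w"
  from assms(2) w consider "u \<in> set (lyndon_factorisation ?v)" | "u = smallest_tail w"
    by (subst (asm) lyndon_factorisation.simps) auto
  then show ?thesis
  proof cases
    case 1
    then have "length u \<le> length ?v"
      using part[OF 1] by (simp only: concat_lyndon_factorisation)
    also have "\<dots> < length w"
      using smallest_tail(1)[OF w] w by simp
    finally show ?thesis .
  next
    case 2
    then show ?thesis
      using smallest_tail(2)[OF w] lyndon_if_smallest_tail[OF w] assms(1)
      by (metis suffix_length_less strict_suffix_def)
  qed
qed

text \<open>
  The position at which the standard factorisation splits a Lyndon word of length at least 2.
\<close>

definition standard_split :: "'l::linorder list \<Rightarrow> nat"
  where "standard_split w = (LEAST i. 0 < i \<and> i < length w \<and> lyndon (drop i w))"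

lemma standard_split:
  assumes "2 \<le> length w"
  shows "0 < standard_split w" "standard_split w < length w"
proof -
  let ?n = "length w - 1"
  have "length (drop ?n w) = 1" using assms by simp
  then have "lyndon (drop ?n w)" by (auto simp: lyndon_def)
  then have "0 < ?n \<and> ?n < length w \<and> lyndon (drop ?n w)"
    using assms by linarith
  then have "0 < standard_split w \<and> standard_split w < length w
      \<and> lyndon (drop (standard_split w) w)"
    unfolding standard_split_def by (rule LeastI)
  then show "0 < standard_split w" "standard_split w < length w" by auto
qed

function shuffle_eigenvector ::
    "('h::real_algebra_1 \<Rightarrow> 'h tensor_algebra) \<Rightarrow> ('l::linorder list \<Rightarrow> 'h) \<Rightarrow> 'l list \<Rightarrow> 'h"
  where "shuffle_eigenvector \<Delta> P w =
    (if lyndon w then eulerian_idempotent \<Delta> (P w)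
     else prod_list (map (shuffle_eigenvector \<Delta> P) (lyndon_factorisation w)))"
  by auto
termination
  by (relation "measure (\<lambda>(_, _, w). length w)") (auto simp: length_lyndon_factor)

declare shuffle_eigenvector.simps [simp del]

function free_eigenvector ::
    "('h::real_algebra_1 \<Rightarrow> 'h tensor_algebra) \<Rightarrow> ('l::linorder \<Rightarrow> 'h) \<Rightarrow> 'l list \<Rightarrow> 'h"
  where "free_eigenvector \<Delta> S w =
    (if length w = 1 then eulerian_idempotent \<Delta> (prod_list (map S w))
     else if lyndon w then
       free_eigenvector \<Delta> S (take (standard_split w) w)
         * free_eigenvector \<Delta> S (drop (standard_split w) w)
       - free_eigenvector \<Delta> S (drop (standard_split w) w)
         * free_eigenvector \<Delta> S (take (standard_split w) w)
     else symmetrized_product (map (free_eigenvector \<Delta> S) (lyndon_factorisation w)))"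
  by auto
termination
proof (relation "measure (\<lambda>(_, _, w). length w)", goal_cases)
  case 1
  show ?case by simp
next
  case (2 \<Delta> S w)
  then have "2 \<le> length w" by (cases w rule: remdups_adj.cases) (auto simp: lyndon_def)
  from standard_split[OF this] show ?case by simp
next
  case (3 \<Delta> S w)
  then have "2 \<le> length w" by (cases w rule: remdups_adj.cases) (auto simp: lyndon_def)
  from standard_split[OF this] show ?case by simp
next
  case (4 \<Delta> S w)
  then have "2 \<le> length w" by (cases w rule: remdups_adj.cases) (auto simp: lyndon_def)
  from standard_split[OF this] show ?case by simp
next
  case (5 \<Delta> S w)
  then have "2 \<le> length w" by (cases w rule: remdups_adj.cases) (auto simp: lyndon_def)
  from standard_split[OF this] show ?case by simp
next
  case (6 \<Delta> S w u)
  then show ?case by (auto simp: length_lyndon_factor)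
qed

declare free_eigenvector.simps [simp del]

end

theory Submission
  imports
    Defs
    "HOL-Computational_Algebra.Polynomial"
    "HOL-Combinatorics.Multiset_Permutations"
begin

text \<open>
  The Hopf powers \<open>\<Psi>\<^sup>n\<close>, the convolution powers of the identity, are polynomial functions of
  \<open>n\<close>, and the Eulerian idempotent \<open>e\<close> is their linear coefficient.  Every statement about
  \<open>e\<close> is therefore the linear coefficient of a statement about all \<open>\<Psi>\<^sup>n\<close>: in the commutative case
  \<open>\<Psi>\<^sup>a \<Psi>\<^sup>n = \<Psi>\<^sup>a\<^sup>n\<close> gives \<open>\<Psi>\<^sup>a e = a e\<close>; in the cocommutative case
  \<open>\<Delta> \<Psi>\<^sup>n = (\<Psi>\<^sup>n \<otimes> \<Psi>\<^sup>n) \<Delta>\<close> shows that \<open>e\<close> takes primitive values.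

  Since \<open>e\<close> is the identity modulo products of elements of lower degree, the images under \<open>e\<close> of
  generators are generators.  In each degree the new family has as many members as a known basis,
  so spanning or independence alone makes it a basis.  Symmetrised products of primitive elements
  are independent because \<open>(\<mu> e \<otimes> id) \<Delta>\<close>, for a functional \<open>\<mu>\<close>, acts on them as a derivation.
  For words, the largest word in the shuffle product of the Lyndon factors of \<open>w\<close> is \<open>w\<close>, and the
  bracketing of a Lyndon word \<open>w\<close> is \<open>w\<close> plus larger words.
\<close>


section \<open>Bases of graded spaces\<close>

text \<open>The polynomial dependence on n is the binomial theorem for convolution: the identity is
  the convolution unit plus a map whose k-th convolution power \<open>conv_power k\<close> kills
  every degree below k. So \<open>psi n\<close> is a combination of these powers with coefficients
  \<open>n choose k\<close>, finite on each element, and (-1)^(k-1)/k is the linear coefficient of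
  \<open>n choose k\<close>. Two obstacles shape the word cases. The isomorphisms need not respect
  degree, yet bases are compared degree by degree; for shuffles, the degree of a product of Lyndon
  factors is read off a basis word that occurs in it. For the free algebra, permuting the factors of
  a product of brackets can lower its leading word, so symmetrised products are not triangular. The
  plain products are; they yield independence of the brackets, which then passes to symmetrised
  products of primitive elements. In (B) no basis is known beforehand, so spanning is proved as
  well: commutators of primitive elements are primitive, whence a product of them equals its
  symmetrisation up to products with fewer factors.\<close>

lemma span_mult:
  fixes x y :: "'a::real_algebra"
  assumes "x \<in> span A" "y \<in> span B" "\<And>a b. a \<in> A \<Longrightarrow> b \<in> B \<Longrightarrow> a * b \<in> span C"
  shows "x * y \<in> span C"
  using assms(1)
proof (induction rule: span_induct_alt)
  case (step c a x)
  have "a * y \<in> span C"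
    using assms(2)
  proof (induction rule: span_induct_alt)
    case (step c b y)
    then show ?case using assms(3)[OF \<open>a \<in> A\<close>] by (simp add: distrib_left span_add span_scale)
  qed (simp add: span_zero)
  then show ?case using step by (simp add: distrib_right span_add span_scale)
qed (simp add: span_zero)

text \<open>A repetition \<open>b i = b j\<close> is itself a relation, with coefficients 1 and -1,
  so relations between indices express injectivity and independence together.\<close>

lemma independent_family_iff:
  fixes b :: "'i \<Rightarrow> 'v::real_vector"
  shows "inj_on b I \<and> independent (b ` I) \<longleftrightarrow>
    (\<forall>F c. finite F \<and> F \<subseteq> I \<and> (\<Sum>i\<in>F. c i *\<^sub>R b i) = 0 \<longrightarrow> (\<forall>i\<in>F. c i = 0))"
    (is "?L \<longleftrightarrow> ?R")
proof
  assume L: ?L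
  show ?R
  proof (intro allI impI ballI)
    fix F c i assume F: "finite F \<and> F \<subseteq> I \<and> (\<Sum>i\<in>F. c i *\<^sub>R b i) = 0" and i: "i \<in> F"
    have inj: "inj_on b F" using L F inj_on_subset by blast
    have "(\<Sum>v\<in>b ` F. c (inv_into F b v) *\<^sub>R v) = (\<Sum>i\<in>F. c i *\<^sub>R b i)"
      by (simp add: sum.reindex[OF inj] inv_into_f_f[OF inj])
    then have "c (inv_into F b (b i)) = 0"
      using independentD[of "b ` I" "b ` F" "\<lambda>v. c (inv_into F b v)" "b i"] L F i by auto
    then show "c i = 0" by (simp add: inv_into_f_f[OF inj i])
  qed
next
  assume R: ?R
  have inj: "inj_on b I"
  proof (rule inj_onI, rule ccontr)
    fix i j assume ij: "i \<in> I" "j \<in> I" "b i = b j" "i \<noteq> j"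
    then have "(\<Sum>k\<in>{i, j}. (if k = i then 1 else -1) *\<^sub>R b k) = 0" by auto
    with R[rule_format, of "{i, j}" "\<lambda>k. if k = i then 1 else -1" i] ij show False by auto
  qed
  moreover have "independent (b ` I)"
  proof -
    have "u v = 0" if t: "finite t" "t \<subseteq> b ` I" "(\<Sum>v\<in>t. u v *\<^sub>R v) = 0" "v \<in> t" for t u v
    proof -
      obtain F where F: "F \<subseteq> I" "t = b ` F" using t(2) by (auto simp: subset_image_iff)
      have injF: "inj_on b F" using inj F inj_on_subset by blast
      have "finite F" using t(1) F injF finite_imageD by blast
      moreover have "(\<Sum>i\<in>F. u (b i) *\<^sub>R b i) = 0"
        using t(3) F by (simp add: sum.reindex[OF injF])
      ultimately show ?thesis using R[rule_format, of F "\<lambda>i. u (b i)"] F t(4) by auto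
    qed
    then show ?thesis unfolding real_vector.dependent_explicit by blast
  qed
  ultimately show ?L ..
qed

lemma basis_family_iff:
  "is_basis_family I b \<longleftrightarrow> (\<forall>F c. finite F \<and> F \<subseteq> I \<and> (\<Sum>i\<in>F. c i *\<^sub>R b i) = 0 \<longrightarrow> (\<forall>i\<in>F. c i = 0))
    \<and> span (b ` I) = UNIV"
  unfolding is_basis_family_def conj_assoc[symmetric] independent_family_iff ..

lemma is_basis_family_reindex:
  assumes "bij_betw h J I"
  shows "is_basis_family J (b \<circ> h) \<longleftrightarrow> is_basis_family I b"
proof -
  have "h ` J = I" "inj_on h J" using assms by (auto simp: bij_betw_def)
  then show ?thesis
    unfolding is_basis_family_def image_comp[symmetric] by (metis comp_inj_on_iff image_comp)
qed

lemma is_basis_family_cong: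
  "(\<And>i. i \<in> I \<Longrightarrow> b i = b' i) \<Longrightarrow> is_basis_family I b \<longleftrightarrow> is_basis_family I b'"
  unfolding is_basis_family_def by (metis image_cong inj_on_cong)

lemma is_basis_family_nonzero: "is_basis_family I b \<Longrightarrow> i \<in> I \<Longrightarrow> b i \<noteq> 0"
  unfolding is_basis_family_def by (metis dependent_zero imageI)

lemma functional_eq_1:
  fixes v :: "'v::real_vector"
  assumes "v \<noteq> 0"
  obtains f :: "'v \<Rightarrow> real" where "linear f" "f v = 1"
  using linear_independent_extend[of "{v}" "\<lambda>_. 1::real"] assms by auto

text \<open>If the linear coefficients differed, a functional with value 1 on the difference would
  turn both sides into real polynomials that agree at all natural numbers, hence are equal. The two
  sides may be expanded in unrelated families of vectors.\<close>

lemma coeff_1_unique: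
  fixes v :: "'k \<Rightarrow> 'v::real_vector" and w :: "'l \<Rightarrow> 'v"
  assumes eq: "\<And>n::nat. (\<Sum>k\<in>K. poly (p k) (real n) *\<^sub>R v k) = (\<Sum>l\<in>L. poly (q l) (real n) *\<^sub>R w l)"
  shows "(\<Sum>k\<in>K. coeff (p k) 1 *\<^sub>R v k) = (\<Sum>l\<in>L. coeff (q l) 1 *\<^sub>R w l)"
proof (rule ccontr)
  let ?d = "(\<Sum>k\<in>K. coeff (p k) 1 *\<^sub>R v k) - (\<Sum>l\<in>L. coeff (q l) 1 *\<^sub>R w l)"
  assume "\<not> ?thesis"
  then have "?d \<noteq> 0" by simp
  then obtain f :: "'v \<Rightarrow> real" where f: "linear f" "f ?d = 1"
    by (rule functional_eq_1)
  let ?q = "(\<Sum>k\<in>K. smult (f (v k)) (p k)) - (\<Sum>l\<in>L. smult (f (w l)) (q l)) :: real poly"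
  have "poly ?q (real n) = 0" for n
    using arg_cong[OF eq[of n], of f]
    by (simp add: poly_sum linear_sum[OF f(1)] linear_scale[OF f(1)] mult.commute)
  then have "range real \<subseteq> {x. poly ?q x = 0}" by auto
  moreover have "infinite (range real)"
    by (simp add: finite_image_iff inj_of_nat)
  ultimately have "?q = 0" using poly_roots_finite finite_subset by blast
  then have "coeff ?q 1 = 0" by simp
  then show False
    using f(2) by (simp add: coeff_sum linear_diff[OF f(1)] linear_sum[OF f(1)] linear_scale[OF f(1)] mult.commute)
qed

section \<open>The direct sum decomposition and its projections\<close>

context graded_connected_hopf_algebra
begin

definition decomposition :: "(nat \<Rightarrow> 'h) \<Rightarrow> 'h \<Rightarrow> bool"
  where "decomposition f x \<longleftrightarrow> (\<forall>n. f n \<in> H n) \<and> finite {n. f n \<noteq> 0} \<and> x = (\<Sum>n | f n \<noteq> 0. f n)"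

lemma zero_in_H [simp]: "0 \<in> H n" by (rule subspace_0[OF subspace_H])

lemma decompositionI:
  assumes "\<And>n. f n \<in> H n" "finite N" "\<And>n. n \<notin> N \<Longrightarrow> f n = 0" "x = (\<Sum>n\<in>N. f n)"
  shows "decomposition f x"
proof -
  have "{n. f n \<noteq> 0} \<subseteq> N" using assms(3) by auto
  then show ?thesis
    unfolding decomposition_def assms(4) using assms(1,2)
    by (auto intro: finite_subset sum.mono_neutral_right)
qed

lemma decompositionD:
  assumes "decomposition f x" "finite N" "{n. f n \<noteq> 0} \<subseteq> N"
  shows "x = (\<Sum>n\<in>N. f n)"
proof -
  have "x = (\<Sum>n | f n \<noteq> 0. f n)" using assms(1) decomposition_def by blast
  also have "\<dots> = (\<Sum>n\<in>N. f n)" using assms by (intro sum.mono_neutral_left) auto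
  finally show ?thesis .
qed

lemma decomposition_add_scale:
  assumes "decomposition f x" "decomposition g y"
  shows "decomposition (\<lambda>n. r *\<^sub>R f n + g n) (r *\<^sub>R x + y)"
proof -
  let ?N = "{n. f n \<noteq> 0} \<union> {n. g n \<noteq> 0}"
  have N: "finite ?N" using assms by (auto simp: decomposition_def)
  show ?thesis
  proof (rule decompositionI[where N = ?N])
    show "r *\<^sub>R f n + g n \<in> H n" for n
      using assms by (auto simp: decomposition_def intro!: subspace_add subspace_scale subspace_H)
    have "x = (\<Sum>n\<in>?N. f n)" "y = (\<Sum>n\<in>?N. g n)"
      by (rule decompositionD[OF assms(1) N], blast) (rule decompositionD[OF assms(2) N], blast)
    then show "r *\<^sub>R x + y = (\<Sum>n\<in>?N. r *\<^sub>R f n + g n)"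
      by (simp add: sum.distrib scaleR_sum_right)
  qed (use N in auto)
qed

lemma decomposition_homogeneous: "x \<in> H m \<Longrightarrow> decomposition (\<lambda>n. if n = m then x else 0) x"
  by (rule decompositionI[where N = "{m}"]) auto

lemma decomposition_exists: "\<exists>f. decomposition f x"
proof -
  have "x \<in> span (\<Union>n. H n)" by (simp add: span_H)
  then show ?thesis
  proof (induction rule: span_induct_alt)
    case base
    show ?case by (rule exI[of _ "\<lambda>_. 0"]) (auto simp: decomposition_def)
  next
    case (step c x y)
    then show ?case using decomposition_add_scale decomposition_homogeneous by blast
  qed
qed

lemma decomposition_unique:
  assumes "decomposition f x" "decomposition g x"
  shows "f = g"
proof
  fix n
  have d: "decomposition (\<lambda>n. (- 1) *\<^sub>R f n + g n) ((- 1) *\<^sub>R x + x)"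
    by (rule decomposition_add_scale[OF assms])
  let ?N = "insert n {n. (- 1) *\<^sub>R f n + g n \<noteq> 0}"
  have "finite ?N" using d unfolding decomposition_def by blast
  moreover from decompositionD[OF d this] have "(\<Sum>n\<in>?N. (- 1) *\<^sub>R f n + g n) = 0" by auto
  ultimately have "(- 1) *\<^sub>R f n + g n = 0"
    using d by (intro direct_H[of ?N "\<lambda>n. (- 1) *\<^sub>R f n + g n"]) (auto simp: decomposition_def)
  then show "f n = g n" by simp
qed

text \<open>The projection onto \<open>H n\<close>. By \<open>decomposition_unique\<close> the
  choice is forced, which is also why the map is linear.\<close>

definition component :: "nat \<Rightarrow> 'h \<Rightarrow> 'h"
  where "component n x = (SOME f. decomposition f x) n"

lemma decomposition_component: "decomposition (\<lambda>n. component n x) x"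
  unfolding component_def using someI_ex[OF decomposition_exists[of x]] .

lemma component_eqI: "decomposition f x \<Longrightarrow> component n x = f n"
  using decomposition_unique[OF decomposition_component] by metis

lemma component_in_H [simp]: "component n x \<in> H n"
  using decomposition_component[of x] by (simp add: decomposition_def)

lemma component_homogeneous: "x \<in> H m \<Longrightarrow> component n x = (if n = m then x else 0)"
  using component_eqI[OF decomposition_homogeneous] by simp

lemma linear_component: "linear (component n)"
proof (rule linearI)
  show "component n (x + y) = component n x + component n y" for x y
    using component_eqI[OF decomposition_add_scale[of _ _ _ _ 1, OF decomposition_component decomposition_component]]
    by simp
  show "component n (r *\<^sub>R x) = r *\<^sub>R component n x" for r x
    using component_eqI[OF decomposition_add_scale[of _ _ _ _ r,
      OF decomposition_component[of x] decomposition_component[of 0]], of n]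
      component_homogeneous[OF zero_in_H, of n] by simp
qed

lemma component_sum:
  assumes "finite N" "{n. component n x \<noteq> 0} \<subseteq> N"
  shows "x = (\<Sum>n\<in>N. component n x)"
  by (rule decompositionD[OF decomposition_component assms])

lemma finite_component: "finite {n. component n x \<noteq> 0}"
  using decomposition_component[of x] by (simp add: decomposition_def)

lemma degree_unique:
  assumes "x \<in> H m" "x \<in> H n" "x \<noteq> 0"
  shows "m = n"
  using assms component_homogeneous[of x m m] component_homogeneous[of x n m] by (metis (full_types))

lemma hdeg_eq: "x \<in> H n \<Longrightarrow> x \<noteq> 0 \<Longrightarrow> hdeg H x = n"
  unfolding hdeg_def using degree_unique by blast

lemma one_in_H0: "1 \<in> H 0" by (simp add: H_0 span_base)

lemma linear_eq_on_homogeneous: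
  assumes "linear f" "linear g" "\<And>n x. x \<in> H n \<Longrightarrow> f x = g x"
  shows "f x = g x"
  by (rule linear_eq_on_span[of f g "\<Union>n. H n"]) (use assms span_H in auto)

text \<open>The projection onto degree n fixes the members of degree n and kills all others, so it
  carries the spanning family onto those of degree n and 0.\<close>

lemma homogeneous_span:
  assumes "\<And>s. s \<in> S \<Longrightarrow> b s \<in> H (d s)" "span (b ` S) = UNIV"
  shows "H n = span (b ` {s \<in> S. d s = n})"
proof
  show "span (b ` {s \<in> S. d s = n}) \<subseteq> H n"
    using assms(1) by (intro span_minimal subspace_H) auto
  show "H n \<subseteq> span (b ` {s \<in> S. d s = n})"
  proof
    fix x assume "x \<in> H n"
    then have "x = component n x" by (simp add: component_homogeneous)
    also have "\<dots> \<in> component n ` span (b ` S)" using assms(2) by simp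
    also have "\<dots> = span (component n ` b ` S)"
      by (simp add: linear_span_image[OF linear_component])
    also have "\<dots> \<subseteq> span (insert 0 (b ` {s \<in> S. d s = n}))"
      by (intro span_mono) (auto simp: component_homogeneous[OF assms(1)])
    finally show "x \<in> span (b ` {s \<in> S. d s = n})" by simp
  qed
qed

text \<open>Applying \<open>component (d i)\<close> to a relation isolates the terms of the degree
  of i.\<close>

lemma independent_by_degree:
  assumes "\<And>i. i \<in> I \<Longrightarrow> b i \<in> H (d i)"
    and "\<And>n. inj_on b {i \<in> I. d i = n} \<and> independent (b ` {i \<in> I. d i = n})"
  shows "inj_on b I \<and> independent (b ` I)"
  unfolding independent_family_iff
proof (intro allI impI ballI)
  fix F c i assume F: "finite F \<and> F \<subseteq> I \<and> (\<Sum>i\<in>F. c i *\<^sub>R b i) = 0" and i: "i \<in> F"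
  have "0 = component (d i) (\<Sum>j\<in>F. c j *\<^sub>R b j)"
    using F by (simp add: linear_0[OF linear_component])
  also have "\<dots> = (\<Sum>j\<in>F. c j *\<^sub>R component (d i) (b j))"
    by (simp add: linear_sum[OF linear_component] linear_scale[OF linear_component])
  also have "\<dots> = (\<Sum>j\<in>F. if d j = d i then c j *\<^sub>R b j else 0)"
    using F by (intro sum.cong refl) (auto simp: component_homogeneous[OF assms(1)] subset_iff)
  also have "\<dots> = (\<Sum>j\<in>{j \<in> F. d j = d i}. c j *\<^sub>R b j)"
    using F by (simp add: sum.inter_filter)
  finally show "c i = 0"
    using assms(2)[of "d i", unfolded independent_family_iff, rule_format,
        of "{j \<in> F. d j = d i}" c i] F i by auto
qed

end

section \<open>Bases when every degree is finite-dimensional\<close>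

locale finite_type_hopf_algebra = graded_connected_hopf_algebra H \<Delta>
  for H :: "nat \<Rightarrow> 'h::real_algebra_1 set" and \<Delta> +
  assumes finite_dim: "\<exists>B. finite B \<and> H n = span B"
begin

text \<open>The members of degree n form a basis of \<open>H n\<close>; finite dimension then forces
  finitely many of them, even if I is infinite.\<close>

lemma basis_degree:
  assumes "is_basis_family I b" "\<And>i. i \<in> I \<Longrightarrow> b i \<in> H (d i)"
  shows "finite {i \<in> I. d i = n}" "card {i \<in> I. d i = n} = dim (H n)"
proof -
  let ?I = "{i \<in> I. d i = n}"
  have inj: "inj_on b ?I" and ind: "independent (b ` ?I)"
    using assms(1) independent_mono[of "b ` I" "b ` ?I"] unfolding is_basis_family_def
    by (auto intro: inj_on_subset)
  have H: "H n = span (b ` ?I)"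
    by (rule homogeneous_span) (use assms in \<open>auto simp: is_basis_family_def\<close>)
  obtain B where B: "finite B" "H n = span B" using finite_dim by blast
  have "finite (b ` ?I)"
    using independent_span_bound[OF B(1) ind] H B(2) span_superset by metis
  then show "finite ?I" using inj finite_imageD by blast
  show "card ?I = dim (H n)"
    using dim_span_eq_card_independent[OF ind] H card_image[OF inj] by metis
qed

text \<open>Two homogeneous families with the same degrees have the same finite number of members in
  each degree, so either half of the definition of a basis suffices for the second one.\<close>

lemma basis_if_spanning:
  assumes b: "is_basis_family I b" "\<And>i. i \<in> I \<Longrightarrow> b i \<in> H (d i)"
    and b': "\<And>i. i \<in> I \<Longrightarrow> b' i \<in> H (d i)" "span (b' ` I) = UNIV"
  shows "is_basis_family I b'"
proof -
  have "inj_on b' {i \<in> I. d i = n} \<and> independent (b' ` {i \<in> I. d i = n})" for n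
  proof -
    let ?I = "{i \<in> I. d i = n}"
    note fin = basis_degree[OF b, of n]
    have H: "H n = span (b' ` ?I)" by (rule homogeneous_span[OF b'])
    have "dim (H n) \<le> card (b' ` ?I)"
      using H fin(1) by (metis dim_le_card finite_imageI order_refl)
    with fin have card: "card (b' ` ?I) = dim (H n)" "card (b' ` ?I) = card ?I"
      using card_image_le[OF fin(1), of b'] by linarith+
    from card(2) have "inj_on b' ?I" using fin(1) eq_card_imp_inj_on by blast
    moreover have "independent (b' ` ?I)"
    proof -
      obtain B where B: "B \<subseteq> b' ` ?I" "independent B" "card B = dim (b' ` ?I)"
        by (rule basis_exists[of "b' ` ?I"])
      have "dim (b' ` ?I) = dim (H n)" using H dim_span by metis
      then have "B = b' ` ?I" using B card fin(1) by (intro card_subset_eq) auto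
      then show ?thesis using B(2) by simp
    qed
    ultimately show ?thesis ..
  qed
  then have "inj_on b' I \<and> independent (b' ` I)"
    using independent_by_degree[of I b' d] b'(1) by blast
  then show ?thesis using b'(2) by (simp add: is_basis_family_def)
qed

lemma basis_if_independent:
  assumes b: "is_basis_family I b" "\<And>i. i \<in> I \<Longrightarrow> b i \<in> H (d i)"
    and b': "\<And>i. i \<in> I \<Longrightarrow> b' i \<in> H (d i)" "inj_on b' I \<and> independent (b' ` I)"
  shows "is_basis_family I b'"
proof -
  have "H n \<subseteq> span (b' ` I)" for n
  proof -
    let ?I = "{i \<in> I. d i = n}"
    note fin = basis_degree[OF b, of n]
    have inj: "inj_on b' ?I" using b'(2) by (auto intro: inj_on_subset)
    have ind: "independent (b' ` ?I)"
      by (rule independent_mono[of "b' ` I"]) (use b'(2) in auto)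
    obtain B where B: "finite B" "H n = span B" using finite_dim by blast
    have "H n \<subseteq> span (b' ` ?I)"
    proof (rule ccontr)
      assume "\<not> ?thesis"
      then obtain x where x: "x \<in> H n" "x \<notin> span (b' ` ?I)" by blast
      then have ind': "independent (insert x (b' ` ?I))"
        using ind by (simp add: independent_insertI)
      have sub: "insert x (b' ` ?I) \<subseteq> H n" using x b'(1) by auto
      have "x \<notin> b' ` ?I" using x(2) span_base[of x "b' ` ?I"] by argo
      then have "card (insert x (b' ` ?I)) = Suc (card ?I)"
        using fin(1) by (simp add: card_image[OF inj])
      moreover have "card (insert x (b' ` ?I)) \<le> card (b ` ?I)"
      proof -
        have "H n = span (b ` ?I)"
          by (rule homogeneous_span) (use b in \<open>auto simp: is_basis_family_def\<close>)
        then show ?thesis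
          using independent_span_bound[of "b ` ?I" "insert x (b' ` ?I)"] ind' fin(1) sub by auto
      qed
      ultimately show False using card_image_le[OF fin(1), of b] by linarith
    qed
    then show ?thesis using span_mono[of "b' ` ?I" "b' ` I"] by blast
  qed
  then have "span (\<Union>n. H n) \<subseteq> span (b' ` I)" by (intro span_minimal) auto
  then show ?thesis using b'(2) span_H by (auto simp: is_basis_family_def)
qed

text \<open>Comparing coordinates in T x = a^m x leaves only the basis vectors with a^(k i) = a^m.
  As a is at least 2, distinct exponents give distinct eigenvalues, so these are the ones with k i =
  m.\<close>

lemma dim_eigenspace:
  assumes b: "is_basis_family I b" "\<And>i. i \<in> I \<Longrightarrow> b i \<in> H (d i)"
    and T: "linear T" "\<And>i. i \<in> I \<Longrightarrow> T (b i) = (real a ^ k i) *\<^sub>R b i" and a: "a \<ge> 2"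
  shows "dim {x \<in> H n. T x = (real a ^ m) *\<^sub>R x} = card {i \<in> I. d i = n \<and> k i = m}"
proof -
  let ?I = "{i \<in> I. d i = n}" and ?J = "{i \<in> I. d i = n \<and> k i = m}"
  note fin = basis_degree[OF b, of n]
  have inj: "inj_on b I" and ind: "independent (b ` I)" using b(1) by (auto simp: is_basis_family_def)
  have "{x \<in> H n. T x = (real a ^ m) *\<^sub>R x} = span (b ` ?J)"
  proof (intro equalityI subsetI)
    fix x assume x: "x \<in> {x \<in> H n. T x = (real a ^ m) *\<^sub>R x}"
    have "H n = span (b ` ?I)"
      by (rule homogeneous_span) (use b in \<open>auto simp: is_basis_family_def\<close>)
    then have "x \<in> span (b ` ?I)" using x by simp
    then obtain u where "x = (\<Sum>v\<in>b ` ?I. u v *\<^sub>R v)"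
      using fin(1) by (auto simp: span_finite)
    then have xc: "x = (\<Sum>i\<in>?I. u (b i) *\<^sub>R b i)"
      using inj by (subst (asm) sum.reindex) (auto intro: inj_on_subset)
    have "0 = T x - (real a ^ m) *\<^sub>R x" using x by simp
    also have "\<dots> = (\<Sum>i\<in>?I. (u (b i) * (real a ^ k i - real a ^ m)) *\<^sub>R b i)"
      unfolding xc using T(2)
      by (simp add: linear_sum[OF T(1)] linear_scale[OF T(1)] scaleR_sum_right
          sum_subtractf[symmetric] algebra_simps)
    finally have z: "\<forall>i\<in>?I. u (b i) * (real a ^ k i - real a ^ m) = 0"
      using b(1)[unfolded basis_family_iff, THEN conjunct1, rule_format,
          of ?I "\<lambda>i. u (b i) * (real a ^ k i - real a ^ m)"] fin(1) by auto
    have "u (b i) *\<^sub>R b i \<in> span (b ` ?J)" if "i \<in> ?I" for i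
    proof (cases "k i = m")
      case True
      then show ?thesis using that by (intro span_scale span_base) auto
    next
      case False
      then have "real a ^ k i \<noteq> real a ^ m" using a by simp
      then have "u (b i) = 0" using z that by auto
      then show ?thesis by (simp add: span_zero)
    qed
    then show "x \<in> span (b ` ?J)" unfolding xc by (intro span_sum)
  next
    fix x assume "x \<in> span (b ` ?J)"
    moreover have "span (b ` ?J) \<subseteq> {x \<in> H n. T x = (real a ^ m) *\<^sub>R x}"
    proof (rule span_minimal)
      show "b ` ?J \<subseteq> {x \<in> H n. T x = (real a ^ m) *\<^sub>R x}" using b(2) T(2) by auto
      show "subspace {x \<in> H n. T x = (real a ^ m) *\<^sub>R x}" unfolding subspace_def
      by (auto simp: linear_0[OF T(1)] linear_add[OF T(1)] linear_scale[OF T(1)] scaleR_add_right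
          intro: subspace_add subspace_scale subspace_H)
    qed
    ultimately show "x \<in> {x \<in> H n. T x = (real a ^ m) *\<^sub>R x}" ..
  qed
  moreover have "dim (b ` ?J) = card (b ` ?J)"
    by (rule dim_eq_card_independent, rule independent_mono[OF ind]) auto
  ultimately have "dim {x \<in> H n. T x = (real a ^ m) *\<^sub>R x} = card (b ` ?J)"
    by (simp add: dim_span)
  moreover have "inj_on b ?J" by (rule inj_on_subset[OF inj]) auto
  ultimately show ?thesis by (simp add: card_image)
qed

end


section \<open>Sweedler calculus\<close>

definition bilin :: "('a::real_vector \<Rightarrow> 'b::real_vector \<Rightarrow> 'c::real_vector) \<Rightarrow> bool"
  where "bilin \<beta> \<longleftrightarrow> (\<forall>y. linear (\<beta> y)) \<and> (\<forall>z. linear (\<lambda>y. \<beta> y z))"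

definition trilin ::
    "('a::real_vector \<Rightarrow> 'b::real_vector \<Rightarrow> 'c::real_vector \<Rightarrow> 'd::real_vector) \<Rightarrow> bool"
  where "trilin F \<longleftrightarrow> (\<forall>x. bilin (F x)) \<and> (\<forall>y z. linear (\<lambda>x. F x y z))"

lemma bilinI: "(\<And>y. linear (\<lambda>z. \<beta> y z)) \<Longrightarrow> (\<And>z. linear (\<lambda>y. \<beta> y z)) \<Longrightarrow> bilin \<beta>"
  by (simp add: bilin_def)

lemma bilinD: "bilin \<beta> \<Longrightarrow> linear (\<beta> y)" "bilin \<beta> \<Longrightarrow> linear (\<lambda>y. \<beta> y z)"
  by (simp_all add: bilin_def)

lemma bilin_comp1: "bilin \<beta> \<Longrightarrow> linear f \<Longrightarrow> linear (\<lambda>x. \<beta> (f x) z)"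
  using linear_compose[of f "\<lambda>y. \<beta> y z"] by (simp add: bilin_def o_def)

lemma bilin_comp2: "bilin \<beta> \<Longrightarrow> linear f \<Longrightarrow> linear (\<lambda>x. \<beta> z (f x))"
  using linear_compose[of f "\<beta> z"] by (simp add: bilin_def o_def)

lemma trilinI:
  "(\<And>y z. linear (\<lambda>x. F x y z)) \<Longrightarrow> (\<And>x z. linear (\<lambda>y. F x y z)) \<Longrightarrow> (\<And>x y. linear (\<lambda>z. F x y z))
    \<Longrightarrow> trilin F"
  by (simp add: trilin_def bilin_def)

lemma trilinD:
  assumes "trilin F"
  shows "linear (\<lambda>x. F x y z)" "linear (\<lambda>y. F x y z)" "linear (\<lambda>z. F x y z)"
  using assms by (auto simp: trilin_def bilin_def)

lemma linear_comp: "linear h \<Longrightarrow> linear f \<Longrightarrow> linear (\<lambda>x. h (f x))"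
  using linear_compose[of f h] by (simp add: o_def)

lemma linear_mult_right: "linear f \<Longrightarrow> linear (\<lambda>x. c * (f x :: 'b::real_algebra))"
  by (rule linearI) (simp_all add: linear_add linear_scale distrib_left)

lemma linear_mult_left: "linear f \<Longrightarrow> linear (\<lambda>x. (f x :: 'b::real_algebra) * c)"
  by (rule linearI) (simp_all add: linear_add linear_scale distrib_right)

lemma linear_scaleR_left': "linear f \<Longrightarrow> linear (\<lambda>x. f x *\<^sub>R v)"
  by (rule linearI) (simp_all add: linear_add linear_scale scaleR_add_left)

lemma linear_pure_tensor1: "linear f \<Longrightarrow> linear (\<lambda>x. pure_tensor (f x # vs))"
  using pure_tensor_add[of "[]" _ _ vs] pure_tensor_scale[of "[]" _ _ vs]
  by (intro linearI) (simp_all add: linear_add linear_scale)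

lemma linear_pure_tensor2: "linear f \<Longrightarrow> linear (\<lambda>x. pure_tensor (u # f x # vs))"
  using pure_tensor_add[of "[u]" _ _ vs] pure_tensor_scale[of "[u]" _ _ vs]
  by (intro linearI) (simp_all add: linear_add linear_scale)

lemma linear_const_0: "linear (\<lambda>_. 0)"
  by (rule linearI) simp_all

lemma linear_var: "linear (\<lambda>x. x)"
  by (rule linearI) simp_all

lemmas lin_intros = linear_const_0 linear_var linear_compose_add linear_compose_sub
  linear_compose_scale_right linear_mult_left linear_mult_right linear_scaleR_left'
  linear_pure_tensor1 linear_pure_tensor2

text \<open>\<open>tensor_lift\<close> expects a function on lists of every length, so a bilinear
  map is extended by 0 to lists of length other than 2.\<close>

definition pair_extend ::
    "('a \<Rightarrow> 'a \<Rightarrow> 'b::real_vector) \<Rightarrow> 'a list \<Rightarrow> 'b"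
  where "pair_extend \<beta> xs = (case xs of [y, z] \<Rightarrow> \<beta> y z | _ \<Rightarrow> 0)"

definition triple_extend ::
    "('a \<Rightarrow> 'a \<Rightarrow> 'a \<Rightarrow> 'b::real_vector) \<Rightarrow> 'a list \<Rightarrow> 'b"
  where "triple_extend F xs = (case xs of [x, y, z] \<Rightarrow> F x y z | _ \<Rightarrow> 0)"

lemma pair_extend_simps [simp]: "pair_extend \<beta> [y, z] = \<beta> y z"
  by (simp add: pair_extend_def)

lemma triple_extend_Cons: "triple_extend F (y # ts) = pair_extend (F y) ts"
  by (auto simp: triple_extend_def pair_extend_def split: list.split)

lemma triple_extend_snoc: "triple_extend F (ts @ [z]) = pair_extend (\<lambda>x y. F x y z) ts"
  by (cases ts rule: remdups_adj.cases) (auto simp: triple_extend_def pair_extend_def split: list.split)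

lemma multilinear_pair_extend:
  assumes "bilin \<beta>"
  shows "multilinear (pair_extend \<beta>)"
  unfolding multilinear_def
proof (intro conjI allI)
  fix us vs and x y :: 'a and r :: real
  note l = linear_add[OF bilinD(1)[OF assms]] linear_add[OF bilinD(2)[OF assms]]
    linear_scale[OF bilinD(1)[OF assms]] linear_scale[OF bilinD(2)[OF assms]]
  show "pair_extend \<beta> (us @ (x + y) # vs) = pair_extend \<beta> (us @ x # vs) + pair_extend \<beta> (us @ y # vs)"
    by (cases us rule: remdups_adj.cases) (auto simp: pair_extend_def l split: list.split)
  show "pair_extend \<beta> (us @ (r *\<^sub>R x) # vs) = r *\<^sub>R pair_extend \<beta> (us @ x # vs)"
    by (cases us rule: remdups_adj.cases) (auto simp: pair_extend_def l split: list.split)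
qed

lemma multilinear_triple_extend:
  assumes "trilin F"
  shows "multilinear (triple_extend F)"
  unfolding multilinear_def
proof (intro conjI allI)
  fix us vs and x y :: 'a and r :: real
  have b: "bilin (F u)" for u using assms by (simp add: trilin_def)
  note m = multilinear_pair_extend[OF b, unfolded multilinear_def, THEN conjunct1, rule_format]
    multilinear_pair_extend[OF b, unfolded multilinear_def, THEN conjunct2, rule_format]
  note l = linear_add[OF trilinD(1)[OF assms]] linear_scale[OF trilinD(1)[OF assms]]
  show "triple_extend F (us @ (x + y) # vs) = triple_extend F (us @ x # vs) + triple_extend F (us @ y # vs)"
    by (cases us) (auto simp: triple_extend_Cons m, auto simp: pair_extend_def l split: list.split)
  show "triple_extend F (us @ (r *\<^sub>R x) # vs) = r *\<^sub>R triple_extend F (us @ x # vs)"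
    by (cases us) (auto simp: triple_extend_Cons m, auto simp: pair_extend_def l split: list.split)
qed

lemmas pair_lift = tensor_lift[OF multilinear_pair_extend]
lemmas triple_lift = tensor_lift[OF multilinear_triple_extend]

lemma pair_lift_compose:
  assumes "linear f" "bilin \<beta>"
  shows "f (tensor_lift (pair_extend \<beta>) t) = tensor_lift (pair_extend (\<lambda>y z. f (\<beta> y z))) t"
proof (rule tensor_lift_eqI)
  have b: "bilin (\<lambda>y z. f (\<beta> y z))"
    by (intro bilinI linear_comp[OF assms(1)] bilinD[OF assms(2)])
  show "linear (\<lambda>t. f (tensor_lift (pair_extend \<beta>) t))" "linear (tensor_lift (pair_extend (\<lambda>y z. f (\<beta> y z))))"
    by (rule linear_comp[OF assms(1) pair_lift(1)[OF assms(2)]], rule pair_lift(1)[OF b])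
  fix xs
  show "f (tensor_lift (pair_extend \<beta>) (pure_tensor xs))
    = tensor_lift (pair_extend (\<lambda>y z. f (\<beta> y z))) (pure_tensor xs)"
    by (unfold pair_lift(2)[OF b] pair_lift(2)[OF assms(2)])
      (simp add: pair_extend_def linear_0[OF assms(1)] split: list.split)
qed

lemma linear_pair_lift_param:
  assumes "\<And>x. bilin (\<beta> x)" "\<And>y z. linear (\<lambda>x. \<beta> x y z)"
  shows "linear (\<lambda>x. tensor_lift (pair_extend (\<beta> x)) t)"
proof (rule linearI)
  fix x x' and r :: real
  note L = pair_lift(1)[OF assms(1)] and P = pair_lift(2)[OF assms(1)]
  show "tensor_lift (pair_extend (\<beta> (x + x'))) t
    = tensor_lift (pair_extend (\<beta> x)) t + tensor_lift (pair_extend (\<beta> x')) t"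
    by (rule tensor_lift_eqI[where F = "tensor_lift _"], rule L, intro linear_compose_add L)
      (unfold P, simp add: pair_extend_def linear_add[OF assms(2)] split: list.split)
  show "tensor_lift (pair_extend (\<beta> (r *\<^sub>R x))) t = r *\<^sub>R tensor_lift (pair_extend (\<beta> x)) t"
    by (rule tensor_lift_eqI[where F = "tensor_lift _"], rule L, intro linear_compose_scale_right L)
      (unfold P, simp add: pair_extend_def linear_scale[OF assms(2)] split: list.split)
qed

text \<open>All tensor orders share one type. Coproducts take values in this part of order 2, where
  an identity of linear maps can be checked on pairs alone.\<close>

definition tensor_square :: "'a::real_vector tensor_algebra set"
  where "tensor_square = span {pure_tensor [y, z] |y z. True}"

lemma tensor_square_eqI:
  assumes "linear F" "linear G" "\<And>y z. F (pure_tensor [y, z]) = G (pure_tensor [y, z])"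
    "t \<in> tensor_square"
  shows "F t = G t"
  by (rule linear_eq_on_span[OF assms(1,2) _ assms(4)[unfolded tensor_square_def]]) (use assms(3) in auto)

lemma tensor_concat_Nil: "tensor_concat (pure_tensor []) t = t"
  by (rule tensor_lift_eqI[of "tensor_concat (pure_tensor [])" "\<lambda>t. t"])
    (simp_all add: tensor_concat linear_var)

text \<open>The tensor of order 0 is excluded because \<open>map_last\<close> would evaluate
  \<open>last []\<close> there; in positive order it commutes with concatenation on the
  left.\<close>

definition positive_tensors :: "'a::real_vector tensor_algebra set"
  where "positive_tensors = span {pure_tensor xs |xs. xs \<noteq> []}"

lemma tensor_square_positive: "tensor_square \<subseteq> positive_tensors"
  unfolding tensor_square_def positive_tensors_def by (rule span_mono) auto

lemma concat_positive:
  assumes "t \<in> positive_tensors"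
  shows "tensor_concat (pure_tensor ys) t \<in> positive_tensors"
  using assms unfolding positive_tensors_def
proof (induction rule: span_induct_alt)
  case base
  then show ?case by (simp add: linear_0[OF tensor_concat(2)] span_zero)
next
  case (step c x y)
  then obtain xs where xs: "x = pure_tensor xs" "xs \<noteq> []" by blast
  have "pure_tensor (ys @ xs) \<in> span {pure_tensor xs |xs. xs \<noteq> []}"
    by (rule span_base) (use xs(2) in blast)
  then show ?case using step(2)
    by (simp add: linear_add[OF tensor_concat(2)] linear_scale[OF tensor_concat(2)] tensor_concat(3)
        xs(1) span_add span_scale)
qed

lemma linear_map_last: "linear D \<Longrightarrow> linear (map_last D)"
  unfolding map_last_def by (rule tensor_lift(1)[OF multilinear_map_last])

lemma map_last_pure: "linear D \<Longrightarrow> map_last D (pure_tensor xs)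
    = tensor_concat (pure_tensor (butlast xs)) (D (last xs))"
  unfolding map_last_def by (rule tensor_lift(2)[OF multilinear_map_last])

lemma tensor_concat_assoc: "tensor_concat (tensor_concat (pure_tensor xs) (pure_tensor ys)) t
    = tensor_concat (pure_tensor xs) (tensor_concat (pure_tensor ys) t)"
  by (rule tensor_lift_eqI[of "tensor_concat _"]) (simp_all add: tensor_concat linear_comp)

lemma map_last_concat:
  assumes D: "linear D" and t: "t \<in> positive_tensors"
  shows "map_last D (tensor_concat (pure_tensor ys) t) = tensor_concat (pure_tensor ys) (map_last D t)"
proof (rule linear_eq_on_span[OF _ _ _ t[unfolded positive_tensors_def]])
  show "linear (\<lambda>t. map_last D (tensor_concat (pure_tensor ys) t))"
    "linear (\<lambda>t. tensor_concat (pure_tensor ys) (map_last D t))"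
    by (intro linear_comp[OF linear_map_last[OF D]] tensor_concat
        linear_comp[OF tensor_concat(2) linear_map_last[OF D]])+
  fix s assume "s \<in> {pure_tensor xs |xs. xs \<noteq> ([]::'a list)}"
  then obtain xs where xs: "s = pure_tensor xs" "xs \<noteq> []" by blast
  then show "map_last D (tensor_concat (pure_tensor ys) s) = tensor_concat (pure_tensor ys) (map_last D s)"
    by (simp add: tensor_concat(3) map_last_pure[OF D] butlast_append flip: tensor_concat_assoc)
qed

lemma map_last_positive:
  assumes D: "linear D" "\<And>x. D x \<in> positive_tensors" and t: "t \<in> positive_tensors"
  shows "map_last D t \<in> positive_tensors"
  using t unfolding positive_tensors_def
proof (induction rule: span_induct_alt)
  case base
  then show ?case by (simp add: linear_0[OF linear_map_last[OF D(1)]] span_zero)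
next
  case (step c x y)
  have "map_last D x \<in> positive_tensors"
    using step(1) concat_positive[OF D(2)] by (auto simp: map_last_pure[OF D(1)])
  then show ?case using step unfolding positive_tensors_def
    by (simp add: linear_add[OF linear_map_last[OF D(1)]] linear_scale[OF linear_map_last[OF D(1)]]
        span_add span_scale)
qed

lemma map_last_power_concat:
  assumes D: "linear D" "\<And>x. D x \<in> positive_tensors" and t: "t \<in> positive_tensors"
  shows "(map_last D ^^ n) (tensor_concat (pure_tensor ys) t)
    = tensor_concat (pure_tensor ys) ((map_last D ^^ n) t) \<and> (map_last D ^^ n) t \<in> positive_tensors"
  by (induction n) (auto simp: t map_last_concat[OF D(1)] map_last_positive[OF D])

lemma linear_map_last_power: "linear D \<Longrightarrow> linear (map_last D ^^ n)"
proof (induction n)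
  case (Suc n)
  then show ?case using linear_compose[OF Suc.IH[OF Suc.prems] linear_map_last[OF Suc.prems]] by (simp add: o_def)
qed (simp add: linear_var id_def)

lemma linear_iterated_coproduct: "linear D \<Longrightarrow> linear (iterated_coproduct D r)"
  unfolding iterated_coproduct_def
  by (intro linear_comp[OF linear_map_last_power] linear_pure_tensor1 linear_var)

lemma iterated_coproduct_1: "iterated_coproduct D (Suc 0) x = pure_tensor [x]"
  by (simp add: iterated_coproduct_def)

lemma bilin_concat: "linear f \<Longrightarrow> bilin (\<lambda>y z. tensor_concat (pure_tensor [y]) (f z))"
  by (intro bilinI linear_comp[OF tensor_concat(2)] linear_comp[OF tensor_concat(1)]
      linear_pure_tensor1 linear_var)

text \<open>Every application of D acts on the last factor. Once the first one has produced y and z,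
  the remaining ones act on z alone, so y can be split off. This gives a recursion from the front
  for an iteration defined at the back.\<close>

lemma iterated_coproduct_Suc:
  assumes D: "linear D" "\<And>x. D x \<in> tensor_square" and r: "r \<ge> 1"
  shows "iterated_coproduct D (Suc r) x
    = tensor_lift (pair_extend (\<lambda>y z. tensor_concat (pure_tensor [y]) (iterated_coproduct D r z))) (D x)"
proof -
  obtain m where m: "r = Suc m" using r by (cases r) auto
  have "iterated_coproduct D (Suc r) x = (map_last D ^^ m) (map_last D (pure_tensor [x]))"
    unfolding iterated_coproduct_def m by (simp add: funpow_swap1)
  also have "map_last D (pure_tensor [x]) = D x"
    by (simp add: map_last_pure[OF D(1)] tensor_concat_Nil)
  also have "(map_last D ^^ m) (D x)
    = tensor_lift (pair_extend (\<lambda>y z. tensor_concat (pure_tensor [y]) (iterated_coproduct D r z))) (D x)"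
  proof (rule tensor_square_eqI[OF _ _ _ D(2)])
    show "linear (map_last D ^^ m)" by (rule linear_map_last_power[OF D(1)])
    note b = bilin_concat[OF linear_iterated_coproduct[OF D(1)]]
    show "linear (tensor_lift (pair_extend (\<lambda>y z. tensor_concat (pure_tensor [y]) (iterated_coproduct D r z))))"
      by (rule pair_lift(1)[OF b])
    fix y z :: 'a
    have "pure_tensor [z] \<in> positive_tensors"
      unfolding positive_tensors_def by (rule span_base) auto
    then have "(map_last D ^^ m) (tensor_concat (pure_tensor [y]) (pure_tensor [z]))
      = tensor_concat (pure_tensor [y]) ((map_last D ^^ m) (pure_tensor [z]))"
      using map_last_power_concat[OF D(1)] D(2) tensor_square_positive by blast
    then show "(map_last D ^^ m) (pure_tensor [y, z]) =
      tensor_lift (pair_extend (\<lambda>y z. tensor_concat (pure_tensor [y]) (iterated_coproduct D r z)))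
        (pure_tensor [y, z])"
      unfolding pair_lift(2)[OF b] by (simp add: tensor_concat(3) iterated_coproduct_def m)
  qed
  finally show ?thesis .
qed

lemma iterated_product: "linear iterated_product" "iterated_product (pure_tensor xs) = prod_list xs"
  unfolding iterated_product_def by (rule tensor_lift[OF multilinear_prod_list])+

lemma iterated_product_concat:
  "iterated_product (tensor_concat (pure_tensor [y]) t) = y * iterated_product t"
  by (rule tensor_lift_eqI[of "\<lambda>t. iterated_product (tensor_concat (pure_tensor [y]) t)"])
    (auto simp: tensor_concat(3) iterated_product
      intro: linear_comp[OF iterated_product(1)] linear_mult_right tensor_concat(2) iterated_product(1))

text \<open>After multiplying out, the recursion is that of convolution powers; with \<Delta> for D
  it matches \<open>psi\<close>, with the reduced coproduct it matches
  \<open>conv_power\<close>.\<close>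

lemma iterated_product_Suc:
  assumes D: "linear D" "\<And>x. D x \<in> tensor_square" and r: "r \<ge> 1"
  shows "iterated_product (iterated_coproduct D (Suc r) x)
    = tensor_lift (pair_extend (\<lambda>y z. y * iterated_product (iterated_coproduct D r z))) (D x)"
  unfolding iterated_coproduct_Suc[OF assms]
  by (subst pair_lift_compose[OF iterated_product(1) bilin_concat[OF linear_iterated_coproduct[OF D(1)]]])
    (simp add: iterated_product_concat)


section \<open>Sweedler sums and the counit\<close>

context graded_connected_hopf_algebra
begin

lemma coprod_tensor_square: "\<Delta> x \<in> tensor_square"
proof -
  have sub: "subspace {x. \<Delta> x \<in> tensor_square}"
    unfolding subspace_def tensor_square_def
    by (simp add: linear_0[OF linear_coprod] linear_add[OF linear_coprod]
        linear_scale[OF linear_coprod] span_zero span_add span_scale)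
  have "H n \<subseteq> {x. \<Delta> x \<in> tensor_square}" for n
  proof
    fix w assume w: "w \<in> H n"
    have "span (\<Union>j\<in>{0..n}. tensor_product_space (H j) (H (n - j))) \<subseteq> tensor_square"
      unfolding tensor_product_space_def tensor_square_def
      by (intro span_minimal UN_least span_mono subspace_span) auto
    then show "w \<in> {x. \<Delta> x \<in> tensor_square}" using coprod_H[OF w] by blast
  qed
  then have "span (\<Union>n. H n) \<subseteq> {x. \<Delta> x \<in> tensor_square}" by (intro span_minimal sub) auto
  then show ?thesis using span_H by auto
qed

lemma linear_reduced: "linear (reduced_coproduct \<Delta>)"
  unfolding reduced_coproduct_def[abs_def] by (intro lin_intros linear_coprod)

lemma reduced_tensor_square: "reduced_coproduct \<Delta> x \<in> tensor_square"
  using coprod_tensor_square[of x] unfolding reduced_coproduct_def tensor_square_def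
  by (intro span_diff) (auto intro: span_base)

text \<open>In Sweedler notation, \<open>sweedler \<beta> x\<close> is the sum of \<open>\<beta> x' x''\<close>.\<close>

definition sweedler :: "('h \<Rightarrow> 'h \<Rightarrow> 'b::real_vector) \<Rightarrow> 'h \<Rightarrow> 'b"
  where "sweedler \<beta> x = tensor_lift (pair_extend \<beta>) (\<Delta> x)"

definition reduced_sweedler :: "('h \<Rightarrow> 'h \<Rightarrow> 'b::real_vector) \<Rightarrow> 'h \<Rightarrow> 'b"
  where "reduced_sweedler \<beta> x = tensor_lift (pair_extend \<beta>) (reduced_coproduct \<Delta> x)"

lemma linear_sweedler: "bilin \<beta> \<Longrightarrow> linear f \<Longrightarrow> linear (\<lambda>x. sweedler \<beta> (f x))"
  unfolding sweedler_def by (intro linear_comp[OF pair_lift(1)] linear_comp[OF linear_coprod])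

lemma linear_sweedler_param:
  "(\<And>x. bilin (\<beta> x)) \<Longrightarrow> (\<And>y z. linear (\<lambda>x. \<beta> x y z)) \<Longrightarrow> linear (\<lambda>x. sweedler (\<beta> x) w)"
  unfolding sweedler_def by (rule linear_pair_lift_param)

lemma sweedler_compose:
  "linear f \<Longrightarrow> bilin \<beta> \<Longrightarrow> f (sweedler \<beta> x) = sweedler (\<lambda>y z. f (\<beta> y z)) x"
  unfolding sweedler_def by (rule pair_lift_compose)

lemma bilin_pure_tensor: "bilin (\<lambda>y z. pure_tensor [y, z])"
  by (intro bilinI lin_intros)

lemma sweedler_pure_tensor: "sweedler (\<lambda>y z. pure_tensor [y, z]) x = \<Delta> x"
  unfolding sweedler_def
  by (rule tensor_square_eqI[OF pair_lift(1)[OF bilin_pure_tensor] linear_var _ coprod_tensor_square])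
    (simp add: pair_lift(2)[OF bilin_pure_tensor])

lemma sweedler_1: "bilin \<beta> \<Longrightarrow> sweedler \<beta> 1 = \<beta> 1 1"
  unfolding sweedler_def coprod_1 by (simp add: pair_lift(2) pair_extend_simps del: One_nat_def)

text \<open>Both sides are the lift of F to the tensor algebra, evaluated at
  \<open>map_first \<Delta> (\<Delta> x)\<close> and at
  \<open>map_last \<Delta> (\<Delta> x)\<close>, which coincide by coassociativity.\<close>

lemma sweedler_coassoc:
  assumes F: "trilin F"
  shows "sweedler (\<lambda>y z. sweedler (\<lambda>y1 y2. F y1 y2 z) y) x
    = sweedler (\<lambda>y z. sweedler (\<lambda>z1 z2. F y z1 z2) z) x"
proof -
  let ?T = "tensor_lift (triple_extend F)"
  have b1: "bilin (\<lambda>y1 y2. F y1 y2 z)" for z by (intro bilinI trilinD[OF F])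
  have b2: "bilin (\<lambda>z1 z2. F y z1 z2)" for y by (intro bilinI trilinD[OF F])
  have b1': "bilin (\<lambda>y z. sweedler (\<lambda>y1 y2. F y1 y2 z) y)"
    by (intro bilinI linear_sweedler linear_sweedler_param b1 linear_var trilinD[OF F])
  have b2': "bilin (\<lambda>y z. sweedler (\<lambda>z1 z2. F y z1 z2) z)"
    by (intro bilinI linear_sweedler linear_sweedler_param b2 linear_var trilinD[OF F])
  note T = triple_lift[OF F]
  have lin_first: "linear (map_first \<Delta>)" and first: "map_first \<Delta> (pure_tensor xs)
      = tensor_concat (\<Delta> (hd xs)) (pure_tensor (tl xs))" for xs
    unfolding map_first_def by (rule tensor_lift[OF multilinear_map_first[OF linear_coprod]])+
  have "?T (map_first \<Delta> (\<Delta> x)) = sweedler (\<lambda>y z. sweedler (\<lambda>y1 y2. F y1 y2 z) y) x"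
    unfolding sweedler_def[of "\<lambda>y z. sweedler (\<lambda>y1 y2. F y1 y2 z) y"]
  proof (rule tensor_square_eqI[OF _ pair_lift(1)[OF b1'] _ coprod_tensor_square])
    show "linear (\<lambda>t. ?T (map_first \<Delta> t))" by (rule linear_comp[OF T(1) lin_first])
    fix y z
    have "?T (tensor_concat t (pure_tensor [z])) = tensor_lift (pair_extend (\<lambda>y1 y2. F y1 y2 z)) t" for t
      by (rule tensor_lift_eqI[OF linear_comp[OF T(1) tensor_concat(1)] pair_lift(1)[OF b1]])
        (simp add: tensor_concat(3) T(2) pair_lift(2)[OF b1] triple_extend_snoc)
    then show "?T (map_first \<Delta> (pure_tensor [y, z]))
      = tensor_lift (pair_extend (\<lambda>y z. sweedler (\<lambda>y1 y2. F y1 y2 z) y)) (pure_tensor [y, z])"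
      unfolding pair_lift(2)[OF b1'] by (simp add: first sweedler_def)
  qed
  moreover have "?T (map_last \<Delta> (\<Delta> x)) = sweedler (\<lambda>y z. sweedler (\<lambda>z1 z2. F y z1 z2) z) x"
    unfolding sweedler_def[of "\<lambda>y z. sweedler (\<lambda>z1 z2. F y z1 z2) z"]
  proof (rule tensor_square_eqI[OF _ pair_lift(1)[OF b2'] _ coprod_tensor_square])
    show "linear (\<lambda>t. ?T (map_last \<Delta> t))"
      by (rule linear_comp[OF T(1) linear_map_last[OF linear_coprod]])
    fix y z
    have "?T (tensor_concat (pure_tensor [y]) t) = tensor_lift (pair_extend (\<lambda>z1 z2. F y z1 z2)) t" for t
      by (rule tensor_lift_eqI[OF linear_comp[OF T(1) tensor_concat(2)] pair_lift(1)[OF b2]])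
        (simp add: tensor_concat(3) T(2) pair_lift(2)[OF b2] triple_extend_Cons)
    then show "?T (map_last \<Delta> (pure_tensor [y, z]))
      = tensor_lift (pair_extend (\<lambda>y z. sweedler (\<lambda>z1 z2. F y z1 z2) z)) (pure_tensor [y, z])"
      unfolding pair_lift(2)[OF b2'] by (simp add: map_last_pure[OF linear_coprod] sweedler_def)
  qed
  ultimately show ?thesis using coassoc by metis
qed

lemma sweedler_cocomm:
  assumes "cocommutative \<Delta>" and b: "bilin \<beta>"
  shows "sweedler \<beta> x = sweedler (\<lambda>y z. \<beta> z y) x"
proof -
  have b': "bilin (\<lambda>y z. \<beta> z y)" by (intro bilinI bilinD[OF b])
  have rev: "linear tensor_rev" "tensor_rev (pure_tensor xs) = pure_tensor (rev xs)" for xs :: "'h list"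
    unfolding tensor_rev_def by (rule tensor_lift[OF multilinear_rev])+
  have "tensor_lift (pair_extend \<beta>) (tensor_rev t) = tensor_lift (pair_extend (\<lambda>y z. \<beta> z y)) t"
    if "t \<in> tensor_square" for t
    by (rule tensor_square_eqI[OF linear_comp[OF pair_lift(1)[OF b] rev(1)] pair_lift(1)[OF b'] _ that])
      (unfold rev pair_lift(2)[OF b] pair_lift(2)[OF b'], simp)
  then show ?thesis
    using assms(1) coprod_tensor_square unfolding sweedler_def cocommutative_def by metis
qed

lemma sweedler_mult:
  assumes b: "bilin \<beta>"
  shows "sweedler \<beta> (x * y) = sweedler (\<lambda>x1 x2. sweedler (\<lambda>y1 y2. \<beta> (x1 * y1) (x2 * y2)) y) x"
proof -
  let ?B = "tensor_lift (pair_extend \<beta>)"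
  have b1: "bilin (\<lambda>y1 y2. \<beta> (x1 * y1) (x2 * y2))" for x1 x2
    by (intro bilinI bilin_comp1[OF b] bilin_comp2[OF b] lin_intros)
  have b2: "bilin (\<lambda>x1 x2. sweedler (\<lambda>y1 y2. \<beta> (x1 * y1) (x2 * y2)) y)"
    by (intro bilinI linear_sweedler_param b1 bilin_comp1[OF b] bilin_comp2[OF b] lin_intros)
  have "?B (tensor_times (\<Delta> x) (\<Delta> y)) = tensor_lift (pair_extend
      (\<lambda>x1 x2. sweedler (\<lambda>y1 y2. \<beta> (x1 * y1) (x2 * y2)) y)) (\<Delta> x)"
  proof (rule tensor_square_eqI[OF _ pair_lift(1)[OF b2] _ coprod_tensor_square])
    show "linear (\<lambda>s. ?B (tensor_times s (\<Delta> y)))"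
      by (rule linear_comp[OF pair_lift(1)[OF b] tensor_times(1)])
    fix x1 x2
    have "?B (tensor_times (pure_tensor [x1, x2]) t)
      = tensor_lift (pair_extend (\<lambda>y1 y2. \<beta> (x1 * y1) (x2 * y2))) t" if "t \<in> tensor_square" for t
      by (rule tensor_square_eqI[OF linear_comp[OF pair_lift(1)[OF b] tensor_times(2)]
            pair_lift(1)[OF b1] _ that])
        (unfold pair_lift(2)[OF b1], simp add: tensor_times(3) pair_lift(2)[OF b])
    then show "?B (tensor_times (pure_tensor [x1, x2]) (\<Delta> y)) = tensor_lift (pair_extend
      (\<lambda>x1 x2. sweedler (\<lambda>y1 y2. \<beta> (x1 * y1) (x2 * y2)) y)) (pure_tensor [x1, x2])"
      unfolding pair_lift(2)[OF b2] using coprod_tensor_square by (simp add: sweedler_def)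
  qed
  then show ?thesis by (simp add: sweedler_def coprod_mult)
qed

lemma sweedler_reduced:
  assumes "bilin \<beta>"
  shows "sweedler \<beta> x = \<beta> 1 x + \<beta> x 1 + reduced_sweedler \<beta> x"
proof -
  have "\<Delta> x = pure_tensor [1, x] + pure_tensor [x, 1] + reduced_coproduct \<Delta> x"
    by (simp add: reduced_coproduct_def)
  then show ?thesis
    unfolding sweedler_def reduced_sweedler_def
    by (simp add: linear_add[OF pair_lift(1)[OF assms]] pair_lift(2)[OF assms])
qed

lemma lift_product_spaces_cong:
  assumes t: "t \<in> span (\<Union>j\<in>J. tensor_product_space (H j) (H (n - j)))"
    and b: "bilin \<beta>" "bilin \<gamma>"
    and eq: "\<And>j y z. j \<in> J \<Longrightarrow> y \<in> H j \<Longrightarrow> z \<in> H (n - j) \<Longrightarrow> \<beta> y z = \<gamma> y z"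
  shows "tensor_lift (pair_extend \<beta>) t = tensor_lift (pair_extend \<gamma>) t"
proof (rule linear_eq_on_span[OF pair_lift(1)[OF b(1)] pair_lift(1)[OF b(2)] _ t])
  fix s assume "s \<in> (\<Union>j\<in>J. tensor_product_space (H j) (H (n - j)))"
  then obtain j where j: "j \<in> J" "s \<in> tensor_product_space (H j) (H (n - j))" by blast
  show "tensor_lift (pair_extend \<beta>) s = tensor_lift (pair_extend \<gamma>) s"
    by (rule linear_eq_on_span[OF pair_lift(1)[OF b(1)] pair_lift(1)[OF b(2)] _
          j(2)[unfolded tensor_product_space_def]])
      (use eq[OF j(1)] in \<open>auto simp: pair_lift(2)[OF b(1)] pair_lift(2)[OF b(2)]\<close>)
qed

lemma sweedler_cong:
  assumes "x \<in> H n" "bilin \<beta>" "bilin \<gamma>"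
    and "\<And>j y z. j \<le> n \<Longrightarrow> y \<in> H j \<Longrightarrow> z \<in> H (n - j) \<Longrightarrow> \<beta> y z = \<gamma> y z"
  shows "sweedler \<beta> x = sweedler \<gamma> x"
  unfolding sweedler_def
  by (rule lift_product_spaces_cong[OF coprod_H[OF assms(1)] assms(2,3)]) (use assms(4) in auto)

text \<open>Both tensor factors of the reduced coproduct have degree strictly between 0 and n. This
  is what lets identities be proved by induction on the degree.\<close>

lemma reduced_sweedler_cong:
  assumes "x \<in> H n" "1 \<le> n" "bilin \<beta>" "bilin \<gamma>"
    and "\<And>j y z. 1 \<le> j \<Longrightarrow> j < n \<Longrightarrow> y \<in> H j \<Longrightarrow> z \<in> H (n - j) \<Longrightarrow> \<beta> y z = \<gamma> y z"
  shows "reduced_sweedler \<beta> x = reduced_sweedler \<gamma> x"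
  unfolding reduced_sweedler_def
  by (rule lift_product_spaces_cong[OF reduced_coprod_H[OF assms(2,1)] assms(3,4)])
    (use assms(2,5) in auto)

lemma reduced_sweedler_0: "reduced_sweedler (\<lambda>y z. 0) x = 0"
  unfolding reduced_sweedler_def
  by (rule tensor_square_eqI[OF pair_lift(1) linear_const_0 _ reduced_tensor_square])
    (simp_all add: pair_lift(2) bilinI linear_const_0)

lemma reduced_sweedler_in:
  assumes x: "x \<in> H n" "1 \<le> n" and b: "bilin \<beta>" and S: "subspace S"
    and in_S: "\<And>j y z. 1 \<le> j \<Longrightarrow> j < n \<Longrightarrow> y \<in> H j \<Longrightarrow> z \<in> H (n - j) \<Longrightarrow> \<beta> y z \<in> S"
  shows "reduced_sweedler \<beta> x \<in> S"
proof -
  let ?L = "tensor_lift (pair_extend \<beta>)"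
  have sub: "subspace {t. ?L t \<in> S}"
    using S unfolding subspace_def
    by (simp add: linear_0[OF pair_lift(1)[OF b]] linear_add[OF pair_lift(1)[OF b]]
        linear_scale[OF pair_lift(1)[OF b]])
  have "span (\<Union>j\<in>{1..n - 1}. tensor_product_space (H j) (H (n - j))) \<subseteq> {t. ?L t \<in> S}"
    unfolding tensor_product_space_def
    by (intro span_minimal sub UN_least)
      (use in_S x(2) in \<open>auto simp: pair_lift(2)[OF b]\<close>)
  then show ?thesis
    unfolding reduced_sweedler_def using reduced_coprod_H[OF x(2,1)] by blast
qed

text \<open>The locale does not provide a counit; connectedness determines it as the coordinate of
  degree 0 with respect to 1. It exists because any functional with value 1 at 1 can be composed
  with \<open>component 0\<close>.\<close>

definition counit :: "'h \<Rightarrow> real"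
  where "counit = (SOME f. linear f \<and> f 1 = 1 \<and> (\<forall>n\<ge>1. \<forall>x\<in>H n. f x = 0))"

lemma counit: "linear counit" "counit 1 = 1" "1 \<le> n \<Longrightarrow> x \<in> H n \<Longrightarrow> counit x = 0"
proof -
  obtain f :: "'h \<Rightarrow> real" where f: "linear f" "f 1 = 1"
    by (rule functional_eq_1[of "1::'h"]) simp
  have "linear (\<lambda>x. f (component 0 x)) \<and> f (component 0 1) = 1
      \<and> (\<forall>n\<ge>1. \<forall>x\<in>H n. f (component 0 x) = 0)"
    using f linear_comp[OF f(1) linear_component[of 0]]
    by (auto simp: component_homogeneous[OF one_in_H0] component_homogeneous linear_0)
  then have "linear counit \<and> counit 1 = 1 \<and> (\<forall>n\<ge>1. \<forall>x\<in>H n. counit x = 0)"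
    unfolding counit_def by (rule someI[of "\<lambda>f. linear f \<and> f 1 = 1 \<and> (\<forall>n\<ge>1. \<forall>x\<in>H n. f x = 0)"])
  then show "linear counit" "counit 1 = 1" "1 \<le> n \<Longrightarrow> x \<in> H n \<Longrightarrow> counit x = 0" by auto
qed

lemma H0_eq: "x \<in> H 0 \<Longrightarrow> x = counit x *\<^sub>R 1"
  by (auto simp: H_0 span_singleton linear_scale[OF counit(1)] counit(2))

lemma homogeneous_cases:
  assumes "linear f" "linear g" "f 1 = g 1" "\<And>n x. 1 \<le> n \<Longrightarrow> x \<in> H n \<Longrightarrow> f x = g x"
  shows "f x = g x"
proof (rule linear_eq_on_homogeneous[OF assms(1,2)])
  fix n x assume x: "x \<in> H n"
  show "f x = g x"
  proof (cases "n = 0")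
    case True
    then show ?thesis
      using H0_eq x assms(3) linear_scale[OF assms(1)] linear_scale[OF assms(2)] by metis
  qed (use assms(4)[of n x] x in auto)
qed

text \<open>The counit axiom is a consequence of the shape of \<Delta>. In positive degree the
  counit vanishes on the first factor of every term except \<open>1 \<otimes> x\<close>.\<close>

lemma sweedler_counit_left:
  assumes "linear f"
  shows "sweedler (\<lambda>y z. counit y *\<^sub>R f z) x = f x"
proof (rule homogeneous_cases[of "\<lambda>x. sweedler (\<lambda>y z. counit y *\<^sub>R f z) x"])
  have b: "bilin (\<lambda>y z. counit y *\<^sub>R f z)" by (intro bilinI lin_intros counit(1) assms)
  show "linear (\<lambda>x. sweedler (\<lambda>y z. counit y *\<^sub>R f z) x)" by (intro linear_sweedler b linear_var)
  show "sweedler (\<lambda>y z. counit y *\<^sub>R f z) 1 = f 1" by (simp add: sweedler_1[OF b] counit)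
  fix n x assume x: "1 \<le> n" "x \<in> H n"
  have "reduced_sweedler (\<lambda>y z. counit y *\<^sub>R f z) x = reduced_sweedler (\<lambda>y z. 0) x"
    by (rule reduced_sweedler_cong[OF x(2,1) b]) (auto simp: counit intro: bilinI linear_const_0)
  then show "sweedler (\<lambda>y z. counit y *\<^sub>R f z) x = f x"
    by (simp add: sweedler_reduced[OF b] counit(2) counit(3)[OF x] reduced_sweedler_0)
qed (rule assms)

lemma sweedler_counit_right:
  assumes "linear f"
  shows "sweedler (\<lambda>y z. counit z *\<^sub>R f y) x = f x"
proof (rule homogeneous_cases[of "\<lambda>x. sweedler (\<lambda>y z. counit z *\<^sub>R f y) x"])
  have b: "bilin (\<lambda>y z. counit z *\<^sub>R f y)" by (intro bilinI lin_intros counit(1) assms)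
  show "linear (\<lambda>x. sweedler (\<lambda>y z. counit z *\<^sub>R f y) x)" by (intro linear_sweedler b linear_var)
  show "sweedler (\<lambda>y z. counit z *\<^sub>R f y) 1 = f 1" by (simp add: sweedler_1[OF b] counit)
  fix n x assume x: "1 \<le> n" "x \<in> H n"
  have "counit z *\<^sub>R f y = 0" if "j < n" "z \<in> H (n - j)" for j y z
    using counit(3)[of "n - j" z] that by simp
  then have "reduced_sweedler (\<lambda>y z. counit z *\<^sub>R f y) x = reduced_sweedler (\<lambda>y z. 0) x"
    by (intro reduced_sweedler_cong[OF x(2,1) b]) (blast intro: bilinI linear_const_0)+
  then show "sweedler (\<lambda>y z. counit z *\<^sub>R f y) x = f x"
    by (simp add: sweedler_reduced[OF b] counit(2) counit(3)[OF x] reduced_sweedler_0)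
qed (rule assms)

text \<open>Each application splits a degree into two positive parts, and n is not a sum of more
  than n positive integers. This makes the sum defining \<open>eulerian_idempotent\<close>
  finite.\<close>

lemma iterated_coproduct_eq_0:
  "x \<in> H n \<Longrightarrow> 1 \<le> n \<Longrightarrow> n < r \<Longrightarrow> iterated_coproduct (reduced_coproduct \<Delta>) r x = 0"
proof (induction r arbitrary: n x)
  case (Suc r)
  note L = linear_iterated_coproduct[OF linear_reduced]
  have "reduced_sweedler (\<lambda>y z. tensor_concat (pure_tensor [y])
      (iterated_coproduct (reduced_coproduct \<Delta>) r z)) x = reduced_sweedler (\<lambda>y z. 0) x"
  proof (rule reduced_sweedler_cong[OF Suc.prems(1,2) bilin_concat[OF L]])
    fix j y z assume "1 \<le> j" "j < n" "y \<in> H j" "z \<in> H (n - j)"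
    then show "tensor_concat (pure_tensor [y]) (iterated_coproduct (reduced_coproduct \<Delta>) r z) = 0"
      using Suc by (simp add: linear_0[OF tensor_concat(2)])
  qed (auto intro: bilinI linear_const_0)
  then show ?case
    using iterated_coproduct_Suc[OF linear_reduced reduced_tensor_square, of r x] Suc.prems
    by (simp add: reduced_sweedler_def[symmetric] reduced_sweedler_0)
qed simp

section \<open>Hopf powers\<close>

text \<open>At \<open>0\<close> the convolution power of the identity is the counit, whereas \<open>hopf_power \<Delta> 0\<close>
  is the identity.\<close>

primrec psi :: "nat \<Rightarrow> 'h \<Rightarrow> 'h"
  where "psi 0 x = counit x *\<^sub>R 1"
  | "psi (Suc n) x = sweedler (\<lambda>y z. y * psi n z) x"

text \<open>Convolution powers of the identity minus the convolution unit. They are the terms of a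
  binomial expansion of \<open>psi\<close>, and unlike \<open>psi\<close> they vanish on
  \<open>H n\<close> for exponents above n.\<close>

primrec conv_power :: "nat \<Rightarrow> 'h \<Rightarrow> 'h"
  where "conv_power 0 x = counit x *\<^sub>R 1"
  | "conv_power (Suc n) x = sweedler (\<lambda>y z. (y - counit y *\<^sub>R 1) * conv_power n z) x"

lemma linear_psi: "linear (psi n)"
proof (induction n)
  case 0
  show ?case unfolding psi.simps[abs_def] by (intro lin_intros counit)
next
  case (Suc n)
  show ?case
    unfolding psi.simps[abs_def]
    by (intro linear_sweedler bilinI lin_intros linear_comp[OF Suc] Suc)
qed

lemma bilin_psi: "bilin (\<lambda>y z. y * psi n z)"
  by (intro bilinI lin_intros linear_psi)

lemma linear_conv_power: "linear (conv_power n)"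
proof (induction n)
  case 0
  show ?case unfolding conv_power.simps[abs_def] by (intro lin_intros counit)
next
  case (Suc n)
  show ?case
    unfolding conv_power.simps[abs_def]
    by (intro linear_sweedler bilinI lin_intros linear_comp[OF Suc] Suc counit)
qed

lemma bilin_conv_power: "bilin (\<lambda>y z. (y - counit y *\<^sub>R 1) * conv_power n z)"
  by (intro bilinI lin_intros linear_conv_power counit)

lemma psi_1: "psi (Suc 0) x = x"
  by (simp add: sweedler_counit_right[OF linear_var])

lemma psi_of_1: "psi n 1 = 1"
  by (induction n) (simp_all add: counit sweedler_1[OF bilin_psi])

lemma hopf_power_eq_psi: "a \<ge> 1 \<Longrightarrow> hopf_power \<Delta> a x = psi a x"
proof (induction a arbitrary: x rule: dec_induct)
  case base
  then show ?case
    by (simp add: hopf_power_def iterated_coproduct_def iterated_product psi_1 del: psi.simps)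
next
  case (step n)
  then have "hopf_power \<Delta> (Suc n) x = sweedler (\<lambda>y z. y * hopf_power \<Delta> n z) x"
    unfolding hopf_power_def sweedler_def
    by (intro iterated_product_Suc linear_coprod coprod_tensor_square)
  then show ?case using step by simp
qed

lemma conv_power_of_1: "conv_power (Suc n) 1 = 0"
  by (simp add: counit sweedler_1[OF bilin_conv_power])

text \<open>Subtracting the counit removes the term \<open>1 \<otimes> x\<close>, and
  \<open>conv_power (Suc r) 1 = 0\<close> removes \<open>x \<otimes> 1\<close>. The exponent starts
  at 2 because for exponent 1 the second term survives and gives x.\<close>

lemma conv_power_Suc_reduced:
  assumes "x \<in> H n" "1 \<le> n"
  shows "conv_power (Suc (Suc r)) x = reduced_sweedler (\<lambda>y z. y * conv_power (Suc r) z) x"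
proof -
  have "conv_power (Suc (Suc r)) x
      = reduced_sweedler (\<lambda>y z. (y - counit y *\<^sub>R 1) * conv_power (Suc r) z) x"
    using sweedler_reduced[OF bilin_conv_power[of "Suc r"], of x]
    by (simp add: counit conv_power_of_1 del: conv_power.simps(2)
        add: conv_power.simps(2)[of "Suc r"])
  also have "\<dots> = reduced_sweedler (\<lambda>y z. y * conv_power (Suc r) z) x"
    by (rule reduced_sweedler_cong[OF assms bilin_conv_power])
      (auto simp: counit simp del: conv_power.simps intro!: bilinI lin_intros linear_conv_power)
  finally show ?thesis .
qed

lemma conv_power_1: "x \<in> H n \<Longrightarrow> 1 \<le> n \<Longrightarrow> conv_power (Suc 0) x = x"
proof -
  assume x: "x \<in> H n" "1 \<le> n"
  have "sweedler (\<lambda>y z. counit z *\<^sub>R (y - counit y *\<^sub>R 1)) x = x - counit x *\<^sub>R 1"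
    by (rule sweedler_counit_right) (intro lin_intros counit)
  then show ?thesis using x by (simp add: counit)
qed

lemma conv_power_eq:
  "x \<in> H n \<Longrightarrow> 1 \<le> n \<Longrightarrow> conv_power (Suc r) x
    = iterated_product (iterated_coproduct (reduced_coproduct \<Delta>) (Suc r) x)"
proof (induction r arbitrary: n x)
  case 0
  then show ?case by (simp add: conv_power_1 iterated_coproduct_1 iterated_product del: conv_power.simps)
next
  case (Suc r)
  have "reduced_sweedler (\<lambda>y z. y * conv_power (Suc r) z) x
    = reduced_sweedler (\<lambda>y z. y * iterated_product (iterated_coproduct (reduced_coproduct \<Delta>) (Suc r) z)) x"
    by (rule reduced_sweedler_cong[OF Suc.prems])
      (auto simp: Suc.IH simp del: conv_power.simps intro!: bilinI lin_intros linear_conv_power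
        linear_comp[OF iterated_product(1)] linear_iterated_coproduct linear_reduced)
  then show ?case
    using iterated_product_Suc[OF linear_reduced reduced_tensor_square, of "Suc r" x]
    by (simp add: conv_power_Suc_reduced[OF Suc.prems] reduced_sweedler_def del: conv_power.simps)
qed

lemma conv_power_eq_0: "x \<in> H n \<Longrightarrow> n < r \<Longrightarrow> conv_power r x = 0"
proof (cases r)
  case (Suc k)
  assume x: "x \<in> H n" "n < r"
  show ?thesis
  proof (cases "n = 0")
    case True
    then have "conv_power r x = counit x *\<^sub>R conv_power r 1"
      using H0_eq[of x] x linear_scale[OF linear_conv_power] by metis
    then show ?thesis using Suc conv_power_of_1 by simp
  next
    case False
    then show ?thesis
      using x conv_power_eq[of x n k] iterated_coproduct_eq_0[of x n r] Suc
      by (simp add: linear_0[OF iterated_product(1)] del: conv_power.simps)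
  qed
qed simp

lemma sweedler_tensor_square:
  assumes "bilin \<beta>" "linear F" "\<And>y z. F (pure_tensor [y, z]) = \<beta> y z"
  shows "sweedler \<beta> x = F (\<Delta> x)"
  unfolding sweedler_def
  by (rule tensor_square_eqI[OF pair_lift(1)[OF assms(1)] assms(2) _ coprod_tensor_square])
    (unfold pair_lift(2)[OF assms(1)], simp add: assms(3))

lemma sweedler_add:
  assumes "bilin \<beta>" "bilin \<gamma>"
  shows "sweedler (\<lambda>y z. \<beta> y z + \<gamma> y z) x = sweedler \<beta> x + sweedler \<gamma> x"
proof -
  have b: "bilin (\<lambda>y z. \<beta> y z + \<gamma> y z)"
    by (intro bilinI linear_compose_add bilinD[OF assms(1)] bilinD[OF assms(2)])
  show ?thesis
    unfolding sweedler_def[of \<beta>] sweedler_def[of \<gamma>]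
    by (rule sweedler_tensor_square[OF b linear_compose_add[OF pair_lift(1)[OF assms(1)] pair_lift(1)[OF assms(2)]]])
      (unfold pair_lift(2)[OF assms(1)] pair_lift(2)[OF assms(2)], simp)
qed

lemma sweedler_sum_scale:
  assumes "\<And>i. bilin (\<beta> i)"
  shows "sweedler (\<lambda>y z. \<Sum>i\<in>I. c i *\<^sub>R \<beta> i y z) x = (\<Sum>i\<in>I. c i *\<^sub>R sweedler (\<beta> i) x)"
proof -
  have b: "bilin (\<lambda>y z. \<Sum>i\<in>I. c i *\<^sub>R \<beta> i y z)"
    by (intro bilinI linear_compose_sum ballI linear_compose_scale_right bilinD[OF assms])
  show ?thesis
    unfolding sweedler_def[of "\<beta> _"]
    by (rule sweedler_tensor_square[OF b])
      (intro linear_compose_sum ballI linear_compose_scale_right pair_lift(1)[OF assms],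
        unfold pair_lift(2)[OF assms], simp)
qed

text \<open>The binomial theorem in the convolution algebra. The index set K does not depend on n,
  so the right-hand side is visibly polynomial in n.\<close>

lemma psi_eq_sum_choose:
  assumes "finite K" "{k. conv_power k x \<noteq> 0} \<subseteq> K"
  shows "psi n x = (\<Sum>k\<in>K. real (n choose k) *\<^sub>R conv_power k x)"
proof -
  \<comment> \<open>Splitting the first factor as counit plus the rest produces the two neighbouring
    powers that Pascal's rule combines.\<close>
  have step: "sweedler (\<lambda>y z. y * conv_power k z) x = conv_power k x + conv_power (Suc k) x" for k x
  proof -
    have "(\<lambda>y z. y * conv_power k z)
      = (\<lambda>y z. counit y *\<^sub>R conv_power k z + (y - counit y *\<^sub>R 1) * conv_power k z)"
      by (simp add: fun_eq_iff algebra_simps)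
    moreover have "bilin (\<lambda>y z. counit y *\<^sub>R conv_power k z)"
      by (intro bilinI lin_intros linear_conv_power counit)
    ultimately show ?thesis
      using sweedler_add[OF _ bilin_conv_power] sweedler_counit_left[OF linear_conv_power] by simp
  qed
  have *: "psi n x = (\<Sum>k\<le>n. real (n choose k) *\<^sub>R conv_power k x)" for x
  proof (induction n arbitrary: x)
    case (Suc n)
    have b: "bilin (\<lambda>y z. y * conv_power k z)" for k
      by (intro bilinI lin_intros linear_conv_power)
    have "psi (Suc n) x = sweedler (\<lambda>y z. \<Sum>k\<le>n. real (n choose k) *\<^sub>R (y * conv_power k z)) x"
      by (simp add: Suc.IH sum_distrib_left)
    also have "\<dots> = (\<Sum>k\<le>n. real (n choose k) *\<^sub>R (conv_power k x + conv_power (Suc k) x))"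
      by (simp add: sweedler_sum_scale[OF b] step del: conv_power.simps)
    also have "\<dots> = (\<Sum>k\<le>n. real (n choose k) *\<^sub>R conv_power k x)
        + (\<Sum>k\<le>n. real (n choose k) *\<^sub>R conv_power (Suc k) x)"
      by (simp add: scaleR_add_right sum.distrib del: conv_power.simps)
    also have "(\<Sum>k\<le>n. real (n choose k) *\<^sub>R conv_power k x)
        = (\<Sum>k\<le>Suc n. real (n choose k) *\<^sub>R conv_power k x)" by (simp del: conv_power.simps)
    also have "\<dots> = conv_power 0 x + (\<Sum>k\<le>n. real (n choose Suc k) *\<^sub>R conv_power (Suc k) x)"
      by (subst sum.atMost_Suc_shift) (simp del: conv_power.simps)
    also have "\<dots> + (\<Sum>k\<le>n. real (n choose k) *\<^sub>R conv_power (Suc k) x)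
        = conv_power 0 x + (\<Sum>k\<le>n. real (Suc n choose Suc k) *\<^sub>R conv_power (Suc k) x)"
      by (simp add: sum.distrib[symmetric] scaleR_add_left[symmetric] add.commute add.assoc
          del: conv_power.simps)
    also have "\<dots> = (\<Sum>k\<le>Suc n. real (Suc n choose k) *\<^sub>R conv_power k x)"
      by (subst sum.atMost_Suc_shift) (simp del: conv_power.simps binomial_Suc_Suc)
    finally show ?case .
  qed simp
  \<comment> \<open>For k above n the binomial coefficient vanishes; outside K the power itself
    does.\<close>
  have "psi n x = (\<Sum>k\<in>K \<union> {..n}. real (n choose k) *\<^sub>R conv_power k x)"
    unfolding * using assms(1) by (intro sum.mono_neutral_left) auto
  also have "\<dots> = (\<Sum>k\<in>K. real (n choose k) *\<^sub>R conv_power k x)"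
    using assms by (intro sum.mono_neutral_right) auto
  finally show ?thesis .
qed

end


section \<open>The Eulerian idempotent as logarithm of the identity\<close>

definition binomial_poly :: "nat \<Rightarrow> real poly"
  where "binomial_poly k = smult (1 / fact k) (\<Prod>j<k. [:- real j, 1:])"

lemma poly_binomial_poly: "poly (binomial_poly k) (real n) = real (n choose k)"
  unfolding binomial_poly_def binomial_gbinomial gbinomial_prod_rev
  by (simp add: poly_prod lessThan_atLeast0)

lemma coeff_0_binomial_poly: "coeff (binomial_poly k) 0 = (if k = 0 then 1 else 0)"
  using poly_binomial_poly[of k 0] by (cases k) (simp_all add: poly_0_coeff_0)

text \<open>Dropping the factor n from n(n-1)...(n-k+1) and setting n = 0 leaves (-1)^(k-1) (k-1)!,
  to be divided by k!. These are the coefficients of log(1+t), hence of the Eulerian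
  idempotent.\<close>

lemma coeff_1_binomial_poly:
  assumes "k \<ge> 1"
  shows "coeff (binomial_poly k) 1 = (- 1) ^ (k - 1) / real k"
proof -
  obtain m where m: "k = Suc m" using assms by (cases k) auto
  have "(\<Prod>j<k. [:- real j, 1:]) = [:0, 1:] * (\<Prod>j<m. [:- real (Suc j), 1:])"
    unfolding m by (subst prod.lessThan_Suc_shift) simp
  then have "coeff (\<Prod>j<k. [:- real j, 1:]) 1 = poly (\<Prod>j<m. [:- real (Suc j), 1:]) 0"
    by (simp add: poly_0_coeff_0)
  also have "\<dots> = (\<Prod>j<m. - real (Suc j))" by (simp add: poly_prod)
  also have "\<dots> = (- 1) ^ m * fact m"
    by (induction m) (simp_all add: algebra_simps)
  finally show ?thesis
    unfolding binomial_poly_def m by (simp add: field_simps del: of_nat_Suc)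
qed

context graded_connected_hopf_algebra
begin

text \<open>An element has finitely many homogeneous components, each killed by the powers beyond
  its degree. Hence \<open>log_id\<close> is a finite sum on arbitrary elements and can be linear on
  the whole space.\<close>

lemma finite_conv_power_support: "finite {k. conv_power k x \<noteq> 0}"
proof -
  let ?N = "{n. component n x \<noteq> 0}"
  have x: "x = (\<Sum>n\<in>?N. component n x)" by (rule component_sum) (auto simp: finite_component)
  have "{k. conv_power k x \<noteq> 0} \<subseteq> (\<Union>n\<in>?N. {..n})"
  proof
    fix k assume k: "k \<in> {k. conv_power k x \<noteq> 0}"
    have "conv_power k x = (\<Sum>n\<in>?N. conv_power k (component n x))"
      by (subst x) (rule linear_sum[OF linear_conv_power])
    then obtain n where "n \<in> ?N" "conv_power k (component n x) \<noteq> 0"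
      using k by (auto elim!: sum.not_neutral_contains_not_neutral)
    then show "k \<in> (\<Union>n\<in>?N. {..n})"
      using conv_power_eq_0[OF component_in_H, of n k x] by force
  qed
  then show ?thesis by (rule finite_subset) (auto simp: finite_component)
qed

text \<open>By \<open>psi_eq_sum_choose\<close>, this is the linear coefficient of \<open>psi n x\<close> as a polynomial in \<open>n\<close>.\<close>

definition log_id :: "'h \<Rightarrow> 'h"
  where "log_id x = (\<Sum>k | conv_power k x \<noteq> 0. coeff (binomial_poly k) 1 *\<^sub>R conv_power k x)"

lemma log_id_sum:
  assumes "finite K" "{k. conv_power k x \<noteq> 0} \<subseteq> K"
  shows "log_id x = (\<Sum>k\<in>K. coeff (binomial_poly k) 1 *\<^sub>R conv_power k x)"
  unfolding log_id_def using assms by (intro sum.mono_neutral_left) auto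

lemma log_id_homogeneous:
  "x \<in> H n \<Longrightarrow> log_id x = (\<Sum>k\<le>n. coeff (binomial_poly k) 1 *\<^sub>R conv_power k x)"
  using conv_power_eq_0[of x n] by (intro log_id_sum) (auto simp: not_less[symmetric])

lemma linear_log_id: "linear log_id"
proof (rule linearI)
  fix x y :: 'h and r :: real
  let ?K = "{k. conv_power k x \<noteq> 0} \<union> {k. conv_power k y \<noteq> 0}"
  have K: "finite ?K" using finite_conv_power_support by blast
  have "log_id (x + y) = (\<Sum>k\<in>?K. coeff (binomial_poly k) 1 *\<^sub>R conv_power k (x + y))"
    by (rule log_id_sum[OF K]) (auto simp: linear_add[OF linear_conv_power])
  also have "\<dots> = log_id x + log_id y"
    by (simp add: log_id_sum[OF K] linear_add[OF linear_conv_power] scaleR_add_right sum.distrib)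
  finally show "log_id (x + y) = log_id x + log_id y" .
  have "log_id (r *\<^sub>R x) = (\<Sum>k\<in>?K. coeff (binomial_poly k) 1 *\<^sub>R conv_power k (r *\<^sub>R x))"
    by (rule log_id_sum[OF K]) (auto simp: linear_scale[OF linear_conv_power])
  also have "\<dots> = r *\<^sub>R log_id x"
    by (simp add: log_id_sum[OF K] linear_scale[OF linear_conv_power] scaleR_sum_right mult.commute)
  finally show "log_id (r *\<^sub>R x) = r *\<^sub>R log_id x" .
qed

lemma eulerian_idempotent_eq_log_id:
  assumes "x \<in> H n" "1 \<le> n"
  shows "eulerian_idempotent \<Delta> x = log_id x"
proof -
  let ?it = "iterated_coproduct (reduced_coproduct \<Delta>)"
  \<comment> \<open>The constant polynomial \<open>binomial_poly 0\<close> has linear coefficient 0,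
    so the term of the counit drops out.\<close>
  have "log_id x = (\<Sum>k\<in>{1..n}. coeff (binomial_poly k) 1 *\<^sub>R conv_power k x)"
    unfolding log_id_homogeneous[OF assms(1)]
    by (rule sum.mono_neutral_right) (auto simp: binomial_poly_def not_le)
  also have "\<dots> = (\<Sum>k\<in>{1..n}. ((- 1) ^ (k - 1) / real k) *\<^sub>R iterated_product (?it k x))"
  proof (rule sum.cong[OF refl])
    fix k assume k: "k \<in> {1..n}"
    then obtain m where "k = Suc m" by (cases k) auto
    then show "coeff (binomial_poly k) 1 *\<^sub>R conv_power k x
      = ((- 1) ^ (k - 1) / real k) *\<^sub>R iterated_product (?it k x)"
      using coeff_1_binomial_poly[of k] conv_power_eq[OF assms, of m] by simp
  qed
  also have "\<dots> = (\<Sum>r | 1 \<le> r \<and> ?it r x \<noteq> 0. ((- 1) ^ (r - 1) / real r) *\<^sub>R iterated_product (?it r x))"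
    using iterated_coproduct_eq_0[OF assms]
    by (intro sum.mono_neutral_right) (auto simp: linear_0[OF iterated_product(1)] not_less[symmetric])
  finally show ?thesis by (simp add: eulerian_idempotent_def)
qed

lemma conv_power_in_H:
  "x \<in> H n \<Longrightarrow> 1 \<le> n \<Longrightarrow> conv_power (Suc r) x \<in> H n"
proof (induction r arbitrary: n x)
  case 0
  then show ?case using conv_power_1 by metis
next
  case (Suc r)
  have "y * conv_power (Suc r) z \<in> H n" if "1 \<le> j" "j < n" "y \<in> H j" "z \<in> H (n - j)" for j y z
    using mult_H[OF that(3) Suc.IH[OF that(4)]] that by simp
  then show ?case
    unfolding conv_power_Suc_reduced[OF Suc.prems]
    by (intro reduced_sweedler_in[OF Suc.prems _ subspace_H])
      (auto intro!: bilinI lin_intros linear_conv_power simp del: conv_power.simps)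
qed

lemma log_id_in_H: "x \<in> H n \<Longrightarrow> 1 \<le> n \<Longrightarrow> log_id x \<in> H n"
proof -
  assume x: "x \<in> H n" "1 \<le> n"
  have "coeff (binomial_poly k) 1 *\<^sub>R conv_power k x \<in> H n" for k
    using conv_power_in_H[OF x] x
    by (cases k) (auto simp: binomial_poly_def counit(3)[OF x(2,1)] simp del: conv_power.simps(2)
        intro: subspace_scale subspace_H)
  then show ?thesis
    unfolding log_id_homogeneous[OF x(1)] by (intro subspace_sum subspace_H)
qed

text \<open>The term k = 1 of \<open>log_id x\<close> is x itself; by
  \<open>conv_power_Suc_reduced\<close> every later term is a sum of products of two factors of
  lower positive degree.\<close>

lemma log_id_minus_decomposable:
  assumes "x \<in> H n" "1 \<le> n"
  shows "x - log_id x \<in> span {y * z |j y z. 1 \<le> j \<and> j < n \<and> y \<in> H j \<and> z \<in> H (n - j)}"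
    (is "_ \<in> span ?D")
proof -
  obtain m where m: "n = Suc m" using assms(2) by (cases n) auto
  have "log_id x = x + (\<Sum>k<m. coeff (binomial_poly (Suc (Suc k))) 1 *\<^sub>R conv_power (Suc (Suc k)) x)"
    unfolding log_id_homogeneous[OF assms(1)] m lessThan_Suc_atMost[symmetric]
    by (simp only: sum.lessThan_Suc_shift)
      (simp add: binomial_poly_def conv_power_1[OF assms] del: conv_power.simps(2))
  moreover have "conv_power (Suc (Suc k)) x \<in> span ?D" for k
    unfolding conv_power_Suc_reduced[OF assms]
  proof (rule reduced_sweedler_in[OF assms _ subspace_span])
    show "bilin (\<lambda>y z. y * conv_power (Suc k) z)" by (intro bilinI lin_intros linear_conv_power)
    show "y * conv_power (Suc k) z \<in> span ?D" if "1 \<le> j" "j < n" "y \<in> H j" "z \<in> H (n - j)" for j y z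
      using that conv_power_in_H[OF that(4)] by (intro span_base) force
  qed
  ultimately show ?thesis
    by (simp add: span_neg span_sum span_scale del: conv_power.simps)
qed

lemma prod_list_in_H: "(\<And>x. x \<in> set xs \<Longrightarrow> c x \<in> H (d x)) \<Longrightarrow> prod_list (map c xs) \<in> H (sum_list (map d xs))"
  by (induction xs) (auto simp: one_in_H0 intro: mult_H)

text \<open>Induction on the degree: a generator differs from its \<open>log_id\<close> by products
  of elements of lower degree, and a product of two or more generators has factors of lower degree.
  Monomials are indexed by lists, so that the lemma serves noncommutative algebras too.\<close>

lemma log_id_generates:
  assumes c: "\<And>x. x \<in> X \<Longrightarrow> c x \<in> H (d x) \<and> 1 \<le> d x"
    and gen: "span ((\<lambda>xs. prod_list (map c xs)) ` lists X) = UNIV"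
  shows "span ((\<lambda>xs. prod_list (map (\<lambda>x. log_id (c x)) xs)) ` lists X) = UNIV" (is "span ?S = UNIV")
proof -
  have closed: "x * y \<in> span ?S" if "x \<in> span ?S" "y \<in> span ?S" for x y
  proof (rule span_mult[OF that])
    fix x y assume "x \<in> ?S" "y \<in> ?S"
    then obtain xs ys where "xs \<in> lists X" "ys \<in> lists X"
      "x = prod_list (map (\<lambda>x. log_id (c x)) xs)" "y = prod_list (map (\<lambda>x. log_id (c x)) ys)"
      by blast
    then show "x * y \<in> span ?S" by (intro span_base image_eqI[of _ _ "xs @ ys"]) auto
  qed
  have "H n \<subseteq> span ?S" for n
  proof (induction n rule: less_induct)
    case (less n)
    have "prod_list (map c xs) \<in> span ?S" if xs: "xs \<in> lists X" "sum_list (map d xs) = n" for xs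
    proof (cases xs rule: remdups_adj.cases)
      case 1
      then show ?thesis by (intro span_base image_eqI[of _ _ "[]"]) auto
    next
      case (2 x)
      then have x: "x \<in> X" "c x \<in> H n" "1 \<le> n" using xs c by auto
      have "{y * z |j y z. 1 \<le> j \<and> j < n \<and> y \<in> H j \<and> z \<in> H (n - j)} \<subseteq> span ?S"
      proof clarify
        fix j y z assume "1 \<le> j" "j < n" "y \<in> H j" "z \<in> H (n - j)"
        then show "y * z \<in> span ?S"
          using less.IH[of j] less.IH[of "n - j"] by (intro closed) auto
      qed
      then have "c x - log_id (c x) \<in> span ?S"
        using log_id_minus_decomposable[OF x(2,3)] span_minimal[OF _ subspace_span] by blast
      moreover have "log_id (c x) \<in> span ?S"
        using x(1) by (intro span_base image_eqI[of _ _ "[x]"]) auto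
      ultimately have "(c x - log_id (c x)) + log_id (c x) \<in> span ?S" by (rule span_add)
      then show ?thesis using 2 by simp
    next
      case (3 x y zs)
      have X: "x \<in> X" "set (y # zs) \<subseteq> X" using xs(1) 3 by auto
      have pos: "1 \<le> d x" "1 \<le> d y" using X c by auto
      have "c x \<in> H (d x)" using X c by blast
      moreover have "d x < n" using pos xs(2) 3 by simp
      moreover have "prod_list (map c (y # zs)) \<in> H (sum_list (map d (y # zs)))"
        by (rule prod_list_in_H) (use X c in auto)
      moreover have "sum_list (map d (y # zs)) < n" using pos xs(2) 3 by simp
      ultimately have "c x * prod_list (map c (y # zs)) \<in> span ?S"
        using less.IH by (intro closed) blast+
      then show ?thesis using 3 by simp
    qed
    moreover have "H n = span ((\<lambda>xs. prod_list (map c xs)) ` {xs \<in> lists X. sum_list (map d xs) = n})"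
      by (rule homogeneous_span[OF _ gen]) (use c in \<open>auto intro: prod_list_in_H\<close>)
    ultimately show ?case
      using span_minimal[OF _ subspace_span, of "(\<lambda>xs. prod_list (map c xs)) ` {xs \<in> lists X. sum_list (map d xs) = n}"]
      by blast
  qed
  then have "span (\<Union>n. H n) \<subseteq> span ?S" by (intro span_minimal) auto
  then show ?thesis using span_H by auto
qed

section \<open>Hopf powers under commutativity and under cocommutativity\<close>

lemma psi_add: "psi (a + b) x = sweedler (\<lambda>y z. psi a y * psi b z) x"
proof (induction a arbitrary: x)
  case 0
  show ?case using sweedler_counit_left[OF linear_psi] by simp
next
  case (Suc a)
  have b1: "bilin (\<lambda>y z. psi a y * psi b z)" by (intro bilinI lin_intros linear_psi)
  have t: "trilin (\<lambda>y z1 z2. y * psi a z1 * psi b z2)"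
    by (intro trilinI lin_intros linear_psi)
  have "psi (Suc a + b) x = sweedler (\<lambda>y z. sweedler (\<lambda>z1 z2. y * psi a z1 * psi b z2) z) x"
    by (simp add: Suc.IH sweedler_compose[OF linear_mult_right[OF linear_var] b1] mult.assoc)
  also have "\<dots> = sweedler (\<lambda>y z. sweedler (\<lambda>y1 y2. y1 * psi a y2 * psi b z) y) x"
    by (rule sweedler_coassoc[OF t, symmetric])
  also have "\<dots> = sweedler (\<lambda>y z. psi (Suc a) y * psi b z) x"
    by (simp add: sweedler_compose[OF linear_mult_left[OF linear_var] bilin_psi])
  finally show ?case .
qed

text \<open>A convolution product of multiplicative maps is multiplicative once the factors of x can
  be moved past those of y. The induction starts from the identity map, at exponent 1.\<close>

lemma psi_mult_commutative:
  assumes comm: "commutative_algebra TYPE('h)" and "a \<ge> 1"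
  shows "psi a (x * y) = psi a x * psi a y"
  using assms(2)
proof (induction a arbitrary: x y rule: dec_induct)
  case base
  then show ?case by (simp add: psi_1 del: psi.simps)
next
  case (step n)
  have c: "w * z = z * w" for w z :: 'h using comm by (simp add: commutative_algebra_def)
  have "psi (Suc n) (x * y)
    = sweedler (\<lambda>x1 x2. sweedler (\<lambda>y1 y2. (x1 * y1) * (psi n x2 * psi n y2)) y) x"
    by (simp add: sweedler_mult[OF bilin_psi] step.IH)
  also have "\<dots> = sweedler (\<lambda>x1 x2. sweedler (\<lambda>y1 y2. (x1 * psi n x2) * (y1 * psi n y2)) y) x"
  proof -
    have "(x1 * y1) * (u * v) = (x1 * u) * (y1 * v)" for x1 y1 u v :: 'h
      using c[of y1 u] by (metis mult.assoc)
    then show ?thesis by simp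
  qed
  also have "\<dots> = sweedler (\<lambda>x1 x2. (x1 * psi n x2) * psi (Suc n) y) x"
    by (simp add: sweedler_compose[OF linear_mult_right[OF linear_var] bilin_psi])
  also have "\<dots> = psi (Suc n) x * psi (Suc n) y"
    unfolding psi.simps(2)[of n x]
    by (rule sweedler_compose[OF linear_mult_left[OF linear_var] bilin_psi, symmetric])
  finally show ?case .
qed

text \<open>Since \<open>psi a\<close> is multiplicative, it maps \<open>y * psi b z\<close> to
  \<open>psi a y * psi (a * b) z\<close>, and \<open>psi_add\<close> joins the exponents a and
  ab.\<close>

lemma psi_psi_commutative:
  assumes comm: "commutative_algebra TYPE('h)" and a: "a \<ge> 1"
  shows "psi a (psi b x) = psi (a * b) x"
proof (induction b arbitrary: x)
  case 0
  show ?case by (simp add: linear_scale[OF linear_psi] psi_of_1)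
next
  case (Suc b)
  show ?case
    by (simp add: sweedler_compose[OF linear_psi bilin_psi] psi_mult_commutative[OF assms] Suc.IH psi_add)
qed

lemma psi_log_id_commutative:
  assumes comm: "commutative_algebra TYPE('h)" and a: "a \<ge> 1"
  shows "psi a (log_id x) = real a *\<^sub>R log_id x"
proof -
  let ?K = "{k. conv_power k x \<noteq> 0}"
  note K = finite_conv_power_support[of x]
  \<comment> \<open>Composition with \<open>[:0, real a:]\<close> substitutes an for n, which
    multiplies the linear coefficient by a.\<close>
  have "(\<Sum>k\<in>?K. coeff (binomial_poly k) 1 *\<^sub>R psi a (conv_power k x))
    = (\<Sum>k\<in>?K. coeff (pcompose (binomial_poly k) [:0, real a:]) 1 *\<^sub>R conv_power k x)"
  proof (rule coeff_1_unique)
    fix n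
    have "psi a (psi n x) = psi (a * n) x" by (rule psi_psi_commutative[OF assms])
    then show "(\<Sum>k\<in>?K. poly (binomial_poly k) (real n) *\<^sub>R psi a (conv_power k x))
      = (\<Sum>k\<in>?K. poly (pcompose (binomial_poly k) [:0, real a:]) (real n) *\<^sub>R conv_power k x)"
      using poly_binomial_poly[of _ "a * n"]
      by (simp add: psi_eq_sum_choose[OF K order_refl] poly_binomial_poly poly_pcompose
          linear_sum[OF linear_psi] linear_scale[OF linear_psi] mult.commute)
  qed
  then show ?thesis
    by (simp add: log_id_def linear_sum[OF linear_psi] linear_scale[OF linear_psi]
        coeff_pcompose_linear scaleR_sum_right)
qed

text \<open>Both sides use the coproduct of x into four factors. Coassociativity rebrackets it until
  the two middle factors come from a common coproduct, where cocommutativity exchanges them.\<close>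

lemma sweedler_swap_middle:
  assumes cocomm: "cocommutative \<Delta>"
    and F: "\<And>y2 z1 z2. linear (\<lambda>y1. F y1 y2 z1 z2)" "\<And>y1 z1 z2. linear (\<lambda>y2. F y1 y2 z1 z2)"
      "\<And>y1 y2 z2. linear (\<lambda>z1. F y1 y2 z1 z2)" "\<And>y1 y2 z1. linear (\<lambda>z2. F y1 y2 z1 z2)"
  shows "sweedler (\<lambda>y z. sweedler (\<lambda>y1 y2. sweedler (\<lambda>z1 z2. F y1 y2 z1 z2) z) y) x
    = sweedler (\<lambda>y z. sweedler (\<lambda>y1 y2. sweedler (\<lambda>z1 z2. F y1 z1 y2 z2) z) y) x"
proof -
  have assoc: "sweedler (\<lambda>y z. sweedler (\<lambda>y1 y2. sweedler (\<lambda>z1 z2. G y1 y2 z1 z2) z) y) x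
    = sweedler (\<lambda>y w. sweedler (\<lambda>y2 z. sweedler (\<lambda>z1 z2. G y y2 z1 z2) z) w) x"
    if G: "\<And>y2 z1 z2. linear (\<lambda>y1. G y1 y2 z1 z2)" "\<And>y1 z1 z2. linear (\<lambda>y2. G y1 y2 z1 z2)"
      "\<And>y1 y2 z2. linear (\<lambda>z1. G y1 y2 z1 z2)" "\<And>y1 y2 z1. linear (\<lambda>z2. G y1 y2 z1 z2)" for G
    by (rule sweedler_coassoc)
      (intro trilinI linear_sweedler_param linear_sweedler bilinI G linear_var)
  \<comment> \<open>The same argument on three factors: it exchanges the first two, and is applied
    below to the last three of the four.\<close>
  have swap: "sweedler (\<lambda>a b. sweedler (\<lambda>b1 b2. K a b1 b2) b) w
    = sweedler (\<lambda>a b. sweedler (\<lambda>b1 b2. K b1 a b2) b) w" if K: "trilin K" for K w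
  proof -
    have K': "trilin (\<lambda>a b c. K b a c)" by (intro trilinI trilinD[OF K])
    have b: "bilin (\<lambda>c1 c2. K c1 c2 d)" for d by (intro bilinI trilinD[OF K])
    have "sweedler (\<lambda>a b. sweedler (\<lambda>b1 b2. K a b1 b2) b) w
        = sweedler (\<lambda>c d. sweedler (\<lambda>c1 c2. K c1 c2 d) c) w"
      by (rule sweedler_coassoc[OF K, symmetric])
    also have "\<dots> = sweedler (\<lambda>c d. sweedler (\<lambda>c1 c2. K c2 c1 d) c) w"
      by (simp add: sweedler_cocomm[OF cocomm b])
    also have "\<dots> = sweedler (\<lambda>a b. sweedler (\<lambda>b1 b2. K b1 a b2) b) w"
      by (rule sweedler_coassoc[OF K'])
    finally show ?thesis .
  qed
  have t: "trilin (F y)" for y by (intro trilinI F)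
  have "sweedler (\<lambda>y w. sweedler (\<lambda>y2 z. sweedler (\<lambda>z1 z2. F y y2 z1 z2) z) w) x
    = sweedler (\<lambda>y w. sweedler (\<lambda>y2 z. sweedler (\<lambda>z1 z2. F y z1 y2 z2) z) w) x"
    by (simp only: swap[OF t])
  then show ?thesis by (simp only: assoc[OF F] assoc[OF F(1,3,2,4)])
qed

text \<open>Dual to \<open>psi_mult_commutative\<close>. Multiplicativity of \<Delta> pairs y1 with
  z1 and y2 with z2, whereas evaluating \<open>psi\<close> on each tensor factor pairs y1 with y2;
  the exchange of the middle factors reconciles the two.\<close>

lemma sweedler_psi_cocommutative:
  assumes cocomm: "cocommutative \<Delta>"
  shows "bilin \<beta> \<Longrightarrow> sweedler \<beta> (psi n x) = sweedler (\<lambda>y z. \<beta> (psi n y) (psi n z)) x"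
proof (induction n arbitrary: x \<beta>)
  case 0
  note b = linear_scale[OF bilinD(1)[OF 0]] linear_scale[OF bilinD(2)[OF 0]]
  have "sweedler (\<lambda>y z. counit y *\<^sub>R (counit z *\<^sub>R \<beta> 1 1)) x = counit x *\<^sub>R \<beta> 1 1"
    by (rule sweedler_counit_left) (intro lin_intros counit)
  moreover have "sweedler \<beta> (counit x *\<^sub>R 1) = counit x *\<^sub>R sweedler \<beta> 1"
    by (rule linear_scale[OF linear_sweedler[OF 0 linear_var]])
  ultimately show ?case by (simp add: b sweedler_1[OF 0] mult.commute)
next
  case (Suc n)
  note b = bilin_comp1[OF Suc.prems] bilin_comp2[OF Suc.prems]
  have b1: "bilin (\<lambda>z1 z2. \<beta> (y1 * z1) (y2 * z2))" for y1 y2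
    by (intro bilinI b lin_intros)
  have "sweedler \<beta> (psi (Suc n) x) = sweedler (\<lambda>y z. sweedler \<beta> (y * psi n z)) x"
    by (simp add: sweedler_compose[OF linear_sweedler[OF Suc.prems linear_var] bilin_psi])
  also have "\<dots> = sweedler (\<lambda>y z. sweedler (\<lambda>y1 y2.
      sweedler (\<lambda>z1 z2. \<beta> (y1 * psi n z1) (y2 * psi n z2)) z) y) x"
    by (simp add: sweedler_mult[OF Suc.prems] Suc.IH[OF b1])
  also have "\<dots> = sweedler (\<lambda>y z. sweedler (\<lambda>y1 y2.
      sweedler (\<lambda>z1 z2. \<beta> (y1 * psi n y2) (z1 * psi n z2)) z) y) x"
    by (rule sweedler_swap_middle[OF cocomm]) (intro b lin_intros linear_psi)+
  also have "\<dots> = sweedler (\<lambda>y z. \<beta> (psi (Suc n) y) (psi (Suc n) z)) x"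
  proof -
    have e1: "\<beta> c (psi (Suc n) z) = sweedler (\<lambda>z1 z2. \<beta> c (z1 * psi n z2)) z" for c z
      by (simp add: sweedler_compose[OF bilinD(1)[OF Suc.prems] bilin_psi])
    have e2: "\<beta> (psi (Suc n) y) c = sweedler (\<lambda>y1 y2. \<beta> (y1 * psi n y2) c) y" for c y
      by (simp add: sweedler_compose[OF bilinD(2)[OF Suc.prems] bilin_psi])
    show ?thesis unfolding e2 unfolding e1 ..
  qed
  finally show ?case .
qed

text \<open>Expanding \<open>psi n\<close> in both tensor factors of \<Delta> gives products of two
  binomial polynomials. The linear coefficient of such a product vanishes unless one index is 0, and
  the terms with an index 0 add up to \<open>1 \<otimes> log_id x\<close> and
  \<open>log_id x \<otimes> 1\<close>.\<close>

lemma primitive_log_id: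
  assumes cocomm: "cocommutative \<Delta>" and x: "x \<in> H m"
  shows "primitive \<Delta> (log_id x)"
proof -
  let ?c = "\<lambda>k. coeff (binomial_poly k) 1"
  let ?T = "\<lambda>k l. sweedler (\<lambda>y z. pure_tensor [conv_power k y, conv_power l z]) x"
  have bT: "bilin (\<lambda>y z. pure_tensor [conv_power k y, conv_power l z])" for k l
    by (intro bilinI lin_intros linear_conv_power)
  \<comment> \<open>One bound m serves both tensor factors whatever their degrees, so the double sum
    below has a fixed index set.\<close>
  have psi_le: "psi n y = (\<Sum>k\<le>m. real (n choose k) *\<^sub>R conv_power k y)" if "y \<in> H j" "j \<le> m" for n y j
    using conv_power_eq_0[OF that(1)] that(2)
    by (intro psi_eq_sum_choose) (auto simp: not_less[symmetric])
  note lin1 = linear_pure_tensor1[OF linear_var] and lin2 = linear_pure_tensor2[OF linear_var]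
  have "(\<Sum>k\<le>m. ?c k *\<^sub>R \<Delta> (conv_power k x))
    = (\<Sum>kl\<in>{..m} \<times> {..m}. coeff (binomial_poly (fst kl) * binomial_poly (snd kl)) 1 *\<^sub>R ?T (fst kl) (snd kl))"
  proof (rule coeff_1_unique)
    fix n
    have "(\<Sum>k\<le>m. poly (binomial_poly k) (real n) *\<^sub>R \<Delta> (conv_power k x)) = \<Delta> (psi n x)"
      by (simp add: psi_le[OF x] poly_binomial_poly linear_sum[OF linear_coprod] linear_scale[OF linear_coprod])
    also have "\<dots> = sweedler (\<lambda>y z. pure_tensor [psi n y, psi n z]) x"
      using sweedler_psi_cocommutative[OF cocomm bilin_pure_tensor, of n x]
      by (simp add: sweedler_pure_tensor)
    also have "\<dots> = sweedler (\<lambda>y z. \<Sum>kl\<in>{..m} \<times> {..m}.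
        (real (n choose fst kl) * real (n choose snd kl)) *\<^sub>R
          pure_tensor [conv_power (fst kl) y, conv_power (snd kl) z]) x"
    proof (rule sweedler_cong[OF x])
      show "bilin (\<lambda>y z. pure_tensor [psi n y, psi n z])" by (intro bilinI lin_intros linear_psi)
      show "bilin (\<lambda>y z. \<Sum>kl\<in>{..m} \<times> {..m}. (real (n choose fst kl) * real (n choose snd kl)) *\<^sub>R
          pure_tensor [conv_power (fst kl) y, conv_power (snd kl) z])"
        by (intro bilinI linear_compose_sum ballI linear_compose_scale_right bilinD[OF bT])
      fix j y z assume yz: "j \<le> m" "y \<in> H j" "z \<in> H (m - j)"
      have p1: "pure_tensor [psi n y, w] = (\<Sum>k\<le>m. real (n choose k) *\<^sub>R pure_tensor [conv_power k y, w])" for w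
        by (simp add: psi_le[OF yz(2,1)] linear_sum[OF lin1] linear_scale[OF lin1])
      have p2: "pure_tensor [u, psi n z] = (\<Sum>l\<le>m. real (n choose l) *\<^sub>R pure_tensor [u, conv_power l z])" for u
        by (simp add: psi_le[OF yz(3)] linear_sum[OF lin2] linear_scale[OF lin2])
      show "pure_tensor [psi n y, psi n z] = (\<Sum>kl\<in>{..m} \<times> {..m}.
        (real (n choose fst kl) * real (n choose snd kl)) *\<^sub>R
          pure_tensor [conv_power (fst kl) y, conv_power (snd kl) z])"
        unfolding p1 unfolding p2 by (simp add: scaleR_sum_right sum.cartesian_product case_prod_beta)
    qed
    also have "\<dots> = (\<Sum>kl\<in>{..m} \<times> {..m}. poly (binomial_poly (fst kl) * binomial_poly (snd kl)) (real n)
        *\<^sub>R ?T (fst kl) (snd kl))"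
      by (simp add: sweedler_sum_scale[OF bT] poly_binomial_poly)
    finally show "(\<Sum>k\<le>m. poly (binomial_poly k) (real n) *\<^sub>R \<Delta> (conv_power k x)) = \<dots>" .
  qed
  \<comment> \<open>The linear coefficient of pq is p(0) q'(0) + p'(0) q(0), and
    \<open>binomial_poly k\<close> vanishes at 0 unless k = 0.\<close>
  also have "\<dots> = (\<Sum>k\<le>m. \<Sum>l\<le>m. (if k = 0 then ?c l *\<^sub>R ?T 0 l else 0) + (if l = 0 then ?c k *\<^sub>R ?T k 0 else 0))"
    by (simp add: sum.cartesian_product case_prod_beta coeff_mult coeff_0_binomial_poly del: conv_power.simps)
      (rule sum.cong, auto simp: scaleR_add_left coeff_0_binomial_poly simp del: conv_power.simps)
  also have "\<dots> = (\<Sum>l\<le>m. ?c l *\<^sub>R ?T 0 l) + (\<Sum>k\<le>m. ?c k *\<^sub>R ?T k 0)"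
  proof -
    have "(\<Sum>k\<le>m. \<Sum>l\<le>m. if k = 0 then f l else 0) = (\<Sum>l\<le>m. f l)"
      for f :: "nat \<Rightarrow> 'h tensor_algebra"
      by (subst sum.swap) (simp add: sum.delta)
    moreover have "(\<Sum>k\<le>m. \<Sum>l\<le>m. if l = 0 then f k else 0) = (\<Sum>k\<le>m. f k)"
      for f :: "nat \<Rightarrow> 'h tensor_algebra"
      by (simp add: sum.delta)
    ultimately show ?thesis by (simp only: sum.distrib)
  qed
  also have "(\<lambda>l. ?T 0 l) = (\<lambda>l. pure_tensor [1, conv_power l x])"
  proof
    fix l
    show "?T 0 l = pure_tensor [1, conv_power l x]"
      using sweedler_counit_left[of "\<lambda>z. pure_tensor [1, conv_power l z]" x]
      by (simp add: linear_scale[OF lin1] lin_intros linear_conv_power del: conv_power.simps(2))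
  qed
  also have "(\<lambda>l. ?T l 0) = (\<lambda>l. pure_tensor [conv_power l x, 1])"
  proof
    fix l
    show "?T l 0 = pure_tensor [conv_power l x, 1]"
      using sweedler_counit_right[of "\<lambda>z. pure_tensor [conv_power l z, 1]" x]
      by (simp add: linear_scale[OF lin2] lin_intros linear_conv_power del: conv_power.simps(2))
  qed
  finally show ?thesis
    unfolding primitive_def log_id_homogeneous[OF x]
    by (simp add: linear_sum[OF linear_coprod] linear_scale[OF linear_coprod]
        linear_sum[OF lin1] linear_sum[OF lin2] linear_scale[OF lin1] linear_scale[OF lin2] del: conv_power.simps)
qed

end


section \<open>Bases indexed by multisets\<close>

definition multiset_count :: "'i set \<Rightarrow> ('i \<Rightarrow> nat) \<Rightarrow> nat \<Rightarrow> nat \<Rightarrow> nat"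
  where "multiset_count X d n k = card {M. set_mset M \<subseteq> X \<and> (\<Sum>i\<in>#M. d i) = n \<and> size M = k}"

text \<open>A multiset either avoids i or loses one copy of it. Read as an identity of coefficients,
  this is multiplication of the series for \<open>insert i J\<close> by 1 - y x^(d i).\<close>

lemma multiset_count_insert:
  assumes "finite J" "i \<notin> J"
  shows "multiset_count (insert i J) d n k
    = multiset_count J d n k + (if d i \<le> n \<and> 1 \<le> k then multiset_count (insert i J) d (n - d i) (k - 1) else 0)"
proof -
  let ?A = "{M. set_mset M \<subseteq> insert i J \<and> (\<Sum>i\<in>#M. d i) = n \<and> size M = k}"
  let ?B = "{M. set_mset M \<subseteq> J \<and> (\<Sum>i\<in>#M. d i) = n \<and> size M = k}"
  let ?C = "{M \<in> ?A. i \<in># M}"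
  have fin: "finite ?A"
  proof (rule finite_subset)
    show "?A \<subseteq> mset ` {xs. set xs \<subseteq> insert i J \<and> length xs = k}"
    proof
      fix M assume "M \<in> ?A"
      then show "M \<in> mset ` {xs. set xs \<subseteq> insert i J \<and> length xs = k}"
        by (intro image_eqI[of _ _ "list_of_mset M"])
          (auto simp flip: set_mset_mset size_mset)
    qed
    show "finite (mset ` {xs. set xs \<subseteq> insert i J \<and> length xs = k})"
      by (intro finite_imageI finite_lists_length_eq) (use assms in simp)
  qed
  have split: "?A = ?B \<union> ?C"
    by (intro equalityI subsetI) (use assms(2) in \<open>auto simp: subset_iff\<close>)
  have "card ?A = card (?B \<union> ?C)" using split by (rule arg_cong)
  also have "\<dots> = card ?B + card ?C"
  proof (rule card_Un_disjoint)
    show "finite ?B" by (rule finite_subset[OF _ fin]) auto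
    show "finite ?C" by (rule finite_subset[OF _ fin]) (rule Collect_restrict)
    show "?B \<inter> ?C = {}" using assms(2) by auto
  qed
  also have "card ?C = (if d i \<le> n \<and> 1 \<le> k then multiset_count (insert i J) d (n - d i) (k - 1) else 0)"
  proof (cases "d i \<le> n \<and> 1 \<le> k")
    case True
    let ?D = "{M. set_mset M \<subseteq> insert i J \<and> (\<Sum>i\<in>#M. d i) = n - d i \<and> size M = k - 1}"
    have "?C = add_mset i ` ?D"
    proof (intro equalityI subsetI)
      fix M assume "M \<in> ?C"
      then obtain N where "M = add_mset i N" "M \<in> ?C" by (metis (no_types, lifting) mem_Collect_eq mset_add)
      then show "M \<in> add_mset i ` ?D" by auto
    qed (use True in auto)
    then have "card ?C = card ?D" by (simp add: card_image inj_on_def)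
    then show ?thesis using True by (simp add: multiset_count_def)
  next
    case False
    have C: "?C = {}"
    proof (rule equals0I)
      fix M assume M: "M \<in> ?C"
      then obtain N where "M = add_mset i N" by (metis (no_types, lifting) mem_Collect_eq mset_add)
      then show False using M False by auto
    qed
    show ?thesis unfolding if_not_P[OF False] by (simp only: C card.empty)
  qed
  finally show ?thesis by (simp add: multiset_count_def)
qed

definition multiset_fps :: "'i set \<Rightarrow> ('i \<Rightarrow> nat) \<Rightarrow> real fps fps"
  where "multiset_fps X d = Abs_fps (\<lambda>n. Abs_fps (\<lambda>k. real (multiset_count X d n k)))"

lemma prod_inverse_eq_multiset_fps:
  assumes "finite J" "\<And>i. i \<in> J \<Longrightarrow> 1 \<le> d i"
  shows "(\<Prod>i\<in>J. inverse (1 - fps_const fps_X * fps_X ^ d i)) = multiset_fps J d"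
  using assms
proof (induction J rule: finite_induct)
  case empty
  have "{M. M = {#} \<and> (\<Sum>i\<in>#M. d i) = n \<and> size M = k} = (if n = 0 \<and> k = 0 then {{#}} else {})" for n k
    by auto
  then have "multiset_count {} d n k = (if n = 0 \<and> k = 0 then 1 else 0)" for n k
    by (simp add: multiset_count_def)
  then show ?case by (simp add: multiset_fps_def fps_eq_iff)
next
  case (insert i J)
  let ?f = "1 - fps_const fps_X * fps_X ^ d i :: real fps fps"
  \<comment> \<open>Positivity of \<open>d i\<close> gives \<open>?f\<close> the constant
    coefficient 1. Coefficients lie in the ring \<open>real fps\<close>, so invertibility is
    obtained from the right inverse attached to that constant coefficient.\<close>
  have f0: "fps_nth ?f 0 = 1" using insert.prems[of i] by simp
  have one: "inverse (1 :: real fps) = 1" by simp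
  have "inverse ?f = fps_right_inverse ?f 1" unfolding fps_inverse_def[of ?f] f0 one ..
  moreover have "?f * fps_right_inverse ?f 1 = 1" by (rule fps_right_inverse) (simp only: f0 mult_1)
  ultimately have inv: "inverse ?f * ?f = 1" by (simp only: mult.commute)
  have "?f * multiset_fps (insert i J) d = multiset_fps J d"
  proof (rule fps_ext, rule fps_ext)
    fix n k
    have e: "?f * multiset_fps (insert i J) d = multiset_fps (insert i J) d
        - fps_const fps_X * (fps_X ^ d i * multiset_fps (insert i J) d)"
      by (simp add: algebra_simps)
    show "fps_nth (fps_nth (?f * multiset_fps (insert i J) d) n) k = fps_nth (fps_nth (multiset_fps J d) n) k"
      unfolding e fps_sub_nth fps_mult_left_const_nth fps_X_power_mult_nth
      by (simp add: multiset_fps_def multiset_count_insert[OF insert.hyps])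
  qed
  then have "inverse ?f * (?f * multiset_fps (insert i J) d) = inverse ?f * multiset_fps J d" by simp
  then have "multiset_fps (insert i J) d = inverse ?f * multiset_fps J d"
    by (simp add: mult.assoc[symmetric] inv)
  then show ?case using insert by simp
qed

text \<open>A multiset of total degree n contains only indices of degree at most n. These are
  finitely many, so the coefficient of x^n is constant for all finite subsets that include
  them.\<close>

lemma has_multiplicity_product_multiset_fps:
  assumes fin: "\<And>n. finite {i \<in> X. d i = n}" and pos: "\<And>i. i \<in> X \<Longrightarrow> 1 \<le> d i"
  shows "has_multiplicity_product X d (multiset_fps X d)"
  unfolding has_multiplicity_product_def
proof (rule tendsto_fpsI)
  fix n
  let ?J = "{i \<in> X. d i \<le> n}"
  have "?J = (\<Union>m\<le>n. {i \<in> X. d i = m})" by auto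
  then have J: "finite ?J" using fin by simp
  show "\<forall>\<^sub>F J in finite_subsets_at_top X. fps_nth (\<Prod>i\<in>J. inverse (1 - fps_const fps_X * fps_X ^ d i)) n
      = fps_nth (multiset_fps X d) n"
    unfolding eventually_finite_subsets_at_top
  proof (rule exI[of _ ?J], intro conjI allI impI J)
    fix K assume K: "finite K \<and> ?J \<subseteq> K \<and> K \<subseteq> X"
    have "multiset_count K d n k = multiset_count X d n k" for k
    proof -
      have "set_mset M \<subseteq> K" if M: "set_mset M \<subseteq> X" "(\<Sum>i\<in>#M. d i) = n" for M
      proof
        fix i assume i: "i \<in># M"
        then have "d i \<le> n" using M(2) by (metis insert_DiffM le_add1 image_mset_add_mset sum_mset.insert)
        then show "i \<in> K" using K M i by auto
      qed
      then have "{M. set_mset M \<subseteq> K \<and> (\<Sum>i\<in>#M. d i) = n \<and> size M = k}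
          = {M. set_mset M \<subseteq> X \<and> (\<Sum>i\<in>#M. d i) = n \<and> size M = k}"
        using K by blast
      then show ?thesis by (simp add: multiset_count_def)
    qed
    moreover have "(\<Prod>i\<in>K. inverse (1 - fps_const fps_X * fps_X ^ d i)) = multiset_fps K d"
      by (rule prod_inverse_eq_multiset_fps) (use K pos in auto)
    ultimately show "fps_nth (\<Prod>i\<in>K. inverse (1 - fps_const fps_X * fps_X ^ d i)) n
      = fps_nth (multiset_fps X d) n"
      by (simp add: multiset_fps_def)
  qed auto
qed

lemma set_list_of_mset [simp]: "set (list_of_mset M) = set_mset M"
  by (metis mset_list_of_mset set_mset_mset)

lemma length_list_of_mset [simp]: "length (list_of_mset M) = size M"
  by (metis mset_list_of_mset size_mset)

lemma sum_list_of_mset: "sum_list (map d (list_of_mset M)) = (\<Sum>i\<in>#M. d i)" for d :: "_ \<Rightarrow> nat"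
  by (metis mset_list_of_mset mset_map sum_mset_sum_list)

lemma prod_list_commutative:
  assumes "commutative_algebra TYPE('h::real_algebra_1)"
  shows "mset xs = mset ys \<Longrightarrow> prod_list xs = (prod_list ys :: 'h)"
proof (induction xs arbitrary: ys)
  case (Cons x xs)
  have c: "w * z = z * w" for w z :: 'h using assms by (simp add: commutative_algebra_def)
  have "x \<in> set ys" using Cons.prems by (metis list.set_intros(1) set_mset_mset)
  then obtain us vs where ys: "ys = us @ x # vs" by (meson split_list)
  then have "prod_list xs = prod_list (us @ vs)" using Cons.prems by (intro Cons.IH) simp
  then show ?case using c[of x "prod_list us"] by (simp add: ys mult.assoc[symmetric])
qed simp

context finite_type_hopf_algebra
begin

lemma multiplicities_of_multiset_basis:
  assumes X: "\<And>i. i \<in> X \<Longrightarrow> 1 \<le> d i"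
    and b: "is_basis_family {M. set_mset M \<subseteq> X} b"
    and deg: "\<And>M. set_mset M \<subseteq> X \<Longrightarrow> b M \<in> H (\<Sum>i\<in>#M. d i)"
    and eig: "\<And>M. set_mset M \<subseteq> X \<Longrightarrow> psi a (b M) = (real a ^ size M) *\<^sub>R b M" and a: "a \<ge> 2"
  shows "multiplicities_given_by H \<Delta> a X d"
proof -
  have hp: "hopf_power \<Delta> a = psi a" using hopf_power_eq_psi[of a] a by auto
  have "finite {i \<in> X. d i = n}" for n
  proof -
    have "finite {M \<in> {M. set_mset M \<subseteq> X}. (\<Sum>i\<in>#M. d i) = n}"
      using basis_degree(1)[OF b, of "\<lambda>M. \<Sum>i\<in>#M. d i"] deg by simp
    \<comment> \<open>Singletons embed the indices of degree n into the basis members of degree n,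
      so finite dimension bounds the generators too.\<close>
    moreover have "(\<lambda>i. {#i#}) ` {i \<in> X. d i = n} \<subseteq> {M \<in> {M. set_mset M \<subseteq> X}. (\<Sum>i\<in>#M. d i) = n}"
      by auto
    ultimately have "finite ((\<lambda>i. {#i#}) ` {i \<in> X. d i = n})" by (rule rev_finite_subset)
    then show ?thesis by (rule finite_imageD) (simp add: inj_on_def)
  qed
  then have "has_multiplicity_product X d (multiset_fps X d)"
    using X by (rule has_multiplicity_product_multiset_fps)
  moreover have "dim {x \<in> H n. hopf_power \<Delta> a x = (real a ^ k) *\<^sub>R x} = multiset_count X d n k" for n k
    unfolding hp multiset_count_def
    using dim_eigenspace[OF b, of "\<lambda>M. \<Sum>i\<in>#M. d i" "psi a" a size n k] deg eig a linear_psi by simp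
  ultimately show ?thesis
    unfolding multiplicities_given_by_def by (intro exI[of _ "multiset_fps X d"]) (simp add: multiset_fps_def)
qed

lemma eigenvector_of_basis:
  assumes "is_basis_family I b" "i \<in> I" "psi a (b i) = c *\<^sub>R b i" "a \<ge> 2"
  shows "is_eigenvector (hopf_power \<Delta> a) c (b i)"
proof -
  show ?thesis
    using is_basis_family_nonzero[OF assms(1,2)] assms(3,4) hopf_power_eq_psi[of a]
    by (simp add: is_eigenvector_def)
qed

text \<open>Spanning comes from \<open>log_id_generates\<close>, since commutativity reduces lists
  to multisets; the monomials in c serve as the reference basis. The eigenvalue is a power of a
  because \<open>psi a\<close> is multiplicative. The map c covers both a free generating set and
  the Lyndon words with their images.\<close>

lemma commutative_eigenbasis:
  assumes comm: "commutative_algebra TYPE('h)"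
    and c: "\<And>x. x \<in> X \<Longrightarrow> c x \<in> H (d x) \<and> 1 \<le> d x"
    and basis: "is_basis_family {M. set_mset M \<subseteq> X} (\<lambda>M. prod_list (map c (list_of_mset M)))"
    and a: "a \<ge> 2"
  defines "b \<equiv> (\<lambda>M. prod_list (map (\<lambda>x. log_id (c x)) (list_of_mset M)))"
  shows "is_basis_family {M. set_mset M \<subseteq> X} b"
    and "\<And>M. psi a (b M) = (real a ^ size M) *\<^sub>R b M"
    and "multiplicities_given_by H \<Delta> a X d"
proof -
  have deg: "prod_list (map f (list_of_mset M)) \<in> H (\<Sum>i\<in>#M. d i)"
    if "set_mset M \<subseteq> X" "\<And>x. x \<in> X \<Longrightarrow> f x \<in> H (d x)" for M f
    unfolding sum_list_of_mset[symmetric] by (rule prod_list_in_H) (use that in auto)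
  have logc: "log_id (c x) \<in> H (d x)" if "x \<in> X" for x
    using c[OF that] log_id_in_H by blast
  have "(\<lambda>M. prod_list (map c (list_of_mset M))) ` {M. set_mset M \<subseteq> X}
      \<subseteq> (\<lambda>xs. prod_list (map c xs)) ` lists X"
  proof
    fix y assume "y \<in> (\<lambda>M. prod_list (map c (list_of_mset M))) ` {M. set_mset M \<subseteq> X}"
    then obtain M where "set_mset M \<subseteq> X" "y = prod_list (map c (list_of_mset M))" by blast
    then show "y \<in> (\<lambda>xs. prod_list (map c xs)) ` lists X"
      by (intro image_eqI[of _ _ "list_of_mset M"]) auto
  qed
  from span_mono[OF this] have "span ((\<lambda>xs. prod_list (map c xs)) ` lists X) = UNIV"
    using basis by (auto simp: is_basis_family_def)
  from log_id_generates[OF c this]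
  have gen: "span ((\<lambda>xs. prod_list (map (\<lambda>x. log_id (c x)) xs)) ` lists X) = UNIV" by blast
  have "(\<lambda>xs. prod_list (map (\<lambda>x. log_id (c x)) xs)) ` lists X \<subseteq> b ` {M. set_mset M \<subseteq> X}"
  proof
    fix y assume "y \<in> (\<lambda>xs. prod_list (map (\<lambda>x. log_id (c x)) xs)) ` lists X"
    then obtain xs where xs: "xs \<in> lists X" "y = prod_list (map (\<lambda>x. log_id (c x)) xs)" by blast
    have "y = b (mset xs)"
      unfolding b_def xs(2) by (rule prod_list_commutative[OF comm]) simp
    then show "y \<in> b ` {M. set_mset M \<subseteq> X}" using xs(1) by auto
  qed
  from span_mono[OF this] have span: "span (b ` {M. set_mset M \<subseteq> X}) = UNIV" using gen by auto
  show B: "is_basis_family {M. set_mset M \<subseteq> X} b"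
  proof (rule basis_if_spanning[OF basis _ _ span])
    show "b M \<in> H (\<Sum>i\<in>#M. d i)" if "M \<in> {M. set_mset M \<subseteq> X}" for M
      unfolding b_def by (rule deg) (use that logc in auto)
    show "prod_list (map c (list_of_mset M)) \<in> H (\<Sum>i\<in>#M. d i)" if "M \<in> {M. set_mset M \<subseteq> X}" for M
      by (rule deg) (use that c in auto)
  qed
  have "psi a (prod_list (map (\<lambda>x. log_id (c x)) xs))
      = (real a ^ length xs) *\<^sub>R prod_list (map (\<lambda>x. log_id (c x)) xs)" for xs
    using a by (induction xs)
      (simp_all add: psi_of_1 psi_mult_commutative[OF comm] psi_log_id_commutative[OF comm])
  then show eig: "psi a (b M) = (real a ^ size M) *\<^sub>R b M" for M
    unfolding b_def by simp
  show "multiplicities_given_by H \<Delta> a X d"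
    by (rule multiplicities_of_multiset_basis[OF _ B _ eig a]) (use c deg logc in \<open>auto simp: b_def\<close>)
qed

end


section \<open>Products of primitive elements\<close>

text \<open>The symmetrised product of a multiset of size \<open>n\<close>, by splitting off the first factor.\<close>

primrec symprod_rec :: "nat \<Rightarrow> 'a::real_algebra_1 multiset \<Rightarrow> 'a"
  where "symprod_rec 0 M = 1"
  | "symprod_rec (Suc n) M = (1 / real (Suc n)) *\<^sub>R (\<Sum>x\<in>#M. x * symprod_rec n (M - {#x#}))"

definition symprod :: "'a::real_algebra_1 multiset \<Rightarrow> 'a"
  where "symprod M = symprod_rec (size M) M"

text \<open>Indexing by a set distinguishes repeated factors, so that ways of splitting a product
  become subsets of I.\<close>

definition symprod_on :: "('i \<Rightarrow> 'a::real_algebra_1) \<Rightarrow> 'i set \<Rightarrow> 'a"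
  where "symprod_on f I = symprod (image_mset f (mset_set I))"

lemma symprod_empty [simp]: "symprod {#} = 1"
  by (simp add: symprod_def)

lemma symprod_step:
  assumes "M \<noteq> {#}"
  shows "symprod M = (1 / real (size M)) *\<^sub>R (\<Sum>x\<in>#M. x * symprod (M - {#x#}))"
proof -
  obtain n where n: "size M = Suc n" using assms by (cases "size M") auto
  have "symprod_rec n (M - {#x#}) = symprod (M - {#x#})" if "x \<in># M" for x
    using that n by (simp add: symprod_def size_Diff_singleton)
  then have "(\<Sum>x\<in>#M. x * symprod_rec n (M - {#x#})) = (\<Sum>x\<in>#M. x * symprod (M - {#x#}))"
    by (intro arg_cong[of _ _ sum_mset] image_mset_cong) simp
  then show ?thesis by (simp add: symprod_def[of M] n)
qed

lemma symprod_on_empty [simp]: "symprod_on f {} = 1"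
  by (simp add: symprod_on_def)

lemma symprod_on_card:
  assumes "finite I"
  shows "real (card I) *\<^sub>R symprod_on f I = (\<Sum>i\<in>I. f i * symprod_on f (I - {i}))"
proof (cases "I = {}")
  case False
  let ?M = "image_mset f (mset_set I)"
  have "?M \<noteq> {#}" using assms False by (simp add: mset_set_empty_iff)
  moreover have "size ?M = card I" by simp
  moreover have "(\<Sum>x\<in>#?M. x * symprod (?M - {#x#})) = (\<Sum>i\<in>I. f i * symprod_on f (I - {i}))"
  proof -
    have "?M - {#f i#} = image_mset f (mset_set (I - {i}))" if "i \<in> I" for i
      using assms that by (simp add: mset_set_Diff image_mset_Diff)
    then have "(\<Sum>i\<in>I. f i * symprod (?M - {#f i#})) = (\<Sum>i\<in>I. f i * symprod_on f (I - {i}))"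
      by (simp add: symprod_on_def)
    then show ?thesis by (simp add: sum_unfold_sum_mset multiset.map_comp o_def)
  qed
  ultimately show ?thesis using assms False symprod_step[of ?M] by (simp add: symprod_on_def)
qed simp

lemma sum_permutations_eq_symprod_on:
  assumes "finite I"
  shows "(\<Sum>l\<in>permutations_of_set I. prod_list (map f l)) = fact (card I) *\<^sub>R symprod_on f I"
  using assms
proof (induction "card I" arbitrary: I)
  case 0
  then show ?case by simp
next
  case (Suc n)
  have ne: "I \<noteq> {}" using Suc.hyps(2) by auto
  have "(\<Sum>l\<in>permutations_of_set I. prod_list (map f l))
    = (\<Sum>i\<in>I. \<Sum>l\<in>(#) i ` permutations_of_set (I - {i}). prod_list (map f l))"
    unfolding permutations_of_set_nonempty[OF ne]
    by (rule sum.UNION_disjoint) (use Suc.prems in auto)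
  also have "\<dots> = (\<Sum>i\<in>I. f i * (\<Sum>l\<in>permutations_of_set (I - {i}). prod_list (map f l)))"
    by (simp add: sum.reindex sum_distrib_left)
  also have "\<dots> = (\<Sum>i\<in>I. fact n *\<^sub>R (f i * symprod_on f (I - {i})))"
  proof (rule sum.cong[OF refl])
    fix i assume "i \<in> I"
    then have "card (I - {i}) = n" using Suc.hyps(2) Suc.prems by simp
    then show "f i * (\<Sum>l\<in>permutations_of_set (I - {i}). prod_list (map f l))
      = fact n *\<^sub>R (f i * symprod_on f (I - {i}))"
      using Suc.hyps(1)[of "I - {i}"] Suc.prems by simp
  qed
  also have "\<dots> = fact n *\<^sub>R (real (card I) *\<^sub>R symprod_on f I)"
    by (simp add: symprod_on_card[OF Suc.prems] scaleR_sum_right)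
  finally show ?case by (simp add: Suc.hyps(2)[symmetric] mult.commute)
qed

lemma mset_eq_image_mset_nth: "mset xs = image_mset ((!) xs) (mset_set {..<length xs})"
proof -
  have "mset xs = mset (map ((!) xs) [0..<length xs])" by (simp add: map_nth)
  then show ?thesis by (simp only: mset_map mset_upt lessThan_atLeast0)
qed

text \<open>A permutation, written as the list of its values, is an ordering of the index set;
  \<open>sum_permutations_eq_symprod_on\<close> evaluates the sum over all orderings.\<close>

lemma symmetrized_product_eq_symprod: "symmetrized_product xs = symprod (mset xs)"
proof -
  let ?I = "{..<length xs}"
  have bij: "bij_betw (\<lambda>\<sigma>. map \<sigma> [0..<length xs]) {\<sigma>. \<sigma> permutes ?I} (permutations_of_set ?I)"
    unfolding bij_betw_def
  proof
    show inj: "inj_on (\<lambda>\<sigma>. map \<sigma> [0..<length xs]) {\<sigma>. \<sigma> permutes ?I}"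
    proof (rule inj_onI, rule ext)
      fix \<sigma> \<tau> i
      assume *: "\<sigma> \<in> {\<sigma>. \<sigma> permutes ?I}" "\<tau> \<in> {\<sigma>. \<sigma> permutes ?I}"
        "map \<sigma> [0..<length xs] = map \<tau> [0..<length xs]"
      show "\<sigma> i = \<tau> i"
        using * by (cases "i < length xs") (auto simp: permutes_def)
    qed
    show "(\<lambda>\<sigma>. map \<sigma> [0..<length xs]) ` {\<sigma>. \<sigma> permutes ?I} = permutations_of_set ?I"
    proof (rule card_subset_eq)
      show "(\<lambda>\<sigma>. map \<sigma> [0..<length xs]) ` {\<sigma>. \<sigma> permutes ?I} \<subseteq> permutations_of_set ?I"
      proof clarify
        fix \<sigma> assume \<sigma>: "\<sigma> permutes ?I"
        have "set (map \<sigma> [0..<length xs]) = ?I"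
          using permutes_image[OF \<sigma>] by (simp add: lessThan_atLeast0)
        moreover have "distinct (map \<sigma> [0..<length xs])"
          using permutes_inj_on[OF \<sigma>] by (simp add: distinct_map)
        ultimately show "map \<sigma> [0..<length xs] \<in> permutations_of_set ?I"
          by (rule permutations_of_setI)
      qed
    qed (simp_all add: card_image[OF inj] card_permutations[of _ "length xs"])
  qed
  have "(\<Sum>\<sigma> | \<sigma> permutes ?I. prod_list (permute_list \<sigma> xs))
    = (\<Sum>\<sigma> | \<sigma> permutes ?I. prod_list (map ((!) xs) (map \<sigma> [0..<length xs])))"
    by (simp add: permute_list_def o_def)
  also have "\<dots> = (\<Sum>l\<in>permutations_of_set ?I. prod_list (map ((!) xs) l))"
    by (rule sum.reindex_bij_betw[OF bij])
  also have "\<dots> = fact (length xs) *\<^sub>R symprod (mset xs)"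
    by (simp add: sum_permutations_eq_symprod_on symprod_on_def mset_eq_image_mset_nth[of xs, symmetric])
  finally show ?thesis by (simp add: symmetrized_product_def)
qed

text \<open>Double counting of a splitting of I with one marked element, which lies in A in the
  first identity and in the complement in the second. Removing it leaves i together with a splitting
  of \<open>I - {i}\<close>.\<close>

lemma sum_Pow_split:
  assumes "finite I"
  shows "(\<Sum>A\<in>Pow I. \<Sum>i\<in>A. g i (A - {i}) (I - A)) = (\<Sum>i\<in>I. \<Sum>A\<in>Pow (I - {i}). g i A (I - {i} - A))"
    and "(\<Sum>A\<in>Pow I. \<Sum>i\<in>I - A. g i A (I - A - {i})) = (\<Sum>i\<in>I. \<Sum>A\<in>Pow (I - {i}). g i A (I - {i} - A))"
proof -
  have fin: "finite A" if "A \<in> Pow I" for A using assms that finite_subset by auto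
  have "(\<Sum>(A, i)\<in>Sigma (Pow I) (\<lambda>A. A). g i (A - {i}) (I - A))
    = (\<Sum>(i, A)\<in>Sigma I (\<lambda>i. Pow (I - {i})). g i A (I - {i} - A))"
    by (rule sum.reindex_bij_witness[of _ "\<lambda>(i, A). (insert i A, i)" "\<lambda>(A, i). (i, A - {i})"])
      (auto simp: insert_absorb intro!: arg_cong[of _ _ "g _ _"])
  then show "(\<Sum>A\<in>Pow I. \<Sum>i\<in>A. g i (A - {i}) (I - A)) = (\<Sum>i\<in>I. \<Sum>A\<in>Pow (I - {i}). g i A (I - {i} - A))"
    using assms fin by (simp add: sum.Sigma)
  have "(\<Sum>(A, i)\<in>Sigma (Pow I) (\<lambda>A. I - A). g i A (I - A - {i}))
    = (\<Sum>(i, A)\<in>Sigma I (\<lambda>i. Pow (I - {i})). g i A (I - {i} - A))"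
    by (rule sum.reindex_bij_witness[of _ "\<lambda>(i, A). (A, i)" "\<lambda>(A, i). (i, A)"])
      (auto intro!: arg_cong[of _ _ "g _ _"])
  then show "(\<Sum>A\<in>Pow I. \<Sum>i\<in>I - A. g i A (I - A - {i})) = (\<Sum>i\<in>I. \<Sum>A\<in>Pow (I - {i}). g i A (I - {i} - A))"
    using assms fin by (simp add: sum.Sigma)
qed

text \<open>Each ordered product splits uniquely into its first \<open>j\<close> factors and the remaining ones.\<close>

lemma symprod_on_split:
  assumes "finite I" "j \<le> card I"
  shows "(\<Sum>A | A \<subseteq> I \<and> card A = j. symprod_on f A * symprod_on f (I - A)) = real (card I choose j) *\<^sub>R symprod_on f I"
  using assms
proof (induction j arbitrary: I)
  case 0
  have "{A. A \<subseteq> I \<and> card A = 0} = {{}}" using 0 by (auto dest: finite_subset)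
  then show ?case by simp
next
  case (Suc j)
  let ?g = "\<lambda>i A B. if card A = j then f i * symprod_on f A * symprod_on f B else 0"
  have fin: "finite A" if "A \<subseteq> I" for A using Suc.prems(1) that finite_subset by blast
  have "real (Suc j) *\<^sub>R (\<Sum>A | A \<subseteq> I \<and> card A = Suc j. symprod_on f A * symprod_on f (I - A))
    = (\<Sum>A | A \<subseteq> I \<and> card A = Suc j. (\<Sum>i\<in>A. f i * symprod_on f (A - {i})) * symprod_on f (I - A))"
    unfolding scaleR_sum_right
  proof (rule sum.cong[OF refl])
    fix A assume "A \<in> {A. A \<subseteq> I \<and> card A = Suc j}"
    then have "finite A" "card A = Suc j" using fin by auto
    then have "(\<Sum>i\<in>A. f i * symprod_on f (A - {i})) = real (Suc j) *\<^sub>R symprod_on f A"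
      using symprod_on_card[of A f] by simp
    then show "real (Suc j) *\<^sub>R (symprod_on f A * symprod_on f (I - A))
      = (\<Sum>i\<in>A. f i * symprod_on f (A - {i})) * symprod_on f (I - A)" by simp
  qed
  also have "\<dots> = (\<Sum>A\<in>Pow I. if card A = Suc j then (\<Sum>i\<in>A. f i * symprod_on f (A - {i})) * symprod_on f (I - A) else 0)"
    using Suc.prems(1) by (subst sum.inter_filter[symmetric]) (auto intro: sum.cong)
  also have "\<dots> = (\<Sum>A\<in>Pow I. \<Sum>i\<in>A. ?g i (A - {i}) (I - A))"
  proof (rule sum.cong[OF refl])
    fix A assume "A \<in> Pow I"
    then have A: "finite A" using fin by blast
    have "card (A - {i}) = j \<longleftrightarrow> card A = Suc j" if "i \<in> A" for i
      using card_Suc_Diff1[OF A that] by auto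
    then show "(if card A = Suc j then (\<Sum>i\<in>A. f i * symprod_on f (A - {i})) * symprod_on f (I - A) else 0)
      = (\<Sum>i\<in>A. ?g i (A - {i}) (I - A))"
      by (simp add: sum_distrib_right)
  qed
  also have "\<dots> = (\<Sum>i\<in>I. \<Sum>A\<in>Pow (I - {i}). ?g i A (I - {i} - A))"
    by (rule sum_Pow_split(1)[OF Suc.prems(1)])
  also have "\<dots> = (\<Sum>i\<in>I. f i * (\<Sum>A | A \<subseteq> I - {i} \<and> card A = j. symprod_on f A * symprod_on f (I - {i} - A)))"
    using Suc.prems(1)
    by (intro sum.cong refl, subst sum.inter_filter[symmetric])
      (auto simp: sum_distrib_left mult.assoc intro: sum.cong)
  also have "\<dots> = (\<Sum>i\<in>I. real (card I - 1 choose j) *\<^sub>R (f i * symprod_on f (I - {i})))"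
    using Suc by (intro sum.cong refl) (simp add: card_Diff_singleton)
  also have "\<dots> = (real (card I - 1 choose j) * real (card I)) *\<^sub>R symprod_on f I"
    using symprod_on_card[OF Suc.prems(1), of f] by (simp flip: scaleR_sum_right scaleR_scaleR)
  also have "real (card I - 1 choose j) * real (card I) = real (Suc j) * real (card I choose Suc j)"
  proof -
    obtain m where "card I = Suc m" using Suc.prems(2) by (cases "card I") auto
    then show ?thesis
      using Suc_times_binomial[of j m] by (metis diff_Suc_1 mult.commute of_nat_mult)
  qed
  finally show ?case by (simp flip: scaleR_scaleR del: of_nat_Suc)
qed

lemma subspace_sum_mset:
  assumes "subspace S"
  shows "(\<And>x. x \<in># M \<Longrightarrow> f x \<in> S) \<Longrightarrow> (\<Sum>x\<in>#M. f x) \<in> S"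
  by (induction M) (simp_all add: subspace_0[OF assms] subspace_add[OF assms])

section \<open>Coproducts and Hopf powers of symmetrised products\<close>

context graded_connected_hopf_algebra
begin

lemma sweedler_primitive:
  assumes "primitive \<Delta> x" "bilin \<beta>"
  shows "sweedler \<beta> x = \<beta> 1 x + \<beta> x 1"
  using assms(1) unfolding sweedler_def primitive_def
  by (simp add: linear_add[OF pair_lift(1)[OF assms(2)]] pair_lift(2)[OF assms(2)])

lemma bilin_translate:
  fixes \<beta> :: "'h \<Rightarrow> 'h \<Rightarrow> 'c::real_vector"
  assumes "bilin \<beta>"
  shows "bilin (\<lambda>y1 y2. \<beta> (x1 * y1) (x2 * y2))"
  by (intro bilinI bilin_comp1[OF assms] bilin_comp2[OF assms] lin_intros)

lemma sweedler_primitive_mult: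
  assumes x: "primitive \<Delta> x" and b: "bilin \<beta>"
  shows "sweedler \<beta> (x * y) = sweedler (\<lambda>y1 y2. \<beta> y1 (x * y2)) y + sweedler (\<lambda>y1 y2. \<beta> (x * y1) y2) y"
proof -
  have "bilin (\<lambda>x1 x2. sweedler (\<lambda>y1 y2. \<beta> (x1 * y1) (x2 * y2)) y)"
    by (intro bilinI linear_sweedler_param bilin_translate b bilin_comp1[OF b] bilin_comp2[OF b] lin_intros)
  then show ?thesis
    by (simp add: sweedler_mult[OF b] sweedler_primitive[OF x])
qed

text \<open>Evaluating the counit on the first factor of \<Delta>(xy) returns xy, and the part of
  \<Delta>(xy) with x in the second factor already accounts for it. The other part is therefore 0,
  and the counit of that part is the counit of xy.\<close>

lemma counit_primitive_mult:
  assumes x: "primitive \<Delta> x"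
  shows "counit (x * y) = 0"
proof -
  have b: "bilin (\<lambda>y z. counit y *\<^sub>R z)" by (intro bilinI lin_intros counit)
  have lx: "linear (\<lambda>y. counit (x * y))"
    by (intro linear_comp[OF counit(1)] lin_intros)
  have b': "bilin (\<lambda>y1 y2. counit (x * y1) *\<^sub>R y2)"
    by (intro bilinI lin_intros lx)
  have "x * y = sweedler (\<lambda>y1 y2. counit y1 *\<^sub>R (x * y2)) y + sweedler (\<lambda>y1 y2. counit (x * y1) *\<^sub>R y2) y"
    using sweedler_counit_left[OF linear_var, of "x * y"] sweedler_primitive_mult[OF x b, of y] by simp
  then have "sweedler (\<lambda>y1 y2. counit (x * y1) *\<^sub>R y2) y = 0"
    using sweedler_counit_left[of "\<lambda>z. x * z" y] by (simp add: lin_intros)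
  then have "0 = counit (sweedler (\<lambda>y1 y2. counit (x * y1) *\<^sub>R y2) y)"
    by (simp add: linear_0[OF counit(1)])
  also have "\<dots> = sweedler (\<lambda>y1 y2. counit y2 *\<^sub>R counit (x * y1)) y"
    by (simp add: sweedler_compose[OF counit(1) b'] linear_scale[OF counit(1)] mult.commute)
  also have "\<dots> = counit (x * y)" by (rule sweedler_counit_right[OF lx])
  finally show ?thesis by simp
qed

text \<open>Normalised symmetric products of primitive elements behave like divided powers.\<close>

lemma sweedler_symprod_on:
  assumes "finite I" "\<And>i. i \<in> I \<Longrightarrow> primitive \<Delta> (f i)" "bilin \<beta>"
  shows "sweedler \<beta> (symprod_on f I) = (\<Sum>A\<in>Pow I. \<beta> (symprod_on f A) (symprod_on f (I - A)))"
  using assms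
proof (induction "card I" arbitrary: I \<beta>)
  case 0
  then show ?case by (simp add: sweedler_1)
next
  case (Suc n)
  note b = Suc.prems(3)
  have lin: "linear (sweedler \<beta>)" using linear_sweedler[OF b linear_var] .
  have fin: "finite A" if "A \<subseteq> I" for A using Suc.prems(1) that finite_subset by blast
  have card: "real (card I) = real (card A) + real (card (I - A))" if "A \<subseteq> I" for A
    using card_Diff_subset[OF fin[OF that] that] card_mono[OF Suc.prems(1) that] by simp
  have "real (card I) *\<^sub>R sweedler \<beta> (symprod_on f I) = (\<Sum>i\<in>I. sweedler \<beta> (f i * symprod_on f (I - {i})))"
    by (simp add: linear_scale[OF lin, symmetric] symprod_on_card[OF Suc.prems(1)] linear_sum[OF lin])
  also have "\<dots> = (\<Sum>i\<in>I. (\<Sum>A\<in>Pow (I - {i}). \<beta> (symprod_on f A) (f i * symprod_on f (I - {i} - A)))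
      + (\<Sum>A\<in>Pow (I - {i}). \<beta> (f i * symprod_on f A) (symprod_on f (I - {i} - A))))"
  proof (rule sum.cong[OF refl])
    fix i assume i: "i \<in> I"
    have c: "n = card (I - {i})" using Suc.hyps(2) Suc.prems(1) i by simp
    have "sweedler \<beta> (f i * symprod_on f (I - {i})) = sweedler (\<lambda>y1 y2. \<beta> y1 (f i * y2)) (symprod_on f (I - {i}))
      + sweedler (\<lambda>y1 y2. \<beta> (f i * y1) y2) (symprod_on f (I - {i}))"
      by (rule sweedler_primitive_mult[OF Suc.prems(2)[OF i] b])
    also have "\<dots> = (\<Sum>A\<in>Pow (I - {i}). \<beta> (symprod_on f A) (f i * symprod_on f (I - {i} - A)))
      + (\<Sum>A\<in>Pow (I - {i}). \<beta> (f i * symprod_on f A) (symprod_on f (I - {i} - A)))"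
    proof (intro arg_cong2[of _ _ _ _ "(+)"])
      show "sweedler (\<lambda>y1 y2. \<beta> y1 (f i * y2)) (symprod_on f (I - {i}))
        = (\<Sum>A\<in>Pow (I - {i}). \<beta> (symprod_on f A) (f i * symprod_on f (I - {i} - A)))"
        by (rule Suc.hyps(1)[OF c])
          (use Suc.prems bilin_translate[OF b, of 1 "f i"] in auto)
      show "sweedler (\<lambda>y1 y2. \<beta> (f i * y1) y2) (symprod_on f (I - {i}))
        = (\<Sum>A\<in>Pow (I - {i}). \<beta> (f i * symprod_on f A) (symprod_on f (I - {i} - A)))"
        by (rule Suc.hyps(1)[OF c])
          (use Suc.prems bilin_translate[OF b, of "f i" 1] in auto)
    qed
    finally show "sweedler \<beta> (f i * symprod_on f (I - {i})) = \<dots>" .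
  qed
  also have "\<dots> = (\<Sum>A\<in>Pow I. \<Sum>i\<in>I - A. \<beta> (symprod_on f A) (f i * symprod_on f (I - A - {i})))
      + (\<Sum>A\<in>Pow I. \<Sum>i\<in>A. \<beta> (f i * symprod_on f (A - {i})) (symprod_on f (I - A)))"
    using sum_Pow_split(1)[OF Suc.prems(1), of "\<lambda>i A B. \<beta> (f i * symprod_on f A) (symprod_on f B)"]
      sum_Pow_split(2)[OF Suc.prems(1), of "\<lambda>i A B. \<beta> (symprod_on f A) (f i * symprod_on f B)"]
    by (simp add: sum.distrib)
  also have "\<dots> = (\<Sum>A\<in>Pow I. \<beta> (symprod_on f A) (real (card (I - A)) *\<^sub>R symprod_on f (I - A)))
      + (\<Sum>A\<in>Pow I. \<beta> (real (card A) *\<^sub>R symprod_on f A) (symprod_on f (I - A)))"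
    using fin Suc.prems(1)
    by (simp add: symprod_on_card linear_sum[OF bilinD(1)[OF b]] linear_sum[OF bilinD(2)[OF b]])
  also have "\<dots> = real (card I) *\<^sub>R (\<Sum>A\<in>Pow I. \<beta> (symprod_on f A) (symprod_on f (I - A)))"
    by (simp add: linear_scale[OF bilinD(1)[OF b]] linear_scale[OF bilinD(2)[OF b]] scaleR_sum_right
        sum.distrib[symmetric] scaleR_add_left[symmetric] card add.commute)
  finally show ?case using Suc.hyps(2) by (metis nat.distinct(1) of_nat_eq_0_iff real_vector.scale_cancel_left)
qed

text \<open>In the step the coproduct runs over subsets A, and the induction hypothesis contributes
  a power of b for the complement. Grouping by the size of A gives the binomial expansion of
  (b+1)^n. For b = 0 the counit vanishes unless I is empty, in agreement with 0^0 = 1.\<close>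

lemma psi_symprod_on:
  assumes "finite I" "\<And>i. i \<in> I \<Longrightarrow> primitive \<Delta> (f i)"
  shows "psi b (symprod_on f I) = (real b ^ card I) *\<^sub>R symprod_on f I"
  using assms
proof (induction b arbitrary: I)
  case 0
  show ?case
  proof (cases "I = {}")
    case False
    have "counit (symprod_on f I) = 0"
    proof -
      have "real (card I) *\<^sub>R counit (symprod_on f I) = (\<Sum>i\<in>I. counit (f i * symprod_on f (I - {i})))"
        using arg_cong[OF symprod_on_card[OF 0(1), of f], of counit]
        by (simp only: linear_scale[OF counit(1)] linear_sum[OF counit(1)])
      also have "\<dots> = 0" using 0(2) by (simp add: counit_primitive_mult)
      finally show ?thesis using False 0(1) by simp
    qed
    then show ?thesis using False 0(1) by (simp add: card_gt_0_iff)
  qed (simp add: counit)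
next
  case (Suc b)
  let ?n = "card I"
  have fin: "finite A" if "A \<subseteq> I" for A using Suc.prems(1) that finite_subset by blast
  have le: "card A \<le> ?n" if "A \<subseteq> I" for A using card_mono[OF Suc.prems(1) that] .
  have "psi (Suc b) (symprod_on f I) = (\<Sum>A\<in>Pow I. symprod_on f A * psi b (symprod_on f (I - A)))"
    using sweedler_symprod_on[OF Suc.prems bilin_psi] by simp
  also have "\<dots> = (\<Sum>A\<in>Pow I. (real b ^ (?n - card A)) *\<^sub>R (symprod_on f A * symprod_on f (I - A)))"
  proof (rule sum.cong[OF refl])
    fix A assume A: "A \<in> Pow I"
    have "psi b (symprod_on f (I - A)) = (real b ^ card (I - A)) *\<^sub>R symprod_on f (I - A)"
      by (rule Suc.IH) (use Suc.prems in auto)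
    then show "symprod_on f A * psi b (symprod_on f (I - A))
      = (real b ^ (?n - card A)) *\<^sub>R (symprod_on f A * symprod_on f (I - A))"
      using A fin by (simp add: card_Diff_subset)
  qed
  also have "\<dots> = (\<Sum>j\<le>?n. \<Sum>A | A \<in> Pow I \<and> card A = j. (real b ^ (?n - card A)) *\<^sub>R (symprod_on f A * symprod_on f (I - A)))"
    by (rule sum.group[symmetric]) (use Suc.prems(1) le in auto)
  also have "\<dots> = (\<Sum>j\<le>?n. (real b ^ (?n - j)) *\<^sub>R (\<Sum>A | A \<subseteq> I \<and> card A = j. symprod_on f A * symprod_on f (I - A)))"
    by (intro sum.cong refl) (simp add: scaleR_sum_right)
  also have "\<dots> = (\<Sum>j\<le>?n. real (?n choose j) * real b ^ (?n - j)) *\<^sub>R symprod_on f I"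
    using Suc.prems(1) by (simp add: symprod_on_split scaleR_sum_left mult.commute)
  also have "(\<Sum>j\<le>?n. real (?n choose j) * real b ^ (?n - j)) = real (Suc b) ^ ?n"
    using binomial_ring[of "1::real" "real b" ?n] by (simp add: add.commute)
  finally show ?case .
qed

text \<open>Since \<open>psi n\<close> acts as n^(card I), the linear coefficient is 1 for one
  factor and 0 for any other number.\<close>

lemma log_id_symprod_on:
  assumes "finite I" "\<And>i. i \<in> I \<Longrightarrow> primitive \<Delta> (f i)"
  shows "log_id (symprod_on f I) = (if card I = 1 then symprod_on f I else 0)"
proof -
  let ?x = "symprod_on f I"
  have "(\<Sum>k | conv_power k ?x \<noteq> 0. coeff (binomial_poly k) 1 *\<^sub>R conv_power k ?x)
    = (\<Sum>i\<in>{()}. coeff (monom 1 (card I)) 1 *\<^sub>R ?x)"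
  proof (rule coeff_1_unique)
    fix n
    have "psi n ?x = (real n ^ card I) *\<^sub>R ?x" by (rule psi_symprod_on[OF assms])
    then show "(\<Sum>k | conv_power k ?x \<noteq> 0. poly (binomial_poly k) (real n) *\<^sub>R conv_power k ?x)
      = (\<Sum>i\<in>{()}. poly (monom 1 (card I)) (real n) *\<^sub>R ?x)"
      by (simp add: psi_eq_sum_choose[OF finite_conv_power_support order_refl] poly_binomial_poly poly_monom)
  qed
  then show ?thesis by (simp add: log_id_def)
qed

lemma symprod_on_singleton [simp]: "symprod_on f {i} = f i"
  using symprod_on_card[of "{i}" f] by simp

lemma symprod_image_eq_symprod_on:
  fixes M :: "'i multiset"
  shows "symprod (image_mset p M) = symprod_on (\<lambda>i. p (list_of_mset M ! i)) {..<size M}"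
proof -
  have "image_mset p M = image_mset p (image_mset ((!) (list_of_mset M)) (mset_set {..<size M}))"
    using mset_eq_image_mset_nth[of "list_of_mset M"] by simp
  then show ?thesis unfolding symprod_on_def by (simp add: multiset.map_comp o_def)
qed

lemma psi_symprod:
  assumes "\<And>x. x \<in># M \<Longrightarrow> primitive \<Delta> (p x)"
  shows "psi b (symprod (image_mset p M)) = (real b ^ size M) *\<^sub>R symprod (image_mset p M)"
  unfolding symprod_image_eq_symprod_on
  by (subst psi_symprod_on) (use assms in \<open>auto simp flip: set_list_of_mset\<close>)

definition derivation :: "('h \<Rightarrow> real) \<Rightarrow> 'h \<Rightarrow> 'h"
  where "derivation \<mu> x = sweedler (\<lambda>y z. \<mu> (log_id y) *\<^sub>R z) x"

lemma linear_derivation: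
  assumes "linear \<mu>"
  shows "linear (derivation \<mu>)"
  unfolding derivation_def[abs_def]
  by (intro linear_sweedler bilinI lin_intros linear_comp[OF assms] linear_log_id)

text \<open>Of all splittings, \<open>log_id\<close> keeps those with exactly one factor on the
  left, and \<mu> keeps those where this factor is x0. So the map acts as the partial derivative in
  x0 does on the monomial M.\<close>

lemma derivation_symprod:
  assumes prim: "\<And>x. x \<in># M \<Longrightarrow> primitive \<Delta> (p x)" and \<mu>: "linear \<mu>"
    and x0: "\<mu> (p x0) = 1" "\<And>x. x \<in># M \<Longrightarrow> x \<noteq> x0 \<Longrightarrow> \<mu> (p x) = 0"
  shows "derivation \<mu> (symprod (image_mset p M)) = real (count M x0) *\<^sub>R symprod (image_mset p (M - {#x0#}))"
proof -
  define xs where "xs = list_of_mset M"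
  let ?I = "{..<size M}" and ?f = "\<lambda>i. p (xs ! i)"
  have M: "M = image_mset ((!) xs) (mset_set ?I)"
    using mset_eq_image_mset_nth[of xs] by (simp add: xs_def)
  have len: "length xs = size M" and set: "set xs = set_mset M" by (simp_all add: xs_def)
  have p: "primitive \<Delta> (?f i)" if "i \<in> ?I" for i using that prim[of "xs ! i"] set len nth_mem[of i xs] by simp
  have b: "bilin (\<lambda>y z. \<mu> (log_id y) *\<^sub>R z)"
    by (intro bilinI lin_intros linear_comp[OF \<mu>] linear_log_id)
  have "derivation \<mu> (symprod (image_mset p M))
    = (\<Sum>A\<in>Pow ?I. \<mu> (log_id (symprod_on ?f A)) *\<^sub>R symprod_on ?f (?I - A))"
    unfolding derivation_def symprod_image_eq_symprod_on xs_def[symmetric]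
    by (rule sweedler_symprod_on[OF _ p b]) simp_all
  also have "\<dots> = (\<Sum>A\<in>(\<lambda>i. {i}) ` ?I. \<mu> (log_id (symprod_on ?f A)) *\<^sub>R symprod_on ?f (?I - A))"
  proof (rule sum.mono_neutral_right)
    show "\<forall>A\<in>Pow ?I - (\<lambda>i. {i}) ` ?I. \<mu> (log_id (symprod_on ?f A)) *\<^sub>R symprod_on ?f (?I - A) = 0"
    proof
      fix A assume A: "A \<in> Pow ?I - (\<lambda>i. {i}) ` ?I"
      then have "card A \<noteq> 1" by (auto simp: card_1_singleton_iff)
      moreover have "finite A" using A by (auto intro: finite_subset)
      ultimately have "log_id (symprod_on ?f A) = 0" using log_id_symprod_on[of A ?f] p A by auto
      then show "\<mu> (log_id (symprod_on ?f A)) *\<^sub>R symprod_on ?f (?I - A) = 0" by (simp add: linear_0[OF \<mu>])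
    qed
  qed auto
  also have "\<dots> = (\<Sum>i\<in>?I. \<mu> (?f i) *\<^sub>R symprod_on ?f (?I - {i}))"
    using log_id_symprod_on[of "{_}" ?f] p by (simp add: sum.reindex)
  also have "\<dots> = (\<Sum>i\<in>?I. (if xs ! i = x0 then 1 else 0) *\<^sub>R symprod (image_mset p (M - {#x0#})))"
  proof (rule sum.cong[OF refl])
    fix i assume i: "i \<in> ?I"
    have "xs ! i \<in># M" using i set len nth_mem[of i xs] by simp
    then have "\<mu> (?f i) = (if xs ! i = x0 then 1 else 0)" using x0 by auto
    moreover have "symprod_on ?f (?I - {i}) = symprod (image_mset p (M - {#xs ! i#}))"
    proof -
      have "M - {#xs ! i#} = image_mset ((!) xs) (mset_set (?I - {i}))"
        using i by (subst M) (simp add: mset_set_Diff image_mset_Diff)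
      then show ?thesis by (simp add: symprod_on_def multiset.map_comp o_def)
    qed
    ultimately show "\<mu> (?f i) *\<^sub>R symprod_on ?f (?I - {i})
      = (if xs ! i = x0 then 1 else 0) *\<^sub>R symprod (image_mset p (M - {#x0#}))" by simp
  qed
  also have "\<dots> = real (card {i \<in> ?I. xs ! i = x0}) *\<^sub>R symprod (image_mset p (M - {#x0#}))"
    by (simp add: scaleR_sum_left[symmetric] sum.If_cases Int_def)
  also have "card {i \<in> ?I. xs ! i = x0} = count M x0"
    by (subst M) (simp add: count_image_mset Int_def vimage_def conj_commute)
  finally show ?thesis .
qed

text \<open>Induction on a bound for the sizes of the multisets. Differentiating a relation in
  direction x0 lowers the sizes, and removing x0 is injective on the multisets containing it, so the
  coefficients of all these vanish. Only the empty multiset, with value 1, remains.\<close>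

lemma independent_symprod:
  assumes prim: "\<And>x. x \<in> X \<Longrightarrow> primitive \<Delta> (p x)"
    and ind: "inj_on p X \<and> independent (p ` X)"
  shows "inj_on (\<lambda>M. symprod (image_mset p M)) {M. set_mset M \<subseteq> X}
    \<and> independent ((\<lambda>M. symprod (image_mset p M)) ` {M. set_mset M \<subseteq> X})"
proof -
  let ?s = "\<lambda>M. symprod (image_mset p M)"
  have main: "\<forall>M\<in>F. c M = 0"
    if "finite F" "\<And>M. M \<in> F \<Longrightarrow> set_mset M \<subseteq> X \<and> size M < n" "(\<Sum>M\<in>F. c M *\<^sub>R ?s M) = 0" for n F c
    using that
  proof (induction n arbitrary: F c)
    case (Suc n)
    have nonempty: "c M0 = 0" if M0: "M0 \<in> F" "x0 \<in># M0" for M0 x0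
    proof -
      have x0: "x0 \<in> X" using M0 Suc.prems(2) by blast
      \<comment> \<open>Independence of the primitive elements supplies a functional dual to
        \<open>p x0\<close>.\<close>
      obtain \<mu> :: "'h \<Rightarrow> real" where \<mu>: "linear \<mu>" "\<forall>v\<in>p ` X. \<mu> v = (if v = p x0 then 1 else 0)"
        using linear_independent_extend[of "p ` X" "\<lambda>v. if v = p x0 then 1 else 0"] ind by blast
      let ?F = "{M \<in> F. x0 \<in># M}"
      have inj: "inj_on (\<lambda>M. M - {#x0#}) ?F"
        by (rule inj_onI) (metis (no_types, lifting) insert_DiffM mem_Collect_eq)
      have "0 = derivation \<mu> (\<Sum>M\<in>F. c M *\<^sub>R ?s M)"
        by (simp add: Suc.prems(3) linear_0[OF linear_derivation[OF \<mu>(1)]])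
      also have "\<dots> = (\<Sum>M\<in>F. (c M * real (count M x0)) *\<^sub>R ?s (M - {#x0#}))"
      proof -
        have "derivation \<mu> (?s M) = real (count M x0) *\<^sub>R ?s (M - {#x0#})" if "M \<in> F" for M
        proof (rule derivation_symprod[OF _ \<mu>(1)])
          show "primitive \<Delta> (p x)" if "x \<in># M" for x using that \<open>M \<in> F\<close> Suc.prems(2) prim by blast
          show "\<mu> (p x0) = 1" using \<mu>(2) x0 by simp
          show "\<mu> (p x) = 0" if "x \<in># M" "x \<noteq> x0" for x
          proof -
            have "x \<in> X" using that \<open>M \<in> F\<close> Suc.prems(2) by blast
            moreover have "p x \<noteq> p x0" using ind \<open>x \<in> X\<close> x0 that(2) by (meson inj_onD)
            ultimately show ?thesis using \<mu>(2) by simp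
          qed
        qed
        then show ?thesis
          by (simp add: linear_sum[OF linear_derivation[OF \<mu>(1)]] linear_scale[OF linear_derivation[OF \<mu>(1)]])
      qed
      also have "\<dots> = (\<Sum>M\<in>?F. (c M * real (count M x0)) *\<^sub>R ?s (M - {#x0#}))"
        by (rule sum.mono_neutral_right) (auto simp: Suc.prems(1) not_in_iff)
      also have "\<dots> = (\<Sum>N\<in>(\<lambda>M. M - {#x0#}) ` ?F. (c (add_mset x0 N) * real (count (add_mset x0 N) x0)) *\<^sub>R ?s N)"
        by (simp add: sum.reindex[OF inj])
      finally have z: "\<forall>N\<in>(\<lambda>M. M - {#x0#}) ` ?F. c (add_mset x0 N) * real (count (add_mset x0 N) x0) = 0"
      proof (intro Suc.IH)
        show "finite ((\<lambda>M. M - {#x0#}) ` ?F)" using Suc.prems(1) by simp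
        fix N assume "N \<in> (\<lambda>M. M - {#x0#}) ` ?F"
        then obtain M where M: "M \<in> F" "x0 \<in># M" "N = M - {#x0#}" by blast
        have "size N < size M" using M size_Diff1_less by metis
        then show "set_mset N \<subseteq> X \<and> size N < n"
          using Suc.prems(2)[OF M(1)] M(3) in_diffD by fastforce
      qed simp
      have "M0 - {#x0#} \<in> (\<lambda>M. M - {#x0#}) ` ?F" using M0 by blast
      from bspec[OF z this] show ?thesis using M0(2) by (simp add: count_eq_zero_iff)
    qed
    then have nonempty': "c M = 0" if "M \<in> F" "M \<noteq> {#}" for M
      using that by (metis multiset_nonemptyE)
    have "c {#} = 0" if "{#} \<in> F"
    proof -
      have "(\<Sum>M\<in>F. c M *\<^sub>R ?s M) = (\<Sum>M\<in>{{#}}. c M *\<^sub>R ?s M)"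
        by (rule sum.mono_neutral_right) (use that Suc.prems(1) nonempty' in auto)
      then show ?thesis using Suc.prems(3) by simp
    qed
    then show ?case using nonempty' by metis
  qed auto
  show ?thesis
    unfolding independent_family_iff
  proof (intro allI impI)
    fix F c assume F: "finite F \<and> F \<subseteq> {M. set_mset M \<subseteq> X} \<and> (\<Sum>M\<in>F. c M *\<^sub>R ?s M) = 0"
    show "\<forall>M\<in>F. c M = 0"
    proof (rule main)
      show "set_mset M \<subseteq> X \<and> size M < Suc (Max (size ` F))" if "M \<in> F" for M
        using F that by (auto simp: less_Suc_eq_le)
    qed (use F in auto)
  qed
qed

lemma symprod_in_H:
  assumes "\<And>x. x \<in># M \<Longrightarrow> p x \<in> H (d x)"
  shows "symprod (image_mset p M) \<in> H (\<Sum>x\<in>#M. d x)"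
  using assms
proof (induction "size M" arbitrary: M)
  case 0
  then show ?case by (simp add: one_in_H0)
next
  case (Suc n)
  have "p x * symprod (image_mset p M - {#p x#}) \<in> H (\<Sum>x\<in>#M. d x)" if x: "x \<in># M" for x
  proof -
    have "symprod (image_mset p (M - {#x#})) \<in> H (\<Sum>x\<in>#M - {#x#}. d x)"
      by (rule Suc.hyps(1)) (use Suc.hyps(2) Suc.prems x in \<open>auto simp: size_Diff_singleton dest: in_diffD\<close>)
    moreover have "(\<Sum>x\<in>#M. d x) = d x + (\<Sum>x\<in>#M - {#x#}. d x)"
      using x by (metis image_mset_add_mset insert_DiffM sum_mset.insert)
    ultimately show ?thesis
      using mult_H[OF Suc.prems[OF x]] x by (simp add: image_mset_Diff)
  qed
  then have "(\<Sum>x\<in>#M. p x * symprod (image_mset p M - {#p x#})) \<in> H (\<Sum>x\<in>#M. d x)"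
    by (rule subspace_sum_mset[OF subspace_H])
  moreover have "M \<noteq> {#}" using Suc.hyps(2) by auto
  ultimately show ?case
    using symprod_step[of "image_mset p M"] by (simp add: multiset.map_comp o_def subspace_scale[OF subspace_H])
qed

text \<open>In degree 0 an element is its counit times 1, and the counit of a primitive element is
  0. A homogeneous primitive basis therefore has the positive degrees that the multiplicity series
  requires.\<close>

lemma primitive_positive:
  assumes "primitive \<Delta> x" "x \<in> H n" "x \<noteq> 0"
  shows "1 \<le> n"
proof (rule ccontr)
  assume "\<not> 1 \<le> n"
  then have "n = 0" by simp
  then have "x = counit x *\<^sub>R 1" using H0_eq assms(2) by blast
  moreover have "counit x = 0" using counit_primitive_mult[OF assms(1), of 1] by simp
  ultimately show False using assms(3) by simp
qed

lemma primitive_commutator: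
  assumes "primitive \<Delta> x" "primitive \<Delta> y"
  shows "primitive \<Delta> (x * y - y * x)"
proof -
  note t = linear_add[OF tensor_times(1)] linear_add[OF tensor_times(2)] tensor_times(3)
  note l1 = linear_diff[OF linear_pure_tensor1[OF linear_var]]
    and l2 = linear_diff[OF linear_pure_tensor2[OF linear_var]]
  show ?thesis
    using assms unfolding primitive_def
    by (simp add: linear_diff[OF linear_coprod] coprod_mult t l1 l2)
qed

text \<open>The filtration by the number of primitive factors, with strict bound n. Modulo this
  space the order of n primitive factors is immaterial.\<close>

definition short_products :: "nat \<Rightarrow> 'h set"
  where "short_products n = span {prod_list qs |qs. (\<forall>q\<in>set qs. primitive \<Delta> q) \<and> length qs < n}"

lemma short_products_mult:
  assumes "primitive \<Delta> x" "y \<in> short_products n"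
  shows "x * y \<in> short_products (Suc n)"
  unfolding short_products_def
proof (rule span_mult[OF span_base[of x "{x}"] assms(2)[unfolded short_products_def]])
  fix a b assume a: "a \<in> {x}" and "b \<in> {prod_list qs |qs. (\<forall>q\<in>set qs. primitive \<Delta> q) \<and> length qs < n}"
  then obtain qs where "b = prod_list qs" "\<forall>q\<in>set qs. primitive \<Delta> q" "length qs < n" by blast
  then show "a * b \<in> span {prod_list qs |qs. (\<forall>q\<in>set qs. primitive \<Delta> q) \<and> length qs < Suc n}"
    using assms(1) a by (intro span_base CollectI exI[of _ "x # qs"]) simp
qed simp

lemma short_products_subspace: "subspace (short_products n)"
  by (simp add: short_products_def)

lemma prod_list_in_short_products:
  "(\<And>q. q \<in> set qs \<Longrightarrow> primitive \<Delta> q) \<Longrightarrow> length qs < n \<Longrightarrow> prod_list qs \<in> short_products n"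
  unfolding short_products_def by (rule span_base) auto

text \<open>Each exchange of x with a neighbour u costs a product in which both are replaced by
  their commutator, a single primitive factor.\<close>

lemma move_factor:
  assumes "primitive \<Delta> x" "\<And>u. u \<in> set us \<union> set vs \<Longrightarrow> primitive \<Delta> u"
  shows "x * prod_list (us @ vs) - prod_list (us @ x # vs) \<in> short_products (Suc (length us + length vs))"
  using assms(2)
proof (induction us)
  case Nil
  then show ?case by (simp add: subspace_0[OF short_products_subspace])
next
  case (Cons u us)
  have "prod_list ((x * u - u * x) # us @ vs) \<in> short_products (Suc (length (u # us) + length vs))"
    by (rule prod_list_in_short_products) (use Cons.prems assms(1) primitive_commutator in auto)
  moreover have "u * (x * prod_list (us @ vs) - prod_list (us @ x # vs))
      \<in> short_products (Suc (length (u # us) + length vs))"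
    using short_products_mult[OF _ Cons.IH] Cons.prems by simp
  ultimately have "prod_list ((x * u - u * x) # us @ vs) + u * (x * prod_list (us @ vs) - prod_list (us @ x # vs))
      \<in> short_products (Suc (length (u # us) + length vs))"
    by (rule subspace_add[OF short_products_subspace])
  then show ?case by (simp add: algebra_simps)
qed

lemma prod_list_permuted:
  "mset xs = mset ys \<Longrightarrow> (\<And>x. x \<in> set xs \<Longrightarrow> primitive \<Delta> x)
    \<Longrightarrow> prod_list xs - prod_list ys \<in> short_products (length xs)"
proof (induction xs arbitrary: ys)
  case Nil
  then show ?case by (simp add: subspace_0[OF short_products_subspace])
next
  case (Cons x xs)
  have "x \<in> set ys" using Cons.prems(1) by (metis list.set_intros(1) set_mset_mset)
  then obtain us vs where ys: "ys = us @ x # vs" by (meson split_list)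
  have ms: "mset xs = mset (us @ vs)" using Cons.prems(1) ys by simp
  then have set: "set xs = set us \<union> set vs" and len: "length xs = length us + length vs"
    using mset_eq_setD[OF ms] mset_eq_length[OF ms] by simp_all
  have "x * (prod_list xs - prod_list (us @ vs)) \<in> short_products (Suc (length xs))"
    by (intro short_products_mult Cons.IH ms) (use Cons.prems in auto)
  moreover have "x * prod_list (us @ vs) - prod_list ys \<in> short_products (Suc (length xs))"
    unfolding ys len by (rule move_factor) (use Cons.prems set in auto)
  ultimately have "x * (prod_list xs - prod_list (us @ vs)) + (x * prod_list (us @ vs) - prod_list ys)
      \<in> short_products (Suc (length xs))"
    by (rule subspace_add[OF short_products_subspace])
  then show ?case by (simp add: algebra_simps)
qed

text \<open>The recursion for \<open>symprod\<close> averages over the choice of first factor. By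
  induction and \<open>prod_list_permuted\<close>, each choice gives \<open>prod_list xs\<close> up
  to fewer factors.\<close>

lemma prod_list_minus_symprod:
  "(\<And>x. x \<in> set xs \<Longrightarrow> primitive \<Delta> x) \<Longrightarrow> prod_list xs - symprod (mset xs) \<in> short_products (length xs)"
proof (induction "length xs" arbitrary: xs)
  case 0
  then show ?case by (simp add: subspace_0[OF short_products_subspace])
next
  case (Suc n)
  let ?S = "short_products (Suc n)"
  note S = short_products_subspace[of "Suc n"]
  have "x * symprod (mset xs - {#x#}) - prod_list xs \<in> ?S" if x: "x \<in># mset xs" for x
  proof -
    define ys where "ys = remove1 x xs"
    have ys: "mset ys = mset xs - {#x#}" "length ys = n" "set ys \<subseteq> set xs"
      using x Suc.hyps(2) by (auto simp: ys_def length_remove1 set_remove1_subset)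
    have "prod_list ys - symprod (mset ys) \<in> short_products (length ys)"
      by (rule Suc.hyps(1)) (use ys Suc.prems in auto)
    then have 1: "x * (prod_list ys - symprod (mset ys)) \<in> ?S"
      using short_products_mult[of x] Suc.prems x ys(2) by simp
    have "prod_list (x # ys) - prod_list xs \<in> short_products (length (x # ys))"
      by (rule prod_list_permuted) (use x ys Suc.prems in auto)
    then have "prod_list (x # ys) - prod_list xs \<in> ?S" using ys(2) by simp
    from subspace_diff[OF S this 1] show ?thesis by (simp add: algebra_simps ys(1))
  qed
  then have "(\<Sum>x\<in>#mset xs. x * symprod (mset xs - {#x#}) - prod_list xs) \<in> ?S"
    by (rule subspace_sum_mset[OF S])
  also have "(\<Sum>x\<in>#mset xs. x * symprod (mset xs - {#x#}) - prod_list xs)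
    = (\<Sum>x\<in>#mset xs. x * symprod (mset xs - {#x#})) - real (length xs) *\<^sub>R prod_list xs"
  proof -
    have "(\<Sum>x\<in>#N. g x - c) = (\<Sum>x\<in>#N. g x) - real (size N) *\<^sub>R c" for N and g :: "'h \<Rightarrow> 'h" and c
      by (induction N) (simp_all add: algebra_simps)
    then show ?thesis by simp
  qed
  finally have "(- 1 / real (length xs)) *\<^sub>R ((\<Sum>x\<in>#mset xs. x * symprod (mset xs - {#x#}))
      - real (length xs) *\<^sub>R prod_list xs) \<in> ?S"
    by (rule subspace_scale[OF S])
  moreover have "mset xs \<noteq> {#}" using Suc.hyps(2) by auto
  from symprod_step[OF this] have "symprod (mset xs) = (1 / real (length xs)) *\<^sub>R
      (\<Sum>x\<in>#mset xs. x * symprod (mset xs - {#x#}))" by simp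
  moreover have "xs \<noteq> []" using Suc.hyps(2) by auto
  ultimately show ?case using Suc.hyps(2) by (simp add: algebra_simps)
qed

text \<open>Induction on the number of factors: expand each factor in P, keeping the length, and
  replace the resulting product by its symmetrisation; the error consists of shorter products of
  primitive elements.\<close>

lemma primitive_products_span:
  assumes P: "span P = {x. primitive \<Delta> x}"
  shows "(\<And>x. x \<in> set ps \<Longrightarrow> primitive \<Delta> x) \<Longrightarrow> prod_list ps \<in> span (symprod ` {M. set_mset M \<subseteq> P})"
proof (induction "length ps" arbitrary: ps rule: less_induct)
  case less
  let ?W = "span (symprod ` {M. set_mset M \<subseteq> P})"
  have short: "short_products (length ps) \<subseteq> ?W"
    unfolding short_products_def by (rule span_minimal) (use less.hyps in auto)
  have "prod_list ps \<in> span {prod_list qs |qs. set qs \<subseteq> P \<and> length qs = length ps}"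
    using less.prems
  proof (induction ps)
    case Nil
    then show ?case by (intro span_base) auto
  next
    case (Cons p ps)
    let ?B = "{prod_list qs |qs. set qs \<subseteq> P \<and> length qs = length ps}"
      and ?C = "{prod_list qs |qs. set qs \<subseteq> P \<and> length qs = length (p # ps)}"
    have "p * prod_list ps \<in> span ?C"
    proof (rule span_mult[of p P _ ?B])
      show "p \<in> span P" using Cons.prems P by simp
      show "prod_list ps \<in> span ?B" using Cons by simp
      fix q y assume "q \<in> P" "y \<in> ?B"
      then obtain qs where "y = prod_list qs" "set qs \<subseteq> P" "length qs = length ps" by blast
      then show "q * y \<in> span ?C" using \<open>q \<in> P\<close> by (intro span_base CollectI exI[of _ "q # qs"]) simp
    qed
    then show ?case by simp
  qed
  also have "span {prod_list qs |qs. set qs \<subseteq> P \<and> length qs = length ps} \<subseteq> ?W"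
  proof (rule span_minimal)
    show "{prod_list qs |qs. set qs \<subseteq> P \<and> length qs = length ps} \<subseteq> ?W"
    proof clarify
      fix qs assume qs: "set qs \<subseteq> P" "length qs = length ps"
      have "primitive \<Delta> q" if "q \<in> set qs" for q using that qs(1) P span_base by blast
      then have "prod_list qs - symprod (mset qs) \<in> ?W"
        using prod_list_minus_symprod[of qs] qs(2) short by auto
      moreover have "symprod (mset qs) \<in> ?W" by (rule span_base) (use qs in auto)
      ultimately have "(prod_list qs - symprod (mset qs)) + symprod (mset qs) \<in> ?W" by (rule span_add)
      then show "prod_list qs \<in> ?W" by simp
    qed
  qed simp
  finally show ?case .
qed

text \<open>All homogeneous elements of positive degree generate, hence so do their images under
  \<open>log_id\<close>, which are primitive by cocommutativity.\<close>

lemma cocommutative_span_symprod: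
  assumes cocomm: "cocommutative \<Delta>" and P: "span P = {x. primitive \<Delta> x}"
  shows "span (symprod ` {M. set_mset M \<subseteq> P}) = UNIV"
proof -
  \<comment> \<open>Pairs let each generator carry its degree, since the zero vector lies in every
    \<open>H n\<close>.\<close>
  let ?X = "{(n, x). 1 \<le> n \<and> x \<in> H n}"
  have "span ((\<lambda>xs. prod_list (map (\<lambda>x. log_id (snd x)) xs)) ` lists ?X) = UNIV"
  proof (rule log_id_generates[where d = fst])
    show "snd x \<in> H (fst x) \<and> 1 \<le> fst x" if "x \<in> ?X" for x using that by auto
    have "H n \<subseteq> span ((\<lambda>xs. prod_list (map snd xs)) ` lists ?X)" for n
    proof
      fix x assume x: "x \<in> H n"
      show "x \<in> span ((\<lambda>xs. prod_list (map snd xs)) ` lists ?X)"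
      proof (cases "n = 0")
        case True
        have "1 \<in> (\<lambda>xs. prod_list (map snd xs)) ` lists ?X"
          by (rule image_eqI[of _ _ "[]"]) auto
        then have "{1} \<subseteq> (\<lambda>xs. prod_list (map snd xs)) ` lists ?X" by blast
        from span_mono[OF this] show ?thesis using x True H_0 by blast
      next
        case False
        then show ?thesis using x by (intro span_base image_eqI[of _ _ "[(n, x)]"]) auto
      qed
    qed
    then have "span (\<Union>n. H n) \<subseteq> span ((\<lambda>xs. prod_list (map snd xs)) ` lists ?X)"
      by (intro span_minimal) auto
    then show "span ((\<lambda>xs. prod_list (map snd xs)) ` lists ?X) = UNIV" using span_H by auto
  qed
  moreover have "span ((\<lambda>xs. prod_list (map (\<lambda>x. log_id (snd x)) xs)) ` lists ?X)
      \<subseteq> span (symprod ` {M. set_mset M \<subseteq> P})"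
  proof (rule span_minimal)
    show "(\<lambda>xs. prod_list (map (\<lambda>x. log_id (snd x)) xs)) ` lists ?X \<subseteq> span (symprod ` {M. set_mset M \<subseteq> P})"
    proof (rule image_subsetI)
      fix xs assume xs: "xs \<in> lists ?X"
      have "primitive \<Delta> (log_id (snd x))" if "x \<in> set xs" for x
      proof -
        have "snd x \<in> H (fst x)" using xs that by auto
        then show ?thesis by (rule primitive_log_id[OF cocomm])
      qed
      then show "prod_list (map (\<lambda>x. log_id (snd x)) xs) \<in> span (symprod ` {M. set_mset M \<subseteq> P})"
        by (intro primitive_products_span[OF P]) auto
    qed
  qed simp
  ultimately show ?thesis by auto
qed

end

context finite_type_hopf_algebra
begin

lemma primitive_eigenbasis:
  assumes p: "\<And>x. x \<in> X \<Longrightarrow> primitive \<Delta> (p x) \<and> p x \<in> H (d x) \<and> 1 \<le> d x"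
    and basis: "is_basis_family {M. set_mset M \<subseteq> X} (\<lambda>M. symprod (image_mset p M))" and a: "a \<ge> 2"
  shows "\<And>M. set_mset M \<subseteq> X \<Longrightarrow> psi a (symprod (image_mset p M)) = (real a ^ size M) *\<^sub>R symprod (image_mset p M)"
    and "multiplicities_given_by H \<Delta> a X d"
proof -
  show eig: "psi a (symprod (image_mset p M)) = (real a ^ size M) *\<^sub>R symprod (image_mset p M)"
    if "set_mset M \<subseteq> X" for M
    by (rule psi_symprod) (use p that in auto)
  show "multiplicities_given_by H \<Delta> a X d"
    by (rule multiplicities_of_multiset_basis[OF _ basis _ eig a])
      (use p in \<open>auto intro!: symprod_in_H\<close>)
qed

end


section \<open>Lyndon words\<close>

lemma append_less_cancel [simp]: "u @ x < u @ y \<longleftrightarrow> x < (y :: 'a::linorder list)"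
  by (induction u) auto

lemma append_le_cancel [simp]: "u @ x \<le> u @ y \<longleftrightarrow> x \<le> (y :: 'a::linorder list)"
  by (induction u) auto

lemma le_append: "x \<le> x @ (y :: 'a::linorder list)"
  by (induction x) auto

text \<open>A strict inequality is either decided at a differing letter, and then survives all
  continuations, or x is a prefix of y.\<close>

lemma less_prefix_or: "x < (y :: 'a::linorder list) \<Longrightarrow> prefix x y \<or> x @ u < y @ v"
proof (induction x arbitrary: y)
  case (Cons a x)
  then obtain b y' where "y = b # y'" by (cases y) auto
  then show ?case using Cons by auto
qed simp

lemma less_append_same_length:
  "length x = length y \<Longrightarrow> x < (y :: 'a::linorder list) \<Longrightarrow> x @ u < y @ v"
  using less_prefix_or[of x y u v] by (auto simp: prefix_def)

lemma append_le_same_length: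
  "length x = length y \<Longrightarrow> x \<le> (y :: 'a::linorder list) \<Longrightarrow> u \<le> v \<Longrightarrow> x @ u \<le> y @ v"
  using less_append_same_length[of x y u v] by (metis append_le_cancel order.order_iff_strict)

lemma lyndon_rotate: "lyndon (x @ y) \<Longrightarrow> x \<noteq> [] \<Longrightarrow> y \<noteq> [] \<Longrightarrow> x @ y < y @ x"
  unfolding lyndon_def by (metis add_less_same_cancel1 length_append length_greater_0_conv less_add_same_cancel1 rotate_append)

text \<open>Passage from rotations to tails. If y were smaller than xy, comparison with the rotation
  yx would make y a prefix, xy = yz. The rotation yx then gives z < x, while the rotation zy gives x
  < z.\<close>

lemma lyndon_less_suffix:
  assumes "lyndon (x @ y)" "x \<noteq> []" "y \<noteq> []"
  shows "x @ y < y"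
proof (rule ccontr)
  assume "\<not> x @ y < y"
  moreover have "x @ y \<noteq> y" using assms(2) by simp
  ultimately have "y < x @ y" by (metis linorder_neqE)
  moreover have r: "x @ y < y @ x" by (rule lyndon_rotate[OF assms])
  ultimately have "prefix y (x @ y)"
    using less_prefix_or[of y "x @ y" x "[]"] by auto
  then obtain z where z: "x @ y = y @ z" by (auto simp: prefix_def)
  have len: "length z = length x" using arg_cong[OF z, of length] by simp
  have "z < x" using r unfolding z by simp
  moreover have "z \<noteq> []" using len assms(2) by auto
  then have "y @ z < z @ y" using lyndon_rotate[of y z] assms(1,3) z by simp
  then have "x @ y < z @ y" using z by simp
  then have "x < z" using less_append_same_length[of z x y y] len
    by (metis less_asym linorder_less_linear order_less_irrefl)
  ultimately show False by simp
qed

lemma lyndonI: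
  assumes "w \<noteq> []" "\<And>x y. w = x @ y \<Longrightarrow> x \<noteq> [] \<Longrightarrow> y \<noteq> [] \<Longrightarrow> w < y"
  shows "lyndon w"
proof (rule lyndon_if_smallest_tail[OF assms(1)])
  note t = smallest_tail[OF assms(1)]
  obtain x where x: "w = x @ smallest_tail w" using t(2) by (auto simp: suffix_def)
  have "smallest_tail w \<le> w" using t(3)[of w] assms(1) by simp
  then have "x = []" using assms(2)[OF x _ t(1)] by (metis leD)
  then show "smallest_tail w = w" using x by simp
qed

lemma lyndon_nonempty: "lyndon w \<Longrightarrow> w \<noteq> []"
  by (simp add: lyndon_def)

lemma lyndon_singleton: "lyndon [a]"
  by (rule lyndonI) (auto simp: Cons_eq_append_conv)

lemma lyndon_append_less:
  assumes "lyndon x" "lyndon y" "x < y"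
  shows "x @ y < y"
proof (cases "prefix x y")
  case True
  then obtain z where z: "y = x @ z" by (auto simp: prefix_def)
  then have "z \<noteq> []" using assms(3) by auto
  then have "y < z" using lyndon_less_suffix[of x z] assms lyndon_nonempty z by blast
  then show ?thesis using z by (metis append_less_cancel)
next
  case False
  then show ?thesis using less_prefix_or[OF assms(3), of y "[]"] by simp
qed

text \<open>A proper tail of xy is either a tail of y, hence at least y, or cy with c a proper tail
  of x. In the second case x < c is decided at a differing letter, because c is shorter than
  x.\<close>

lemma lyndon_append:
  assumes "lyndon x" "lyndon y" "x < y"
  shows "lyndon (x @ y)"
proof (rule lyndonI)
  show "x @ y \<noteq> []" using lyndon_nonempty[OF assms(1)] by simp
  fix a b assume ab: "x @ y = a @ b" "a \<noteq> []" "b \<noteq> []"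
  then obtain d where "x @ d = a \<and> y = d @ b \<or> x = a @ d \<and> d @ y = b"
    unfolding append_eq_append_conv2 by blast
  then consider c where "a = x @ c" "y = c @ b" | c where "x = a @ c" "b = c @ y" "c \<noteq> []"
    by (cases "d = []") auto
  then show "x @ y < b"
  proof cases
    case 1
    have "y \<le> b"
      using lyndon_less_suffix[of c b] assms(2) 1 ab(3) by (cases "c = []") auto
    then show ?thesis using lyndon_append_less[OF assms] by simp
  next
    case 2
    have "x < c" using lyndon_less_suffix[of a c] assms(1) 2 ab(2) by simp
    moreover have "\<not> prefix x c" using 2(1) ab(2) by (auto dest: prefix_length_le)
    ultimately show ?thesis using less_prefix_or[of x c y y] 2(2) by simp
  qed
qed

lemma lyndon_commute: "lyndon x \<Longrightarrow> lyndon y \<Longrightarrow> x < y \<Longrightarrow> x @ y < y @ x"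
  using lyndon_rotate[OF lyndon_append] lyndon_nonempty by blast

section \<open>Existence and uniqueness of the Lyndon factorisation\<close>

definition lyndon_seq :: "'l::linorder list list \<Rightarrow> bool"
  where "lyndon_seq us \<longleftrightarrow> (\<forall>u\<in>set us. lyndon u) \<and> sorted_wrt (\<ge>) us"

text \<open>A tail t starts inside some factor u, so it begins with a nonempty tail s of u, and
  \<open>last us \<le> u \<le> s \<le> t\<close>.\<close>

lemma lyndon_seq_tail_ge:
  "lyndon_seq us \<Longrightarrow> t \<noteq> [] \<Longrightarrow> suffix t (concat us) \<Longrightarrow> us \<noteq> [] \<and> last us \<le> t"
proof (induction us)
  case (Cons u us)
  have seq: "lyndon_seq us" using Cons.prems(1) by (simp add: lyndon_seq_def)
  from Cons.prems(3) consider "suffix t (concat us)" | s where "t = s @ concat us" "suffix s u"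
    by (auto simp: suffix_append)
  then show ?case
  proof cases
    case 1
    then show ?thesis using Cons.IH[OF seq Cons.prems(2)] by auto
  next
    case 2
    show ?thesis
    proof (cases "s = []")
      case True
      then show ?thesis using Cons.IH[OF seq Cons.prems(2)] 2 by auto
    next
      case False
      obtain r where r: "u = r @ s" using 2(2) by (auto simp: suffix_def)
      have "u \<le> s"
        using lyndon_less_suffix[of r s] Cons.prems(1) r False
        by (cases "r = []") (auto simp: lyndon_seq_def)
      also have "s \<le> t" using 2(1) le_append by simp
      finally have "u \<le> t" .
      moreover have "last (u # us) \<le> u"
        using Cons.prems(1) by (auto simp: lyndon_seq_def)
      ultimately show ?thesis by (simp del: last.simps)
    qed
  qed
qed simp

lemma smallest_tail_concat:
  assumes "lyndon_seq us" "us \<noteq> []"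
  shows "smallest_tail (concat us) = last us"
proof -
  have last: "last us \<noteq> []" using assms lyndon_nonempty last_in_set by (metis lyndon_seq_def)
  have suf: "suffix (last us) (concat us)"
    using assms(2) by (induction us rule: rev_induct) (auto simp: suffix_def)
  have ne: "concat us \<noteq> []" using last suf by (metis suffix_Nil)
  show ?thesis
    using lyndon_seq_tail_ge[OF assms(1) smallest_tail(1,2)[OF ne]] smallest_tail(3)[OF ne last suf] by simp
qed

lemma lyndon_factorisation_concat:
  "lyndon_seq us \<Longrightarrow> lyndon_factorisation (concat us) = us"
proof (induction us rule: rev_induct)
  case (snoc u us)
  have seq: "lyndon_seq us" using snoc.prems by (simp add: lyndon_seq_def sorted_wrt_append)
  have "smallest_tail (concat (us @ [u])) = u" using smallest_tail_concat[OF snoc.prems] by simp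
  moreover have "concat (us @ [u]) \<noteq> []"
    using snoc.prems lyndon_nonempty by (auto simp: lyndon_seq_def)
  ultimately show ?case
    using snoc.IH[OF seq] by (subst lyndon_factorisation.simps) simp
qed (simp add: lyndon_factorisation.simps)

text \<open>The smallest tail u is Lyndon because its tails are tails of w. The preceding factor l
  cannot be smaller than u, since then the tail lu would be smaller than u.\<close>

lemma lyndon_seq_factorisation: "lyndon_seq (lyndon_factorisation w)"
proof (induction w rule: lyndon_factorisation.induct)
  case (1 w)
  show ?case
  proof (cases "w = []")
    case True
    then show ?thesis by (simp add: lyndon_factorisation.simps lyndon_seq_def)
  next
    case False
    note t = smallest_tail[OF False]
    define u where "u = smallest_tail w"
    obtain v where v: "w = v @ u" using t(2) by (auto simp: suffix_def u_def)
    have T: "take (length w - length u) w = v" using v by simp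
    have LF: "lyndon_factorisation w = lyndon_factorisation v @ [u]"
      by (subst lyndon_factorisation.simps) (simp only: u_def[symmetric] T False if_False)
    from T have seq: "lyndon_seq (lyndon_factorisation v)" using 1[OF False] by (simp only: u_def[symmetric])
    have lu: "lyndon u"
    proof (rule lyndonI)
      show "u \<noteq> []" using t(1) by (simp add: u_def)
      fix x y assume xy: "u = x @ y" "x \<noteq> []" "y \<noteq> []"
      have "suffix y w" unfolding v xy(1) by (metis append_assoc suffixI)
      then have "u \<le> y" using t(3)[OF xy(3)] by (simp only: u_def)
      moreover have "u \<noteq> y" using xy by simp
      ultimately show "u < y" by simp
    qed
    have "u \<le> l" if "lyndon_factorisation v = ls @ [l]" for ls l
    proof (rule ccontr)
      assume "\<not> u \<le> l"
      then have "l < u" by (simp add: not_le)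
      have ll: "lyndon l" using seq that by (simp add: lyndon_seq_def)
      have "l @ u < u" by (rule lyndon_append_less[OF ll lu \<open>l < u\<close>])
      moreover have "v = concat ls @ l"
        using concat_lyndon_factorisation[of v] that by simp
      then have "suffix (l @ u) w" using v by (simp add: suffix_def)
      then have "u \<le> l @ u" using t(3)[of "l @ u"] lyndon_nonempty[OF lu] by (simp add: u_def)
      ultimately show False by simp
    qed
    then have "\<forall>x\<in>set (lyndon_factorisation v). u \<le> x"
    proof (cases "lyndon_factorisation v" rule: rev_cases)
      case (snoc ls l)
      then have "u \<le> l" "\<forall>x\<in>set ls. l \<le> x"
        using \<open>\<And>ls l. lyndon_factorisation v = ls @ [l] \<Longrightarrow> u \<le> l\<close> seq
        by (auto simp: lyndon_seq_def sorted_wrt_append)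
      then show ?thesis using snoc by auto
    qed simp
    then show ?thesis using seq lu by (simp add: LF lyndon_seq_def sorted_wrt_append)
  qed
qed

lemma lyndon_factorisation_lyndon: "lyndon u \<Longrightarrow> lyndon_factorisation u = [u]"
  using lyndon_factorisation_concat[of "[u]"] by (simp add: lyndon_seq_def)

lemma lyndon_factors: "u \<in> set (lyndon_factorisation w) \<Longrightarrow> lyndon u"
  using lyndon_seq_factorisation by (auto simp: lyndon_seq_def)

lemma lyndon_factors_lists: "w \<in> lists L \<Longrightarrow> u \<in> set (lyndon_factorisation w) \<Longrightarrow> u \<in> lists L"
  using concat_lyndon_factorisation[of w] by (metis UN_I in_lists_conv_set set_concat)

text \<open>The inverse of taking the multiset of Lyndon factors. For Lyndon words it is also the
  largest concatenation in any order, by \<open>concat_le_decreasing_concat\<close>.\<close>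

definition decreasing_concat :: "'l::linorder list multiset \<Rightarrow> 'l list"
  where "decreasing_concat M = concat (rev (sorted_list_of_multiset M))"

lemma lyndon_seq_rev_sorted:
  assumes "\<forall>u\<in>#M. lyndon u"
  shows "lyndon_seq (rev (sorted_list_of_multiset M))"
proof -
  have "sorted (sorted_list_of_multiset M)" by (rule sorted_sorted_list_of_multiset)
  then show ?thesis using assms by (simp add: lyndon_seq_def sorted_wrt_rev)
qed

lemma rev_sorted_list_of_multiset:
  assumes "sorted_wrt (\<ge>) us"
  shows "rev (sorted_list_of_multiset (mset us)) = us"
proof -
  have "sorted (rev us)" using assms by (simp add: sorted_wrt_rev)
  then have "sorted_list_of_multiset (mset (rev us)) = rev us"
    by (metis sorted_list_of_multiset_mset sorted_sort_id)
  then show ?thesis by simp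
qed

lemma decreasing_concat_mset: "sorted_wrt (\<ge>) us \<Longrightarrow> decreasing_concat (mset us) = concat us"
  unfolding decreasing_concat_def by (simp only: rev_sorted_list_of_multiset)

lemma decreasing_concat_factorisation: "decreasing_concat (mset (lyndon_factorisation w)) = w"
  using lyndon_seq_factorisation[of w]
  by (simp add: decreasing_concat_mset lyndon_seq_def concat_lyndon_factorisation)

lemma factorisation_decreasing_concat:
  "\<forall>u\<in>#M. lyndon u \<Longrightarrow> mset (lyndon_factorisation (decreasing_concat M)) = M"
  unfolding decreasing_concat_def by (simp add: lyndon_factorisation_concat lyndon_seq_rev_sorted)

lemma bij_betw_lyndon_factorisation:
  "bij_betw (\<lambda>w. mset (lyndon_factorisation w)) (lists L) {M. set_mset M \<subseteq> {w \<in> lists L. lyndon w}}"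
proof (rule bij_betwI[where g = decreasing_concat])
  show "(\<lambda>w. mset (lyndon_factorisation w)) \<in> lists L \<rightarrow> {M. set_mset M \<subseteq> {w \<in> lists L. lyndon w}}"
    using lyndon_factors lyndon_factors_lists by fastforce
  show "decreasing_concat \<in> {M. set_mset M \<subseteq> {w \<in> lists L. lyndon w}} \<rightarrow> lists L"
    by (fastforce simp: decreasing_concat_def)
  show "decreasing_concat (mset (lyndon_factorisation w)) = w" for w :: "'a list"
    by (rule decreasing_concat_factorisation)
  show "mset (lyndon_factorisation (decreasing_concat M)) = M"
    if "M \<in> {M. set_mset M \<subseteq> {w \<in> lists L. lyndon w}}" for M
    by (rule factorisation_decreasing_concat) (use that in auto)
qed

text \<open>Let l be the last Lyndon factor of the head and v the chosen tail. If l < v, then lv is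
  a Lyndon tail, and maximality of v forces l to be the whole head. Otherwise the factors of the
  head followed by v would factor the Lyndon word w into at least two parts.\<close>

lemma lyndon_standard_factors:
  assumes "lyndon w" "2 \<le> length w"
  shows "lyndon (take (standard_split w) w)" "lyndon (drop (standard_split w) w)"
proof -
  define k where "k = standard_split w"
  note k = standard_split[OF assms(2), folded k_def]
  let ?P = "\<lambda>i. 0 < i \<and> i < length w \<and> lyndon (drop i w)"
  have "length (drop (length w - 1) w) = 1" using assms(2) by simp
  then obtain a where "drop (length w - 1) w = [a]" by (metis One_nat_def length_0_conv length_Suc_conv)
  then have "lyndon (drop (length w - 1) w)" by (simp only: lyndon_singleton)
  then have ex: "?P (length w - 1)" using assms(2) by linarith
  have v: "lyndon (drop k w)" and least: "\<And>i. ?P i \<Longrightarrow> k \<le> i"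
    using LeastI[of ?P, OF ex] Least_le[of ?P] unfolding k_def standard_split_def by blast+
  then show "lyndon (drop (standard_split w) w)" by (simp add: k_def)
  have w: "w = take k w @ drop k w" by simp
  have ne: "take k w \<noteq> []" using k by auto
  have "lyndon_factorisation (take k w) \<noteq> []"
    using ne concat_lyndon_factorisation[of "take k w"] by auto
  then obtain ls l where ls: "lyndon_factorisation (take k w) = ls @ [l]"
    by (cases "lyndon_factorisation (take k w)" rule: rev_cases) auto
  have u: "take k w = concat ls @ l"
    using concat_lyndon_factorisation[of "take k w"] ls by simp
  have seq: "lyndon_seq (ls @ [l])" using lyndon_seq_factorisation[of "take k w"] ls by simp
  then have l: "lyndon l" by (simp add: lyndon_seq_def)
  show "lyndon (take (standard_split w) w)"
  proof (cases "l < drop k w")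
    case True
    then have lv: "lyndon (l @ drop k w)" using lyndon_append l v by blast
    have "concat ls = []"
    proof (rule ccontr)
      assume c: "concat ls \<noteq> []"
      have len: "length (concat ls) < k"
        using arg_cong[OF u, of length] k lyndon_nonempty[OF l] by (cases l) auto
      have "w = concat ls @ (l @ drop k w)" using u w by (metis append_assoc)
      then have "drop (length (concat ls)) w = l @ drop k w" by (metis append_eq_conv_conj)
      moreover have "0 < length (concat ls)" using c by blast
      ultimately have "?P (length (concat ls))" using lv len k(2) by (metis less_trans)
      then have "k \<le> length (concat ls)" by (rule least)
      then show False using len by linarith
    qed
    then have "take k w = l" using u by (simp only: append_Nil)
    then show ?thesis using l by (simp only: k_def)
  next
    case False
    then have "lyndon_seq (ls @ [l] @ [drop k w])"
      using seq v by (auto simp: lyndon_seq_def sorted_wrt_append intro: order_trans)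
    moreover have "concat (ls @ [l] @ [drop k w]) = w" using u w by simp
    ultimately have "lyndon_factorisation w = ls @ [l] @ [drop k w]"
      using lyndon_factorisation_concat by metis
    then show ?thesis using lyndon_factorisation_lyndon[OF assms(1)] by simp
  qed
qed

section \<open>Comparing arrangements of Lyndon words\<close>

lemma lyndon_move_right:
  "lyndon b \<Longrightarrow> (\<And>u. u \<in> set us \<Longrightarrow> lyndon u \<and> b < u) \<Longrightarrow> b @ concat us \<le> concat us @ b"
proof (induction us)
  case (Cons u us)
  have "b @ u < u @ b" using Cons.prems lyndon_commute[of b u] by simp
  then have "(b @ u) @ concat us \<le> (u @ b) @ concat us"
    by (intro append_le_same_length[OF _ less_imp_le]) auto
  also have "\<dots> \<le> u @ (concat us @ b)" using Cons by simp
  finally show ?case by simp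
qed simp

lemma decreasing_concat_union:
  assumes "\<And>a b. a \<in># A \<Longrightarrow> b \<in># B \<Longrightarrow> b \<le> a"
  shows "decreasing_concat (A + B) = decreasing_concat A @ decreasing_concat B"
proof -
  let ?us = "rev (sorted_list_of_multiset A) @ rev (sorted_list_of_multiset B)"
  have "sorted_wrt (\<ge>) ?us"
    using assms by (simp add: sorted_wrt_append sorted_wrt_rev sorted_sorted_list_of_multiset)
  from decreasing_concat_mset[OF this] show ?thesis by (simp add: decreasing_concat_def)
qed

lemma decreasing_concat_singleton [simp]: "decreasing_concat {#u#} = u"
  using decreasing_concat_mset[of "[u]"] by simp

lemma decreasing_concat_empty [simp]: "decreasing_concat {#} = []"
  by (simp add: decreasing_concat_def)

text \<open>In the decreasing arrangement x stands behind the words larger than it; moving it there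
  from the front only increases the concatenation, by \<open>lyndon_move_right\<close>.\<close>

lemma append_decreasing_concat_le:
  assumes "lyndon x" "\<And>u. u \<in># M \<Longrightarrow> lyndon u"
  shows "x @ decreasing_concat M \<le> decreasing_concat (add_mset x M)"
proof -
  let ?A = "filter_mset (\<lambda>u. x < u) M" and ?B = "filter_mset (\<lambda>u. \<not> x < u) M"
  have M: "M = ?A + ?B" by (rule multiset_partition)
  have 1: "decreasing_concat M = decreasing_concat ?A @ decreasing_concat ?B"
    using M decreasing_concat_union[of ?A ?B] by fastforce
  have "decreasing_concat (?A + ({#x#} + ?B)) = decreasing_concat ?A @ decreasing_concat ({#x#} + ?B)"
    by (rule decreasing_concat_union) (auto simp: not_less)
  also have "decreasing_concat ({#x#} + ?B) = x @ decreasing_concat ?B"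
    by (subst decreasing_concat_union) (auto simp: not_less)
  also have "?A + ({#x#} + ?B) = add_mset x M" using M by simp
  finally have 2: "decreasing_concat (add_mset x M) = decreasing_concat ?A @ x @ decreasing_concat ?B" .
  have le: "x @ decreasing_concat ?A \<le> decreasing_concat ?A @ x"
    unfolding decreasing_concat_def by (rule lyndon_move_right) (use assms in auto)
  have "(x @ decreasing_concat ?A) @ decreasing_concat ?B \<le> (decreasing_concat ?A @ x) @ decreasing_concat ?B"
    by (rule append_le_same_length[OF _ le order_refl]) simp
  then show ?thesis by (simp add: 1 2)
qed

lemma concat_le_decreasing_concat:
  "(\<And>u. u \<in> set us \<Longrightarrow> lyndon u) \<Longrightarrow> concat us \<le> decreasing_concat (mset us)"
proof (induction us)
  case (Cons u us)
  then have "u @ concat us \<le> u @ decreasing_concat (mset us)" by simp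
  also have "\<dots> \<le> decreasing_concat (add_mset u (mset us))"
    by (rule append_decreasing_concat_le) (use Cons.prems in auto)
  finally show ?case by simp
qed simp

lemma decreasing_concat_append_le:
  assumes "\<And>u. u \<in># A + B \<Longrightarrow> lyndon u"
  shows "decreasing_concat A @ decreasing_concat B \<le> decreasing_concat (A + B)"
  using concat_le_decreasing_concat[of "rev (sorted_list_of_multiset A) @ rev (sorted_list_of_multiset B)"] assms
  by (auto simp: decreasing_concat_def)

text \<open>The factorisation after prepending a Lyndon word b: it absorbs the next factor as long
  as that factor is larger, and each merger is Lyndon by \<open>lyndon_append\<close>.\<close>

fun lyndon_cons :: "'l::linorder list \<Rightarrow> 'l list list \<Rightarrow> 'l list list"
  where "lyndon_cons b [] = [b]"
  | "lyndon_cons b (v # vs) = (if b < v then lyndon_cons (b @ v) vs else b # v # vs)"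

lemma lyndon_cons:
  "lyndon b \<Longrightarrow> lyndon_seq vs \<Longrightarrow> lyndon_seq (lyndon_cons b vs) \<and> concat (lyndon_cons b vs) = b @ concat vs"
proof (induction b vs rule: lyndon_cons.induct)
  case (1 b)
  then show ?case by (simp add: lyndon_seq_def)
next
  case (2 b v vs)
  show ?case
  proof (cases "b < v")
    case True
    have "lyndon v" "lyndon_seq vs" using "2.prems"(2) by (simp_all add: lyndon_seq_def)
    then show ?thesis using "2.IH"[OF True] lyndon_append[OF "2.prems"(1) _ True] True by simp
  next
    case False
    then show ?thesis using 2 by (auto simp: lyndon_seq_def intro: order_trans)
  qed
qed

lemma factorisation_Cons: "lyndon_factorisation (a # w) = lyndon_cons [a] (lyndon_factorisation w)"
  using lyndon_cons[OF lyndon_singleton[of a] lyndon_seq_factorisation[of w]]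
    lyndon_factorisation_concat[of "lyndon_cons [a] (lyndon_factorisation w)"]
  by (simp add: concat_lyndon_factorisation)

text \<open>Moving \<open>b\<close> to the right past larger Lyndon words increases the concatenation, until \<open>b\<close>
  meets the next factor of \<open>vs\<close> and merges with it.\<close>

lemma append_le_lyndon_cons:
  "lyndon b \<Longrightarrow> lyndon_seq vs \<Longrightarrow> (\<And>u. u \<in># M \<Longrightarrow> lyndon u)
    \<Longrightarrow> b @ decreasing_concat (mset vs + M) \<le> decreasing_concat (mset (lyndon_cons b vs) + M)"
proof (induction b vs arbitrary: M rule: lyndon_cons.induct)
  case (1 b)
  then show ?case using append_decreasing_concat_le[of b M] by simp
next
  case (2 b v vs)
  show ?case
  proof (cases "b < v")
    case False
    have "b @ decreasing_concat (mset (v # vs) + M) \<le> decreasing_concat (add_mset b (mset (v # vs) + M))"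
      by (rule append_decreasing_concat_le) (use 2 in \<open>auto simp: lyndon_seq_def\<close>)
    then show ?thesis using False by simp
  next
    case True
    let ?A = "filter_mset (\<lambda>u. v \<le> u) M" and ?B = "filter_mset (\<lambda>u. \<not> v \<le> u) M"
    have M: "M = ?A + ?B" by (rule multiset_partition)
    have v: "lyndon v" and vs: "lyndon_seq vs" and v_ge: "\<forall>u\<in>set vs. u \<le> v"
      using "2.prems"(2) by (auto simp: lyndon_seq_def)
    have lc: "lyndon_seq (lyndon_cons (b @ v) vs)"
      using lyndon_cons[OF lyndon_append[OF "2.prems"(1) v True] vs] by simp
    have "mset (v # vs) + M = ?A + ({#v#} + (mset vs + ?B))" using M by simp
    also have "decreasing_concat \<dots> = decreasing_concat ?A @ decreasing_concat ({#v#} + (mset vs + ?B))"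
      by (rule decreasing_concat_union) (use v_ge in \<open>auto intro: order_trans\<close>)
    also have "decreasing_concat ({#v#} + (mset vs + ?B)) = v @ decreasing_concat (mset vs + ?B)"
      by (subst decreasing_concat_union) (use v_ge in auto)
    finally have "b @ decreasing_concat (mset (v # vs) + M)
        = (b @ decreasing_concat ?A) @ v @ decreasing_concat (mset vs + ?B)" by simp
    also have "\<dots> \<le> (decreasing_concat ?A @ b) @ v @ decreasing_concat (mset vs + ?B)"
    proof (rule append_le_same_length)
      show "b @ decreasing_concat ?A \<le> decreasing_concat ?A @ b"
        unfolding decreasing_concat_def
        by (rule lyndon_move_right) (use 2 True in auto)
    qed auto
    also have "\<dots> = decreasing_concat ?A @ ((b @ v) @ decreasing_concat (mset vs + ?B))" by simp
    also have "\<dots> \<le> decreasing_concat ?A @ decreasing_concat (mset (lyndon_cons (b @ v) vs) + ?B)"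
      using "2.IH"[OF True lyndon_append[OF "2.prems"(1) v True] vs, of ?B] "2.prems"(3) by simp
    also have "\<dots> \<le> decreasing_concat (?A + (mset (lyndon_cons (b @ v) vs) + ?B))"
      by (rule decreasing_concat_append_le) (use lc "2.prems"(3) in \<open>auto simp: lyndon_seq_def\<close>)
    also have "?A + (mset (lyndon_cons (b @ v) vs) + ?B) = mset (lyndon_cons b (v # vs)) + M"
      using M True by simp
    finally show ?thesis .
  qed
qed

text \<open>A shuffle of several words, generated from its first letter, which may be the head of
  any of them. This form allows the bound \<open>is_shuffle_le\<close> to be proved letter by
  letter, although the words met on the way are not Lyndon.\<close>

inductive is_shuffle :: "'a list multiset \<Rightarrow> 'a list \<Rightarrow> bool"
  where Nil: "(\<And>x. x \<in># X \<Longrightarrow> x = []) \<Longrightarrow> is_shuffle X []"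
  | Cons: "is_shuffle (add_mset t X) z \<Longrightarrow> is_shuffle (add_mset (a # t) X) (a # z)"

lemma is_shuffle_add_Nil: "is_shuffle X z \<Longrightarrow> is_shuffle (add_mset [] X) z"
proof (induction rule: is_shuffle.induct)
  case (Nil X)
  then show ?case by (intro is_shuffle.Nil) auto
next
  case (Cons t X z a)
  then show ?case using is_shuffle.Cons[of t "add_mset [] X" z a] by (simp add: add_mset_commute)
qed

lemma is_shuffle_add_word: "(\<And>x. x \<in># X \<Longrightarrow> x = []) \<Longrightarrow> is_shuffle (add_mset w X) w"
proof (induction w)
  case Nil
  then show ?case by (intro is_shuffle.Nil) auto
qed (simp add: is_shuffle.Cons)

lemma is_shuffle_interleavings:
  "z \<in># interleavings x y \<Longrightarrow> is_shuffle X y \<Longrightarrow> is_shuffle (add_mset x X) z"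
proof (induction x y arbitrary: z X rule: interleavings.induct)
  case (1 vs)
  then show ?case by (simp add: is_shuffle_add_Nil)
next
  case (2 u us)
  then have "z = u # us" by simp
  moreover have "\<And>x. x \<in># X \<Longrightarrow> x = []" using 2(2) by (cases rule: is_shuffle.cases) auto
  ultimately show ?case using is_shuffle_add_word by blast
next
  case (3 u us v vs)
  from "3.prems"(1) consider z' where "z = u # z'" "z' \<in># interleavings us (v # vs)"
    | z' where "z = v # z'" "z' \<in># interleavings (u # us) vs" by auto
  then show ?case
  proof cases
    case 1
    then show ?thesis using "3.IH"(1) "3.prems"(2) by (auto intro: is_shuffle.Cons)
  next
    case 2
    from "3.prems"(2) obtain t Y where Y: "X = add_mset (v # t) Y" "is_shuffle (add_mset t Y) vs"
      by (cases rule: is_shuffle.cases) auto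
    have "is_shuffle (add_mset t (add_mset (u # us) Y)) z'"
      using "3.IH"(2)[OF 2(2) Y(2)] by (simp add: add_mset_commute)
    then show ?thesis
      using is_shuffle.Cons[of t "add_mset (u # us) Y" z' v] 2(1) Y(1) by (simp add: add_mset_commute)
  qed
qed

text \<open>If the first letter a comes from the word \<open>a # t\<close>, the rest is bounded by
  the factors of t and of the other words. Prefixing a turns the factorisation of t into that of
  \<open>a # t\<close>, and \<open>append_le_lyndon_cons\<close> controls this change.\<close>

lemma is_shuffle_le:
  "is_shuffle X z \<Longrightarrow> z \<le> decreasing_concat (\<Sum>x\<in>#X. mset (lyndon_factorisation x))"
proof (induction rule: is_shuffle.induct)
  case (Nil X)
  then show ?case by simp
next
  case (Cons t X z a)
  let ?S = "\<Sum>x\<in>#X. mset (lyndon_factorisation x)"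
  have lyn: "lyndon u" if "u \<in># ?S" for u
  proof -
    have "\<exists>x. u \<in> set (lyndon_factorisation x)"
      using that by (induction X) auto
    then show ?thesis using lyndon_factors by blast
  qed
  have "a # z \<le> [a] @ decreasing_concat (mset (lyndon_factorisation t) + ?S)"
    using Cons.IH by simp
  also have "\<dots> \<le> decreasing_concat (mset (lyndon_cons [a] (lyndon_factorisation t)) + ?S)"
    by (rule append_le_lyndon_cons[OF lyndon_singleton lyndon_seq_factorisation lyn])
  finally show ?case by (simp add: factorisation_Cons)
qed

lemma is_shuffle_mset: "is_shuffle X z \<Longrightarrow> mset z = (\<Sum>x\<in>#X. mset x)"
proof (induction rule: is_shuffle.induct)
  case (Nil X)
  then show ?case by (induction X) auto
qed simp

primrec shuffle_list :: "'a list list \<Rightarrow> 'a list multiset"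
  where "shuffle_list [] = {#[]#}"
  | "shuffle_list (u # us) = (\<Sum>z\<in>#shuffle_list us. interleavings u z)"

lemma is_shuffle_shuffle_list: "z \<in># shuffle_list us \<Longrightarrow> is_shuffle (mset us) z"
  by (induction us arbitrary: z) (auto intro: is_shuffle.Nil is_shuffle_interleavings)

lemma append_in_interleavings: "x @ y \<in># interleavings x y"
proof (induction x arbitrary: y)
  case (Cons a x)
  then show ?case by (cases y) auto
qed simp

lemma concat_in_shuffle_list: "concat us \<in># shuffle_list us"
  by (induction us) (auto intro: append_in_interleavings)

text \<open>A Lyndon word is its own factorisation, so the bound of \<open>is_shuffle_le\<close> is
  the decreasing arrangement of the factors of w, namely w.\<close>

lemma shuffle_list_le:
  assumes "z \<in># shuffle_list (lyndon_factorisation w)"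
  shows "z \<le> w" "mset z = mset w"
proof -
  note s = is_shuffle_shuffle_list[OF assms]
  have "(\<Sum>x\<in>#mset us. mset (lyndon_factorisation x)) = mset us" if "\<And>u. u \<in> set us \<Longrightarrow> lyndon u" for us :: "'a list list"
    using that by (induction us) (auto simp: lyndon_factorisation_lyndon)
  then have "(\<Sum>x\<in>#mset (lyndon_factorisation w). mset (lyndon_factorisation x)) = mset (lyndon_factorisation w)"
    using lyndon_factors by blast
  then show "z \<le> w" using is_shuffle_le[OF s] by (simp add: decreasing_concat_factorisation)
  have "mset z = mset (concat (lyndon_factorisation w))"
    using is_shuffle_mset[OF s] by (simp add: mset_concat sum_mset_sum_list[symmetric])
  then show "mset z = mset w" by (simp add: concat_lyndon_factorisation)
qed


section \<open>Word bases\<close>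

lemma free_extend_sum_single:
  "free_extend f (\<Sum>i\<in>F. c i *\<^sub>R Poly_Mapping.single i 1) = (\<Sum>i\<in>F. c i *\<^sub>R f i)"
  by (simp add: linear_sum[OF linear_free_extend] linear_scale[OF linear_free_extend])

lemma basis_family_if_free:
  assumes bij: "bij_betw (free_extend f) {p. Poly_Mapping.keys p \<subseteq> I} UNIV"
  shows "is_basis_family I f"
  unfolding basis_family_iff
proof (intro conjI allI impI ballI)
  fix F c i assume F: "finite F \<and> F \<subseteq> I \<and> (\<Sum>i\<in>F. c i *\<^sub>R f i) = 0" and i: "i \<in> F"
  let ?p = "\<Sum>i\<in>F. c i *\<^sub>R Poly_Mapping.single i 1 :: 'a \<Rightarrow>\<^sub>0 real"
  have lookup: "Poly_Mapping.lookup ?p j = (if j \<in> F then c j else 0)" for j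
    using F by (simp add: lookup_sum lookup_single when_def if_distrib cong: if_cong)
  have "Poly_Mapping.keys ?p \<subseteq> I"
    using F by (auto simp: in_keys_iff lookup split: if_splits)
  moreover have "free_extend f ?p = free_extend f 0"
    using F by (simp add: free_extend_sum_single linear_0[OF linear_free_extend])
  ultimately have "?p = 0"
    using bij by (auto simp: bij_betw_def dest!: inj_onD)
  then show "c i = 0" using lookup[of i] i by simp
next
  have "h \<in> span (f ` I)" for h
  proof -
    obtain p where p: "Poly_Mapping.keys p \<subseteq> I" "h = free_extend f p"
      using bij by (auto simp: bij_betw_def image_iff set_eq_iff)
    show ?thesis
      unfolding p(2) free_extend_def using p(1) by (intro span_sum span_scale span_base) auto
  qed
  then show "span (f ` I) = UNIV" by blast
qed

text \<open>The isomorphism is constrained only on combinations of words over L. Replacing it there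
  by \<open>free_extend\<close> gives a map that is linear on the whole type.\<close>

lemma word_algebra_iso_eq_free_extend:
  assumes iso: "word_algebra_iso L times_w \<phi>" and p: "Poly_Mapping.keys p \<subseteq> lists L"
  shows "\<phi> p = free_extend (\<lambda>w. \<phi> (Poly_Mapping.single w 1)) p"
proof -
  have add: "\<phi> (p + q) = \<phi> p + \<phi> q" if "Poly_Mapping.keys p \<subseteq> lists L" "Poly_Mapping.keys q \<subseteq> lists L" for p q
    using iso that by (simp add: word_algebra_iso_def Let_def)
  have scale: "\<phi> (r *\<^sub>R p) = r *\<^sub>R \<phi> p" if "Poly_Mapping.keys p \<subseteq> lists L" for p r
    using iso that by (simp add: word_algebra_iso_def Let_def)
  have sum: "\<phi> (\<Sum>w\<in>F. c w *\<^sub>R Poly_Mapping.single w 1) = (\<Sum>w\<in>F. c w *\<^sub>R \<phi> (Poly_Mapping.single w 1))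
      \<and> Poly_Mapping.keys (\<Sum>w\<in>F. c w *\<^sub>R Poly_Mapping.single w 1 :: 'a list \<Rightarrow>\<^sub>0 real) \<subseteq> lists L"
    if "finite F" "F \<subseteq> lists L" for F and c :: "'a list \<Rightarrow> real"
    using that
  proof (induction F rule: finite_induct)
    case empty
    show ?case using scale[of 0 0] by simp
  next
    case (insert w F)
    have "Poly_Mapping.keys (c w *\<^sub>R Poly_Mapping.single w 1 :: 'a list \<Rightarrow>\<^sub>0 real) \<subseteq> {w}"
      by (auto simp: in_keys_iff lookup_single when_def split: if_splits)
    then have k: "Poly_Mapping.keys (c w *\<^sub>R Poly_Mapping.single w 1 :: 'a list \<Rightarrow>\<^sub>0 real) \<subseteq> lists L"
      using insert.prems by blast
    have "Poly_Mapping.keys (Poly_Mapping.single w 1 :: 'a list \<Rightarrow>\<^sub>0 real) \<subseteq> lists L"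
      using insert.prems by simp
    moreover have IH: "\<phi> (\<Sum>w\<in>F. c w *\<^sub>R Poly_Mapping.single w 1) = (\<Sum>w\<in>F. c w *\<^sub>R \<phi> (Poly_Mapping.single w 1))"
      "Poly_Mapping.keys (\<Sum>w\<in>F. c w *\<^sub>R Poly_Mapping.single w 1 :: 'a list \<Rightarrow>\<^sub>0 real) \<subseteq> lists L"
      using insert by auto
    moreover note order_trans[OF keys_add Un_least[OF k IH(2)]]
    ultimately show ?case
      using add[OF k IH(2)] scale insert.hyps by simp
  qed
  have "p = free_extend (\<lambda>w. Poly_Mapping.single w 1) p" by (simp add: free_extend_basis)
  then have "\<phi> p = \<phi> (\<Sum>w\<in>Poly_Mapping.keys p. Poly_Mapping.lookup p w *\<^sub>R Poly_Mapping.single w 1)"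
    by (simp add: free_extend_def)
  then show ?thesis using sum[OF _ p] by (simp add: free_extend_def)
qed

lemma word_basis:
  assumes iso: "word_algebra_iso L times_w \<phi>"
  shows "is_basis_family (lists L) (\<lambda>w. \<phi> (Poly_Mapping.single w 1))"
proof (rule basis_family_if_free)
  have "bij_betw \<phi> {p. Poly_Mapping.keys p \<subseteq> lists L} UNIV"
    using iso by (simp add: word_algebra_iso_def Let_def)
  then show "bij_betw (free_extend (\<lambda>w. \<phi> (Poly_Mapping.single w 1))) {p. Poly_Mapping.keys p \<subseteq> lists L} UNIV"
    by (rule bij_betw_cong[THEN iffD1, rotated]) (use word_algebra_iso_eq_free_extend[OF iso] in auto)
qed

lemma word_algebra_iso_mult:
  assumes iso: "word_algebra_iso L (bilinear_extension m) \<phi>" and "u \<in> lists L" "v \<in> lists L"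
  shows "\<phi> (Poly_Mapping.single u 1) * \<phi> (Poly_Mapping.single v 1) = \<phi> (m u v)"
proof -
  have "\<phi> (bilinear_extension m (Poly_Mapping.single u 1) (Poly_Mapping.single v 1))
      = \<phi> (Poly_Mapping.single u 1) * \<phi> (Poly_Mapping.single v 1)"
    using iso assms(2,3) by (simp add: word_algebra_iso_def Let_def)
  then show ?thesis by (simp add: bilinear_extension_def)
qed

lemma set_interleavings: "z \<in># interleavings u v \<Longrightarrow> set z = set u \<union> set v"
  by (induction u v arbitrary: z rule: interleavings.induct) auto

lemma shuffle_list_in_lists:
  "set us \<subseteq> lists L \<Longrightarrow> z \<in># shuffle_list us \<Longrightarrow> z \<in> lists L"
proof (induction us arbitrary: z)
  case (Cons u us)
  then obtain y where y: "y \<in># shuffle_list us" "z \<in># interleavings u y" by auto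
  then show ?case using set_interleavings[OF y(2)] Cons by (auto simp: in_lists_conv_set)
qed simp

lemma shuffle_iso_mult:
  assumes iso: "word_algebra_iso L shuffle_times \<phi>" and uv: "u \<in> lists L" "v \<in> lists L"
  shows "\<phi> (Poly_Mapping.single u 1) * \<phi> (Poly_Mapping.single v 1)
    = (\<Sum>w\<in>#interleavings u v. \<phi> (Poly_Mapping.single w 1))"
proof -
  let ?s = "\<lambda>N. (\<Sum>w\<in>#N. Poly_Mapping.single w 1) :: 'a list \<Rightarrow>\<^sub>0 real"
  have keys: "Poly_Mapping.keys (?s N) \<subseteq> set_mset N" for N
  proof (induction N)
    case (add x N)
    then show ?case using keys_add[of "Poly_Mapping.single x 1" "?s N"] by auto
  qed simp
  have "free_extend f (?s N) = (\<Sum>w\<in>#N. f w)" for N and f :: "_ \<Rightarrow> 'b"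
    by (induction N) (simp_all add: linear_0[OF linear_free_extend] linear_add[OF linear_free_extend])
  moreover have "set_mset (interleavings u v) \<subseteq> lists L"
    using uv set_interleavings[of _ u v] by (fastforce simp: in_lists_conv_set)
  then have "Poly_Mapping.keys (?s (interleavings u v)) \<subseteq> lists L" using keys by blast
  ultimately show ?thesis
    using word_algebra_iso_mult[OF iso[unfolded shuffle_times_def] uv]
      word_algebra_iso_eq_free_extend[OF iso] by simp
qed

lemma shuffle_iso_prod_list:
  assumes iso: "word_algebra_iso L shuffle_times \<phi>" and us: "set us \<subseteq> lists L"
  shows "prod_list (map (\<lambda>w. \<phi> (Poly_Mapping.single w 1)) us)
    = (\<Sum>z\<in>#shuffle_list us. \<phi> (Poly_Mapping.single z 1))"
  using us
proof (induction us)
  case Nil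
  then show ?case using iso by (simp add: word_algebra_iso_def Let_def)
next
  case (Cons u us)
  let ?P = "\<lambda>w. \<phi> (Poly_Mapping.single w 1)"
  have "?P u * (\<Sum>z\<in>#N. ?P z) = (\<Sum>z\<in>#(\<Sum>z\<in>#N. interleavings u z). ?P z)"
    if "set_mset N \<subseteq> lists L" for N
    using that
  proof (induction N)
    case (add x N)
    then show ?case using shuffle_iso_mult[OF iso, of u x] Cons.prems by (simp add: distrib_left)
  qed simp
  from this[of "shuffle_list us"] show ?case
    using Cons shuffle_list_in_lists[of us L] by auto
qed

lemma finite_same_mset: "finite {z. mset z = mset w \<and> Q z}"
  by (rule finite_subset[OF _ finite_permutations_of_multiset[of "mset w"]])
    (auto simp: permutations_of_multiset_def)

text \<open>Induction on the number of words below w with the same letters. This number is finite,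
  whereas the lexicographic order alone has infinite descents such as b > ab > aab. The relation R
  is a parameter because shuffles are triangular downwards and brackets upwards.\<close>

lemma span_if_triangular:
  assumes tri: "\<And>w. w \<in> W \<Longrightarrow> \<exists>c. c \<noteq> 0 \<and> b w - c *\<^sub>R t w \<in> span (t ` {z \<in> W. mset z = mset w \<and> R z w})"
    and R: "transp R" "irreflp R" and W: "w \<in> W"
  shows "t w \<in> span (b ` W)"
  using W
proof (induction "card {z. mset z = mset w \<and> R z w}" arbitrary: w rule: less_induct)
  case less
  obtain c where c: "c \<noteq> 0" "b w - c *\<^sub>R t w \<in> span (t ` {z \<in> W. mset z = mset w \<and> R z w})"
    using tri[OF less.prems] by blast
  have "t ` {z \<in> W. mset z = mset w \<and> R z w} \<subseteq> span (b ` W)"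
  proof (rule image_subsetI)
    fix z assume z: "z \<in> {z \<in> W. mset z = mset w \<and> R z w}"
    have "{y. mset y = mset z \<and> R y z} \<subset> {y. mset y = mset w \<and> R y w}"
    proof
      show "{y. mset y = mset z \<and> R y z} \<subseteq> {y. mset y = mset w \<and> R y w}"
        using z R(1) by (auto dest: transpD)
      have "z \<in> {y. mset y = mset w \<and> R y w}" "z \<notin> {y. mset y = mset z \<and> R y z}"
        using z R(2) by (auto dest: irreflpD)
      then show "{y. mset y = mset z \<and> R y z} \<noteq> {y. mset y = mset w \<and> R y w}" by blast
    qed
    then have "card {y. mset y = mset z \<and> R y z} < card {y. mset y = mset w \<and> R y w}"
      by (rule psubset_card_mono[OF finite_same_mset])
    then show "t z \<in> span (b ` W)" using less.hyps z by blast
  qed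
  then have 1: "b w - c *\<^sub>R t w \<in> span (b ` W)" using c(2) span_minimal[OF _ subspace_span] by blast
  have "b w \<in> span (b ` W)" using less.prems by (intro span_base) auto
  from span_diff[OF this 1] have "b w - (b w - c *\<^sub>R t w) \<in> span (b ` W)" .
  then have "c *\<^sub>R t w \<in> span (b ` W)" by simp
  then have "(1 / c) *\<^sub>R (c *\<^sub>R t w) \<in> span (b ` W)" by (rule span_scale)
  then show ?case using c(1) by simp
qed

section \<open>Eigenbases indexed by words\<close>

context finite_type_hopf_algebra
begin

theorem shuffle_eigenbasis:
  fixes L :: "'l::linorder set" and P :: "'l list \<Rightarrow> 'h"
  assumes comm: "commutative_algebra TYPE('h)" and iso: "word_algebra_iso L shuffle_times \<phi>"
    and P: "P = (\<lambda>w. \<phi> (Poly_Mapping.single w 1))"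
    and hom: "\<forall>w\<in>lists L. w \<noteq> [] \<longrightarrow> (\<exists>n\<ge>1. P w \<in> H n)" and a: "a \<ge> 2"
  defines "X \<equiv> {w \<in> lists L. lyndon w}"
  shows "is_basis_family (lists L) (shuffle_eigenvector \<Delta> P)"
    and "w \<in> lists L \<Longrightarrow> psi a (shuffle_eigenvector \<Delta> P w)
      = (real a ^ length (lyndon_factorisation w)) *\<^sub>R shuffle_eigenvector \<Delta> P w"
    and "multiplicities_given_by H \<Delta> a X (\<lambda>w. hdeg H (P w))"
proof -
  let ?d = "\<lambda>w. hdeg H (P w)" and ?F = "\<lambda>w. mset (lyndon_factorisation w)"
  let ?b = "\<lambda>w. prod_list (map P (lyndon_factorisation w))"
  have basis: "is_basis_family (lists L) P" unfolding P by (rule word_basis[OF iso])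
  have P_nonzero: "P w \<noteq> 0" if "w \<in> lists L" for w
    by (rule is_basis_family_nonzero[OF basis that])
  have P_deg: "P w \<in> H (?d w) \<and> (w \<noteq> [] \<longrightarrow> 1 \<le> ?d w)" if w: "w \<in> lists L" for w
  proof (cases "w = []")
    case True
    have "P w \<in> H 0" using iso one_in_H0 unfolding P True by (simp add: word_algebra_iso_def Let_def)
    then show ?thesis using hdeg_eq[of "P w" 0] P_nonzero[OF w] True by simp
  next
    case False
    then obtain n where "n \<ge> 1" "P w \<in> H n" using hom w by blast
    then show ?thesis using hdeg_eq[of "P w" n] P_nonzero[OF w] by simp
  qed
  have b_eq: "?b w = (\<Sum>z\<in>#shuffle_list (lyndon_factorisation w). P z)" if "w \<in> lists L" for w
    unfolding P by (rule shuffle_iso_prod_list[OF iso]) (use lyndon_factors_lists that in blast)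
  have in_L: "z \<in> lists L" if "w \<in> lists L" "z \<in># shuffle_list (lyndon_factorisation w)" for z w
    using shuffle_list_in_lists that lyndon_factors_lists by blast
  \<comment> \<open>The isomorphism need not be graded, so the degree of the product has to be
    compared with that of \<open>P w\<close>. The product is homogeneous and contains
    \<open>P w\<close> with positive multiplicity, hence has its degree.\<close>
  have b_deg: "?b w \<in> H (?d w)" if w: "w \<in> lists L" for w
  proof -
    let ?N = "shuffle_list (lyndon_factorisation w)"
    obtain f :: "'h \<Rightarrow> real" where f: "linear f" "\<forall>v\<in>P ` lists L. f v = (if v = P w then 1 else 0)"
      using linear_independent_extend[of "P ` lists L" "\<lambda>v. if v = P w then 1 else 0"] basis
      unfolding is_basis_family_def by blast
    have 1: "f (component (?d w) (P z)) = (if z = w then 1 else 0)" if "z \<in> lists L" for z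
    proof (cases "?d z = ?d w")
      case True
      then have "component (?d w) (P z) = P z"
        using P_deg[OF that] component_homogeneous by metis
      moreover have "P z = P w \<longleftrightarrow> z = w"
        using basis that w unfolding is_basis_family_def by (meson inj_onD)
      ultimately show ?thesis using f(2) that by simp
    next
      case False
      then have "component (?d w) (P z) = 0"
        using P_deg[OF that] component_homogeneous by metis
      then show ?thesis using False linear_0[OF f(1)] by auto
    qed
    have "f (component (?d w) (\<Sum>z\<in>#M. P z)) = real (count M w)" if "set_mset M \<subseteq> lists L" for M
      using that
      by (induction M) (simp_all add: linear_0[OF linear_component] linear_0[OF f(1)]
          linear_add[OF linear_component] linear_add[OF f(1)] 1)
    then have "f (component (?d w) (?b w)) = real (count ?N w)"
      unfolding b_eq[OF w] using in_L[OF w] by blast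
    moreover have "w \<in># ?N"
      using concat_in_shuffle_list[of "lyndon_factorisation w"] by (simp add: concat_lyndon_factorisation)
    ultimately have "component (?d w) (?b w) \<noteq> 0"
      using linear_0[OF f(1)] by (auto simp: count_eq_zero_iff)
    moreover have "?b w \<in> H (sum_list (map ?d (lyndon_factorisation w)))"
      by (rule prod_list_in_H) (use P_deg lyndon_factors_lists[OF w] in blast)
    ultimately show ?thesis using component_homogeneous by metis
  qed
  \<comment> \<open>The word w is the largest one in \<open>?b w\<close>. Its coefficient is a
    multiplicity, nonzero but larger than 1 when factors repeat.\<close>
  have "P w \<in> span (?b ` lists L)" if "w \<in> lists L" for w
  proof (rule span_if_triangular[where R = "(<)", OF _ _ _ that])
    fix w assume w: "w \<in> lists L"
    let ?N = "shuffle_list (lyndon_factorisation w)"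
    have "w \<in># ?N"
      using concat_in_shuffle_list[of "lyndon_factorisation w"] by (simp add: concat_lyndon_factorisation)
    moreover have "?b w - real (count ?N w) *\<^sub>R P w = (\<Sum>z\<in>#filter_mset (\<lambda>z. z \<noteq> w) ?N. P z)"
    proof -
      have "(\<Sum>z\<in>#M. P z) - real (count M w) *\<^sub>R P w = (\<Sum>z\<in>#filter_mset (\<lambda>z. z \<noteq> w) M. P z)" for M
        by (induction M) (auto simp: algebra_simps)
      then show ?thesis unfolding b_eq[OF w] .
    qed
    moreover have "(\<Sum>z\<in>#filter_mset (\<lambda>z. z \<noteq> w) ?N. P z) \<in> span (P ` {z \<in> lists L. mset z = mset w \<and> z < w})"
    proof (rule subspace_sum_mset[OF subspace_span])
      fix z assume z: "z \<in># filter_mset (\<lambda>z. z \<noteq> w) ?N"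
      then have "z < w" "mset z = mset w" "z \<in> lists L"
        using shuffle_list_le[of z w] in_L[OF w] by auto
      then show "P z \<in> span (P ` {z \<in> lists L. mset z = mset w \<and> z < w})" by (intro span_base) auto
    qed
    ultimately show "\<exists>c. c \<noteq> 0 \<and> ?b w - c *\<^sub>R P w \<in> span (P ` {z \<in> lists L. mset z = mset w \<and> z < w})"
      by (intro exI[of _ "real (count ?N w)"]) (simp add: count_eq_zero_iff)
  qed (auto simp: transp_def irreflp_def)
  then have "span (P ` lists L) \<subseteq> span (?b ` lists L)" by (intro span_minimal) auto
  then have "span (?b ` lists L) = UNIV" using basis by (auto simp: is_basis_family_def)
  then have "is_basis_family (lists L) ?b"
    using basis_if_spanning[OF basis, of ?d ?b] P_deg b_deg by blast
  moreover have prod_eq: "prod_list (map f (list_of_mset (?F w))) = prod_list (map f (lyndon_factorisation w))"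
    for f :: "'l list \<Rightarrow> 'h" and w
    by (rule prod_list_commutative[OF comm]) simp
  ultimately have "is_basis_family (lists L) ((\<lambda>M. prod_list (map P (list_of_mset M))) \<circ> ?F)"
    by (simp add: o_def)
  then have "is_basis_family {M. set_mset M \<subseteq> X} (\<lambda>M. prod_list (map P (list_of_mset M)))"
    unfolding X_def using is_basis_family_reindex[OF bij_betw_lyndon_factorisation] by blast
  note E = commutative_eigenbasis[OF comm _ this a, of ?d]
  have X: "P x \<in> H (?d x) \<and> 1 \<le> ?d x" if "x \<in> X" for x
    using that P_deg lyndon_nonempty by (auto simp: X_def)
  have e: "shuffle_eigenvector \<Delta> P u = log_id (P u)" if "u \<in> X" for u
    using that eulerian_idempotent_eq_log_id[of "P u" "?d u"] X[OF that]
    by (simp add: shuffle_eigenvector.simps[of \<Delta> P u] X_def)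
  have g: "shuffle_eigenvector \<Delta> P w = prod_list (map (\<lambda>u. log_id (P u)) (list_of_mset (?F w)))"
    if w: "w \<in> lists L" for w
  proof -
    have 1: "map (shuffle_eigenvector \<Delta> P) (lyndon_factorisation w) = map (\<lambda>u. log_id (P u)) (lyndon_factorisation w)"
    proof (rule map_cong[OF refl])
      fix u assume u: "u \<in> set (lyndon_factorisation w)"
      have "u \<in> X" unfolding X_def using lyndon_factors[OF u] lyndon_factors_lists[OF w u] by blast
      then show "shuffle_eigenvector \<Delta> P u = log_id (P u)" by (rule e)
    qed
    have "shuffle_eigenvector \<Delta> P w = prod_list (map (shuffle_eigenvector \<Delta> P) (lyndon_factorisation w))"
      by (cases "lyndon w")
        (simp_all add: lyndon_factorisation_lyndon shuffle_eigenvector.simps[of \<Delta> P w])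
    then show ?thesis unfolding prod_eq 1 .
  qed
  have "is_basis_family (lists L) ((\<lambda>M. prod_list (map (\<lambda>u. log_id (P u)) (list_of_mset M))) \<circ> ?F)"
    using is_basis_family_reindex[OF bij_betw_lyndon_factorisation] E(1)[OF X] unfolding X_def by blast
  then show "is_basis_family (lists L) (shuffle_eigenvector \<Delta> P)"
    by (rule is_basis_family_cong[THEN iffD1, rotated]) (simp add: g)
  show "psi a (shuffle_eigenvector \<Delta> P w)
      = (real a ^ length (lyndon_factorisation w)) *\<^sub>R shuffle_eigenvector \<Delta> P w" if "w \<in> lists L"
    unfolding g[OF that] using E(2)[OF X, of "?F w"] by simp
  show "multiplicities_given_by H \<Delta> a X ?d" by (rule E(3)[OF X])
qed

theorem free_eigenbasis:
  fixes L :: "'l::linorder set" and S :: "'l \<Rightarrow> 'h"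
  assumes cocomm: "cocommutative \<Delta>" and iso: "word_algebra_iso L concat_times \<phi>"
    and S: "S = (\<lambda>i. \<phi> (Poly_Mapping.single [i] 1))"
    and hom: "\<forall>i\<in>L. \<exists>n\<ge>1. S i \<in> H n" and a: "a \<ge> 2"
  defines "X \<equiv> {w \<in> lists L. lyndon w}"
  shows "is_basis_family (lists L) (free_eigenvector \<Delta> S)"
    and "w \<in> lists L \<Longrightarrow> psi a (free_eigenvector \<Delta> S w)
      = (real a ^ length (lyndon_factorisation w)) *\<^sub>R free_eigenvector \<Delta> S w"
    and "multiplicities_given_by H \<Delta> a X (\<lambda>w. hdeg H (prod_list (map S w)))"
proof -
  let ?g = "free_eigenvector \<Delta> S" and ?F = "\<lambda>w. mset (lyndon_factorisation w)"
  let ?Sw = "\<lambda>w. prod_list (map S w)" and ?Tw = "\<lambda>w. prod_list (map (\<lambda>i. log_id (S i)) w)"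
  \<comment> \<open>The unsymmetrised product: its factors stand in decreasing order, so w is its
    smallest word, which other orders of the factors can violate.\<close>
  let ?G = "\<lambda>w. prod_list (map ?g (lyndon_factorisation w))"
  let ?d = "\<lambda>w. hdeg H (?Sw w)"
  obtain d where d: "\<And>i. i \<in> L \<Longrightarrow> S i \<in> H (d i) \<and> 1 \<le> d i" using hom by metis
  have \<phi>_eq: "\<phi> (Poly_Mapping.single w 1) = ?Sw w" if "w \<in> lists L" for w
    using that
  proof (induction w)
    case Nil
    then show ?case using iso by (simp add: word_algebra_iso_def Let_def)
  next
    case (Cons i w)
    then show ?case
      using word_algebra_iso_mult[OF iso[unfolded concat_times_def], of "[i]" w] by (simp add: S)
  qed
  have basis: "is_basis_family (lists L) ?Sw"
    by (rule is_basis_family_cong[THEN iffD1, OF \<phi>_eq word_basis[OF iso]])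
  have S_deg: "?Sw w \<in> H (sum_list (map d w))" if "w \<in> lists L" for w
    by (rule prod_list_in_H) (use d that in auto)
  have d_eq: "?d w = sum_list (map d w)" if "w \<in> lists L" for w
  proof (rule hdeg_eq[OF S_deg[OF that]])
    show "?Sw w \<noteq> 0" by (rule is_basis_family_nonzero[OF basis that])
  qed
  have T_span: "span (?Tw ` lists L) = UNIV"
    by (rule log_id_generates[OF d]) (use basis in \<open>auto simp: is_basis_family_def\<close>)
  \<comment> \<open>The error terms: combinations of larger words with the same letters, written in
    the primitive elements \<open>log_id (S i)\<close> from which the brackets are built.\<close>
  define up where "up w = span (?Tw ` {z \<in> lists L. mset z = mset w \<and> w < z})" for w
  define up_eq where "up_eq w = span (?Tw ` {z \<in> lists L. mset z = mset w \<and> w \<le> z})" for w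
  have up_mult: "x * y \<in> span (?Tw ` {z \<in> lists L. mset z = mset (u @ v) \<and> R (u @ v) z})"
    if "x \<in> span (?Tw ` A)" "y \<in> span (?Tw ` B)" "A \<subseteq> lists L" "B \<subseteq> lists L"
      "\<And>s t. s \<in> A \<Longrightarrow> t \<in> B \<Longrightarrow> mset (s @ t) = mset (u @ v) \<and> R (u @ v) (s @ t)" for x y u v A B R
  proof (rule span_mult[OF that(1,2)])
    fix a b assume "a \<in> ?Tw ` A" "b \<in> ?Tw ` B"
    then obtain s t where st: "s \<in> A" "t \<in> B" "a = ?Tw s" "b = ?Tw t" by blast
    then show "a * b \<in> span (?Tw ` {z \<in> lists L. mset z = mset (u @ v) \<and> R (u @ v) z})"
      using that(3,4) that(5)[OF st(1,2)] by (intro span_base image_eqI[of _ _ "s @ t"]) auto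
  qed
  \<comment> \<open>Equal letters force equal length, so a strict comparison of the left factors is
    decided at a differing letter and survives multiplication on the right.\<close>
  have len: "length s = length u" if "mset s = mset u" for s u :: "'l list"
    using that by (metis size_mset)
  have less_append: "u @ v < s @ t" if "mset s = mset u" "u < s" for s t u v :: "'l list"
    using less_append_same_length[of u s v t] len[OF that(1)] that(2) by simp
  have le_append: "u @ v \<le> s @ t" if "mset s = mset u" "u \<le> s" "v \<le> t" for s t u v :: "'l list"
    using append_le_same_length[of u s v t] len[OF that(1)] that by simp
  have mult_up_left: "x * y \<in> up (u @ v)" if "x \<in> up u" "y \<in> up_eq v" for x y u v
    unfolding up_def
    by (rule up_mult[OF that[unfolded up_def up_eq_def]]) (use less_append in auto)
  have mult_up_right: "x * y \<in> up (u @ v)" if "x \<in> up_eq u" "y \<in> up v" for x y u v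
    unfolding up_def
    by (rule up_mult[OF that[unfolded up_def up_eq_def]])
      (use append_le_same_length less_append len in \<open>auto simp: order.order_iff_strict\<close>)
  have mult_up_eq: "x * y \<in> up_eq (u @ v)" if "x \<in> up_eq u" "y \<in> up_eq v" for x y u v
    unfolding up_eq_def
    by (rule up_mult[OF that[unfolded up_eq_def]]) (use le_append in auto)
  have T_up_eq: "?Tw w \<in> up_eq w" if "w \<in> lists L" for w
    unfolding up_eq_def using that by (intro span_base) auto
  have up_up_eq: "up w \<subseteq> up_eq w" for w
    unfolding up_def up_eq_def by (intro span_mono image_mono) auto
  have lead_mult: "x * y - ?Tw (u @ v) \<in> up (u @ v) \<and> x * y \<in> up_eq (u @ v)"
    if x: "x - ?Tw u \<in> up u" "u \<in> lists L" and y: "y - ?Tw v \<in> up v" "v \<in> lists L" for x y u v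
  proof -
    have y': "y \<in> up_eq v"
      using span_add[OF _ T_up_eq[OF y(2), unfolded up_eq_def], of "y - ?Tw v"] y(1) up_up_eq[of v]
      unfolding up_eq_def by auto
    have x': "x \<in> up_eq u"
      using span_add[OF _ T_up_eq[OF x(2), unfolded up_eq_def], of "x - ?Tw u"] x(1) up_up_eq[of u]
      unfolding up_eq_def by auto
    have "(x - ?Tw u) * y + ?Tw u * (y - ?Tw v) \<in> up (u @ v)"
      using mult_up_left[OF x(1) y'] mult_up_right[OF T_up_eq[OF x(2)] y(1)]
      unfolding up_def by (rule span_add)
    then show ?thesis using mult_up_eq[OF x' y'] by (simp add: algebra_simps)
  qed
  have lyndon_lead: "primitive \<Delta> (?g w) \<and> ?g w \<in> H (sum_list (map d w)) \<and> ?g w - ?Tw w \<in> up w"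
    if "w \<in> X" for w
    using that
  proof (induction "length w" arbitrary: w rule: less_induct)
    case less
    have w: "w \<in> lists L" "lyndon w" using less.prems by (auto simp: X_def)
    show ?case
    proof (cases "length w = 1")
      case True
      then obtain i where i: "w = [i]" by (auto simp: length_Suc_conv)
      then have iL: "i \<in> L" using w(1) by simp
      have "?g w = log_id (S i)"
        using eulerian_idempotent_eq_log_id[of "S i" "d i"] d[OF iL] i
        by (simp add: free_eigenvector.simps[of \<Delta> S "[i]"])
      moreover have "0 \<in> up w" by (simp add: up_def span_zero)
      ultimately show ?thesis
        using primitive_log_id[OF cocomm, of "S i" "d i"] log_id_in_H[of "S i" "d i"] d[OF iL] i by simp
    next
      case False
      then have l2: "2 \<le> length w" using lyndon_nonempty[OF w(2)] by (cases w rule: remdups_adj.cases) auto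
      define u v where "u = take (standard_split w) w" and "v = drop (standard_split w) w"
      have lyn: "lyndon u" "lyndon v"
        unfolding u_def v_def by (rule lyndon_standard_factors[OF w(2) l2])+
      have "w = u @ v" by (simp add: u_def v_def)
      note uv = this lyn lyndon_nonempty[OF lyn(1)] lyndon_nonempty[OF lyn(2)]
      have X: "u \<in> X" "v \<in> X" using uv w(1) by (auto simp: X_def)
      have g: "?g w = ?g u * ?g v - ?g v * ?g u"
        using False w(2) by (simp add: free_eigenvector.simps[of \<Delta> S w] u_def v_def)
      have IH: "primitive \<Delta> (?g u) \<and> ?g u \<in> H (sum_list (map d u)) \<and> ?g u - ?Tw u \<in> up u"
        "primitive \<Delta> (?g v) \<and> ?g v \<in> H (sum_list (map d v)) \<and> ?g v - ?Tw v \<in> up v"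
        using less.hyps[OF _ X(1)] less.hyps[OF _ X(2)] uv by simp_all
      have L: "u \<in> lists L" "v \<in> lists L" using X by (auto simp: X_def)
      have "?g u * ?g v \<in> H (sum_list (map d w))" "?g v * ?g u \<in> H (sum_list (map d w))"
        using mult_H[of "?g u" "sum_list (map d u)" "?g v" "sum_list (map d v)"]
          mult_H[of "?g v" "sum_list (map d v)" "?g u" "sum_list (map d u)"] IH uv(1)
        by (simp_all add: add.commute)
      then have "?g w \<in> H (sum_list (map d w))" unfolding g by (rule subspace_diff[OF subspace_H])
      moreover have "primitive \<Delta> (?g w)" unfolding g using IH by (intro primitive_commutator) auto
      moreover have "?g u * ?g v - ?Tw w \<in> up w"
        using lead_mult[of "?g u" u "?g v" v] IH L uv(1) by auto
      \<comment> \<open>The leading word vu of the reversed product is a proper rotation of the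
        Lyndon word w = uv, hence larger, so the whole product is an error term.\<close>
      moreover have "?g v * ?g u \<in> up w"
      proof -
        have "?g v * ?g u \<in> up_eq (v @ u)" using lead_mult[of "?g v" v "?g u" u] IH L by auto
        moreover have "w < v @ u" using lyndon_rotate[of u v] w(2) uv by simp
        then have "up_eq (v @ u) \<subseteq> up w"
          unfolding up_def up_eq_def uv(1) by (intro span_mono image_mono) auto
        ultimately show ?thesis by blast
      qed
      ultimately show ?thesis
        unfolding g up_def using span_diff[of "?g u * ?g v - ?Tw w" _ "?g v * ?g u"] by (simp add: algebra_simps)
    qed
  qed
  have seq_lead: "prod_list (map ?g us) - ?Tw (concat us) \<in> up (concat us) \<and> concat us \<in> lists L"
    if "set us \<subseteq> X" for us
    using that
  proof (induction us)
    case Nil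
    show ?case by (simp add: up_def span_zero)
  next
    case (Cons u us)
    have u: "?g u - ?Tw u \<in> up u" "u \<in> lists L" using lyndon_lead[of u] Cons.prems by (auto simp: X_def)
    have us: "prod_list (map ?g us) - ?Tw (concat us) \<in> up (concat us)" "concat us \<in> lists L"
      using Cons by auto
    show ?case using lead_mult[OF u us] u(2) us(2) by simp
  qed
  have LF: "set (lyndon_factorisation w) \<subseteq> X" if "w \<in> lists L" for w
    using lyndon_factors lyndon_factors_lists[OF that] by (auto simp: X_def)
  have "?Tw w \<in> span (?G ` lists L)" if "w \<in> lists L" for w
  proof (rule span_if_triangular[where R = "(>)", OF _ _ _ that])
    fix w assume w: "w \<in> lists L"
    have "?G w - ?Tw w \<in> up w" using seq_lead[OF LF[OF w]] by (simp add: concat_lyndon_factorisation)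
    then show "\<exists>c. c \<noteq> 0 \<and> ?G w - c *\<^sub>R ?Tw w \<in> span (?Tw ` {z \<in> lists L. mset z = mset w \<and> z > w})"
      by (intro exI[of _ 1]) (simp add: up_def)
  qed (auto simp: transp_def irreflp_def)
  then have "span (?Tw ` lists L) \<subseteq> span (?G ` lists L)" by (intro span_minimal) auto
  then have G_span: "span (?G ` lists L) = UNIV" using T_span by auto
  have sum_d: "(\<Sum>u\<in>#?F w. sum_list (map d u)) = sum_list (map d w)" for w
  proof -
    have "(\<Sum>u\<in>#mset us. sum_list (map d u)) = sum_list (map d (concat us))" for us
      by (induction us) auto
    from this[of "lyndon_factorisation w"] show ?thesis by (simp only: concat_lyndon_factorisation)
  qed
  have G_deg: "?G w \<in> H (sum_list (map d w))" if "w \<in> lists L" for w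
  proof -
    have "?G w \<in> H (sum_list (map (\<lambda>u. sum_list (map d u)) (lyndon_factorisation w)))"
      by (rule prod_list_in_H) (use lyndon_lead LF[OF that] in auto)
    then show ?thesis using sum_d[of w] by (simp add: sum_mset_sum_list[symmetric])
  qed
  have G_basis: "is_basis_family (lists L) ?G"
    by (rule basis_if_spanning[OF basis S_deg G_deg G_span])
  have G_eq: "?G u = ?g u" if "u \<in> X" for u
    using that by (simp add: X_def lyndon_factorisation_lyndon)
  have G_X: "?G ` X = ?g ` X" "inj_on ?G X = inj_on ?g X"
    by (rule image_cong[OF refl G_eq], assumption) (rule inj_on_cong[OF G_eq])
  \<comment> \<open>For Lyndon w the product has the single factor \<open>?g w\<close>, so the
    brackets form a subfamily of the basis \<open>?G\<close> and are independent.\<close>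
  have "inj_on ?G X" "independent (?G ` X)"
  proof -
    have XL: "X \<subseteq> lists L" by (auto simp: X_def)
    have G: "inj_on ?G (lists L)" "independent (?G ` lists L)"
      using G_basis by (auto simp: is_basis_family_def)
    show "inj_on ?G X" by (rule inj_on_subset[OF G(1) XL])
    show "independent (?G ` X)" by (rule independent_mono[OF G(2) image_mono[OF XL]])
  qed
  then have "inj_on ?g X \<and> independent (?g ` X)" using G_X by simp
  from independent_symprod[OF _ this] lyndon_lead
  have ind: "inj_on (\<lambda>M. symprod (image_mset ?g M)) {M. set_mset M \<subseteq> X}
      \<and> independent ((\<lambda>M. symprod (image_mset ?g M)) ` {M. set_mset M \<subseteq> X})" by blast
  have bij: "bij_betw ?F (lists L) {M. set_mset M \<subseteq> X}"
    unfolding X_def by (rule bij_betw_lyndon_factorisation)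
  have sym_basis: "is_basis_family (lists L) ((\<lambda>M. symprod (image_mset ?g M)) \<circ> ?F)"
  proof (rule basis_if_independent[OF basis S_deg])
    show "((\<lambda>M. symprod (image_mset ?g M)) \<circ> ?F) w \<in> H (sum_list (map d w))" if "w \<in> lists L" for w
      using symprod_in_H[of "?F w" ?g "\<lambda>u. sum_list (map d u)"] lyndon_lead LF[OF that] sum_d[of w] by auto
    have "?F ` lists L = {M. set_mset M \<subseteq> X}" "inj_on ?F (lists L)"
      using bij by (auto simp: bij_betw_def)
    then show "inj_on ((\<lambda>M. symprod (image_mset ?g M)) \<circ> ?F) (lists L)
      \<and> independent (((\<lambda>M. symprod (image_mset ?g M)) \<circ> ?F) ` lists L)"
      using ind by (metis comp_inj_on image_comp)
  qed
  then have sym_basis': "is_basis_family {M. set_mset M \<subseteq> X} (\<lambda>M. symprod (image_mset ?g M))"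
    using is_basis_family_reindex[OF bij] by blast
  \<comment> \<open>The three recursive cases agree in this form: a Lyndon word, in particular a
    letter, has one factor.\<close>
  have g_eq: "?g w = symprod (image_mset ?g (?F w))" for w
  proof (cases "lyndon w")
    case True
    then show ?thesis using symprod_step[of "{#?g w#}"] by (simp add: lyndon_factorisation_lyndon)
  next
    case False
    then have "length w \<noteq> 1" by (auto simp: length_Suc_conv lyndon_singleton)
    then show ?thesis using False
      by (subst free_eigenvector.simps) (simp add: symmetrized_product_eq_symprod)
  qed
  have X: "primitive \<Delta> (?g u) \<and> ?g u \<in> H (?d u) \<and> 1 \<le> ?d u" if u: "u \<in> X" for u
  proof -
    have uL: "u \<in> lists L" "lyndon u" using u by (auto simp: X_def)
    then obtain i w where "u = i # w" "i \<in> L" using lyndon_nonempty by (cases u) auto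
    then have "1 \<le> sum_list (map d u)" using d[of i] by simp
    then show ?thesis using lyndon_lead[OF u] unfolding d_eq[OF uL(1)] by blast
  qed
  show "is_basis_family (lists L) ?g"
    by (rule is_basis_family_cong[THEN iffD1, OF _ sym_basis]) (simp add: g_eq[symmetric])
  show "psi a (?g w) = (real a ^ length (lyndon_factorisation w)) *\<^sub>R ?g w" if "w \<in> lists L"
    using primitive_eigenbasis(1)[OF X sym_basis' a, of "?F w"] LF[OF that] g_eq[of w] by simp
  show "multiplicities_given_by H \<Delta> a X ?d"
    by (rule primitive_eigenbasis(2)[OF X sym_basis' a])
qed

end

theorem theorem2p5p1:
  fixes H :: "nat \<Rightarrow> 'h::real_algebra_1 set"
    and \<Delta> :: "'h \<Rightarrow> 'h tensor_algebra"
    and a :: nat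
  assumes hopf: "graded_connected_hopf_algebra H \<Delta>"
    and finite_dim: "\<forall>n. \<exists>B. finite B \<and> H n = span B"
    and a: "a \<ge> 2"
  shows
    "(\<forall>C. commutative_algebra TYPE('h) \<and> free_generating_set H C \<longrightarrow>
        (let b = (\<lambda>M. prod_list (map (eulerian_idempotent \<Delta>) (list_of_mset M)))
         in is_basis_family {M. set_mset M \<subseteq> C} b \<and>
            (\<forall>M. set_mset M \<subseteq> C \<longrightarrow> is_eigenvector (hopf_power \<Delta> a) (real a ^ size M) (b M)) \<and>
            multiplicities_given_by H \<Delta> a C (hdeg H)))
     \<and>
     (\<forall>P. cocommutative \<Delta> \<and> homogeneous_primitive_basis H \<Delta> P \<longrightarrow>
        (let b = (\<lambda>M. symmetrized_product (list_of_mset M))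
         in is_basis_family {M. set_mset M \<subseteq> P} b \<and>
            (\<forall>M. set_mset M \<subseteq> P \<longrightarrow> is_eigenvector (hopf_power \<Delta> a) (real a ^ size M) (b M)) \<and>
            multiplicities_given_by H \<Delta> a P (hdeg H)))
     \<and>
     (\<forall>L \<phi> P. commutative_algebra TYPE('h) \<and> is_alphabet L \<and>
        word_algebra_iso L shuffle_times \<phi> \<and>
        P = (\<lambda>w. \<phi> (Poly_Mapping.single w 1)) \<and>
        (\<forall>w\<in>lists L. w \<noteq> [] \<longrightarrow> (\<exists>n\<ge>1. P w \<in> H n)) \<longrightarrow>
        (let g = shuffle_eigenvector \<Delta> P
         in is_basis_family (lists L) g \<and>
            (\<forall>w\<in>lists L. is_eigenvector (hopf_power \<Delta> a)
               (real a ^ length (lyndon_factorisation w)) (g w)) \<and>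
            multiplicities_given_by H \<Delta> a {w \<in> lists L. lyndon w} (\<lambda>w. hdeg H (P w))))
     \<and>
     (\<forall>L \<phi> S. cocommutative \<Delta> \<and> is_alphabet L \<and>
        word_algebra_iso L concat_times \<phi> \<and>
        S = (\<lambda>i. \<phi> (Poly_Mapping.single [i] 1)) \<and>
        (\<forall>i\<in>L. \<exists>n\<ge>1. S i \<in> H n) \<longrightarrow>
        (let g = free_eigenvector \<Delta> S
         in is_basis_family (lists L) g \<and>
            (\<forall>w\<in>lists L. is_eigenvector (hopf_power \<Delta> a)
               (real a ^ length (lyndon_factorisation w)) (g w)) \<and>
            multiplicities_given_by H \<Delta> a {w \<in> lists L. lyndon w}
              (\<lambda>w. hdeg H (prod_list (map S w)))))"
proof -
  interpret finite_type_hopf_algebra H \<Delta>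
    by (intro finite_type_hopf_algebra.intro hopf finite_type_hopf_algebra_axioms.intro) (use finite_dim in blast)
  have hp: "hopf_power \<Delta> a = psi a" using hopf_power_eq_psi[of a] a by auto
  have A: "is_basis_family {M. set_mset M \<subseteq> C} (\<lambda>M. prod_list (map (eulerian_idempotent \<Delta>) (list_of_mset M)))
      \<and> (\<forall>M. set_mset M \<subseteq> C \<longrightarrow> is_eigenvector (hopf_power \<Delta> a) (real a ^ size M)
            (prod_list (map (eulerian_idempotent \<Delta>) (list_of_mset M))))
      \<and> multiplicities_given_by H \<Delta> a C (hdeg H)"
    if "commutative_algebra TYPE('h) \<and> free_generating_set H C" for C
  proof -
    have comm: "commutative_algebra TYPE('h)" and C: "free_generating_set H C" using that by auto
    let ?I = "{M. set_mset M \<subseteq> C}"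
    have "is_basis_family ?I (\<lambda>M. prod_list (list_of_mset M))"
    proof (rule basis_family_if_free)
      have eq: "{p. \<forall>M\<in>Poly_Mapping.keys p. set_mset M \<subseteq> C} = {p. Poly_Mapping.keys p \<subseteq> ?I}" by auto
      show "bij_betw (free_extend (\<lambda>M. prod_list (list_of_mset M))) {p. Poly_Mapping.keys p \<subseteq> ?I} UNIV"
        using C unfolding free_generating_set_def eval_polynomial_def eq by blast
    qed
    then have basis: "is_basis_family ?I (\<lambda>M. prod_list (map (\<lambda>c. c) (list_of_mset M)))" by simp
    have deg: "c \<in> H (hdeg H c) \<and> 1 \<le> hdeg H c" if "c \<in> C" for c
    proof -
      obtain n where n: "n \<ge> 1" "c \<in> H n" using C \<open>c \<in> C\<close> unfolding free_generating_set_def by blast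
      \<comment> \<open>\<open>hdeg\<close> is meaningful for nonzero elements; c is nonzero as the
        basis member belonging to the multiset \<open>{#c#}\<close>.\<close>
      have "list_of_mset {#c#} = [c]"
        using mset_list_of_mset[of "{#c#}"] by (metis mset_single_iff)
      then have "c \<noteq> 0"
        using is_basis_family_nonzero[OF basis, of "{#c#}"] \<open>c \<in> C\<close> by simp
      then show ?thesis using hdeg_eq[OF n(2)] n by simp
    qed
    note E = commutative_eigenbasis[OF comm deg basis a]
    have eq: "prod_list (map (eulerian_idempotent \<Delta>) (list_of_mset M)) = prod_list (map log_id (list_of_mset M))"
      if "set_mset M \<subseteq> C" for M
      by (intro arg_cong[of _ _ prod_list] map_cong refl eulerian_idempotent_eq_log_id[OF deg[THEN conjunct1] deg[THEN conjunct2]])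
        (use that in auto)
    have B: "is_basis_family ?I (\<lambda>M. prod_list (map (eulerian_idempotent \<Delta>) (list_of_mset M)))"
      by (rule is_basis_family_cong[THEN iffD2, OF _ E(1)]) (use eq in auto)
    have "is_eigenvector (hopf_power \<Delta> a) (real a ^ size M)
        (prod_list (map (eulerian_idempotent \<Delta>) (list_of_mset M)))" if "set_mset M \<subseteq> C" for M
      by (rule eigenvector_of_basis[OF B _ _ a]) (use that E(2) eq in auto)
    with B E(3) show ?thesis by blast
  qed
  have B: "is_basis_family {M. set_mset M \<subseteq> P} (\<lambda>M. symmetrized_product (list_of_mset M))
      \<and> (\<forall>M. set_mset M \<subseteq> P \<longrightarrow> is_eigenvector (hopf_power \<Delta> a) (real a ^ size M)
            (symmetrized_product (list_of_mset M)))
      \<and> multiplicities_given_by H \<Delta> a P (hdeg H)"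
    if "cocommutative \<Delta> \<and> homogeneous_primitive_basis H \<Delta> P" for P
  proof -
    have cocomm: "cocommutative \<Delta>" and P: "homogeneous_primitive_basis H \<Delta> P" using that by auto
    have span: "span P = {x. primitive \<Delta> x}" and ind: "independent P" and hom: "\<forall>p\<in>P. \<exists>n. p \<in> H n"
      using P by (simp_all add: homogeneous_primitive_basis_def)
    have deg: "primitive \<Delta> ((\<lambda>p. p) p) \<and> (\<lambda>p. p) p \<in> H (hdeg H p) \<and> 1 \<le> hdeg H p" if "p \<in> P" for p
    proof -
      obtain n where n: "p \<in> H n" using hom \<open>p \<in> P\<close> by blast
      have "p \<in> {x. primitive \<Delta> x}" unfolding span[symmetric] by (rule span_base[OF that])
      then have "primitive \<Delta> p" by simp
      moreover have "p \<noteq> 0" using ind dependent_zero[of P] that by metis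
      ultimately show ?thesis using hdeg_eq[OF n] primitive_positive[OF _ n] n by simp
    qed
    have "inj_on (\<lambda>p. p) P \<and> independent ((\<lambda>p. p) ` P)" using ind by simp
    \<comment> \<open>Without a reference basis, independence and spanning come from separate
      arguments.\<close>
    from independent_symprod[OF _ this] deg cocommutative_span_symprod[OF cocomm span]
    have basis: "is_basis_family {M. set_mset M \<subseteq> P} (\<lambda>M. symprod (image_mset (\<lambda>p. p) M))"
      by (simp add: is_basis_family_def)
    note E = primitive_eigenbasis[OF deg basis a]
    have "is_eigenvector (hopf_power \<Delta> a) (real a ^ size M) (symprod (image_mset (\<lambda>p. p) M))"
      if "set_mset M \<subseteq> P" for M
      by (rule eigenvector_of_basis[OF basis _ E(1) a]) (use that in auto)
    with basis E(2) show ?thesis by (simp add: symmetrized_product_eq_symprod)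
  qed
  have A': "is_basis_family (lists L) (shuffle_eigenvector \<Delta> P)
      \<and> (\<forall>w\<in>lists L. is_eigenvector (hopf_power \<Delta> a) (real a ^ length (lyndon_factorisation w))
            (shuffle_eigenvector \<Delta> P w))
      \<and> multiplicities_given_by H \<Delta> a {w \<in> lists L. lyndon w} (\<lambda>w. hdeg H (P w))"
    if "commutative_algebra TYPE('h) \<and> is_alphabet L \<and> word_algebra_iso L shuffle_times \<phi> \<and>
      P = (\<lambda>w. \<phi> (Poly_Mapping.single w 1)) \<and> (\<forall>w\<in>lists L. w \<noteq> [] \<longrightarrow> (\<exists>n\<ge>1. P w \<in> H n))"
    for L :: "nat set" and \<phi> P
  proof -
    note E = shuffle_eigenbasis[OF that[THEN conjunct1] that[THEN conjunct2, THEN conjunct2, THEN conjunct1]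
        that[THEN conjunct2, THEN conjunct2, THEN conjunct2, THEN conjunct1]
        that[THEN conjunct2, THEN conjunct2, THEN conjunct2, THEN conjunct2] a]
    show ?thesis
      by (intro conjI ballI E(1,3) eigenvector_of_basis[OF E(1) _ E(2) a])
  qed
  have B': "is_basis_family (lists L) (free_eigenvector \<Delta> S)
      \<and> (\<forall>w\<in>lists L. is_eigenvector (hopf_power \<Delta> a) (real a ^ length (lyndon_factorisation w))
            (free_eigenvector \<Delta> S w))
      \<and> multiplicities_given_by H \<Delta> a {w \<in> lists L. lyndon w} (\<lambda>w. hdeg H (prod_list (map S w)))"
    if "cocommutative \<Delta> \<and> is_alphabet L \<and> word_algebra_iso L concat_times \<phi> \<and>
      S = (\<lambda>i. \<phi> (Poly_Mapping.single [i] 1)) \<and> (\<forall>i\<in>L. \<exists>n\<ge>1. S i \<in> H n)"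
    for L :: "nat set" and \<phi> S
  proof -
    note E = free_eigenbasis[OF that[THEN conjunct1] that[THEN conjunct2, THEN conjunct2, THEN conjunct1]
        that[THEN conjunct2, THEN conjunct2, THEN conjunct2, THEN conjunct1]
        that[THEN conjunct2, THEN conjunct2, THEN conjunct2, THEN conjunct2] a]
    show ?thesis
      by (intro conjI ballI E(1,3) eigenvector_of_basis[OF E(1) _ E(2) a])
  qed
  show ?thesis
    unfolding Let_def
  proof (rule conjI[OF _ conjI[OF _ conjI]])
  qed (intro allI impI, erule A B A' B')+
qed

end
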